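(* Let $0\le k\le\mu$ be integers. (i) For $f\in\mathrm{Im}(R_\mu)$, $((\nu+1)B_\nu)^{-1}(f)$ converges uniformly to $f$ as $\nu\to\infty$. (ii) For $f\in C(\mathbb{CP}^1)$, $((\mu+\nu-2k+1)B_{\mu+\nu-2k})^{-1}E^\nu_{\mu,k}(f)$ converges uniformly on $\mathbb{C}$ to $E_{\mu,k}(f)$ as $\nu\to\infty$.
   Context: For an integer $\tau\ge0$, $\mathcal{H}_\tau$ is the space of polynomials in one complex variable of degree $\le\tau$, with inner product $\langle f,g\rangle=\int_{\mathbb{C}}f\overline g\,d\iota_\tau$, $d\iota_\tau(z)=\frac{\tau+1}{(1+|z|^2)^\tau}\frac{dA(z)}{\pi(1+|z|^2)^2}$ ($dA$ Lebesgue measure); $d\iota:=d\iota_0$. It has reproducing kernel $K^\tau(x,y)=(1+x\overline y)^\tau$; the kernel of $\Gamma\in B(\mathcal{H}_\tau)$ is $\Gamma(x,y):=\Gamma(K^\tau(\cdot,y))(x)$. $C(\mathbb{CP}^1)$: continuous functions on $\mathbb{C}$ extending continuously to $\infty$, sup norm. $R_\tau(\Gamma)(z)=\Gamma(z,z)/(1+|z|^2)^\tau$ and $\mathrm{Im}(R_\mu)=\{R_\mu(\Gamma):\Gamma\in B(\mathcal{H}_\mu)\}$, a finite-dimensional subspace of $C(\mathbb{CP}^1)$. $R_\tau^*(f)$ is the operator $(R_\tau^*(f)h)(x)=\frac1{\tau+1}\int f(z)h(z)(1+x\overline z)^\tau d\iota_\tau(z)$, and $B_\tau(f)(z)=\int_{\mathbb{C}}\frac{|1+z\overline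 s|^{2\tau}}{(1+|z|^2)^\tau(1+|s|^2)^\tau}f(s)\,d\iota(s)$. For $\tau\ge\mu$, $B_\tau$ maps $\mathrm{Im}(R_\mu)$ bijectively onto itself, and $(cB_\tau)^{-1}$ denotes the inverse of $cB_\tau$ restricted to $\mathrm{Im}(R_\mu)$. $\mathcal{H}_\mu\otimes\mathcal{H}_\nu$ is realized as polynomials $F(z,w)$ of degree $\le\mu$ in $z$, $\le\nu$ in $w$, inner product of $L^2(d\iota_\mu(z)d\iota_\nu(w))$; $J_k(F)(\xi)=\int F(z,w)(\overline z-\overline w)^k(1+\xi\overline z)^{\mu-k}(1+\xi\overline w)^{\nu-k}d\iota_\mu(z)d\iota_\nu(w)\in\mathcal{H}_{\mu+\nu-2k}$; $C_{\mu,\nu,k}>0$ with $C_{\mu,\nu,k}^2=\frac{(-\nu)_k(-\mu)_k}{k!(\mu+\nu-2k+2)_k}$ (rising Pochhammer symbols); $P_k=C_{\mu,\nu,k}J_k$; $\mathcal{T}^\nu_{\mu,k}(A)=P_k(A\otimes I)P_k^*$. For $\nu>\mu$, $E^\nu_{\mu,k}(f):=R_{\mu+\nu-2k}(\mathcal{T}^\nu_{\mu,k}(R_\mu^*(f)))$, which lies in $\mathrm{Im}(R_\mu)$, and $E_{\mu,k}(f):=\binom{\mu}{k}\sum_{l=0}^k(-1)^{k-l}\binom kl B_{\mu-l}(f)$. *)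

theory Defs
  imports "HOL-Analysis.Analysis"
begin

definition iota :: "nat \<Rightarrow> complex measure" where
  "iota \<tau> = density lborel
     (\<lambda>z. ennreal ((real \<tau> + 1) / (pi * (1 + (cmod z)\<^sup>2) ^ (\<tau> + 2))))"

definition Hsp :: "nat \<Rightarrow> (complex \<Rightarrow> complex) set" where
  "Hsp \<tau> = {p. \<exists>a::nat \<Rightarrow> complex. p = (\<lambda>z. \<Sum>i\<le>\<tau>. a i * z ^ i)}"

text \<open>B(H_tau): linear operators on H_tau (bounded automatically, finite dimension).\<close>
definition Bop :: "nat \<Rightarrow> ((complex \<Rightarrow> complex) \<Rightarrow> (complex \<Rightarrow> complex)) set" where
  "Bop \<tau> = {\<Gamma>. (\<forall>h\<in>Hsp \<tau>. \<Gamma> h \<in> Hsp \<tau>) \<and>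
     (\<forall>g\<in>Hsp \<tau>. \<forall>h\<in>Hsp \<tau>. \<forall>c::complex.
        \<Gamma> (\<lambda>z. c * g z + h z) = (\<lambda>z. c * \<Gamma> g z + \<Gamma> h z))}"

definition Kker :: "nat \<Rightarrow> complex \<Rightarrow> complex \<Rightarrow> complex" where
  "Kker \<tau> x y = (1 + x * cnj y) ^ \<tau>"

definition opker :: "nat \<Rightarrow> ((complex \<Rightarrow> complex) \<Rightarrow> (complex \<Rightarrow> complex)) \<Rightarrow> complex \<Rightarrow> complex \<Rightarrow> complex" where
  "opker \<tau> \<Gamma> x y = \<Gamma> (\<lambda>x'. Kker \<tau> x' y) x"

definition Rmap :: "nat \<Rightarrow> ((complex \<Rightarrow> complex) \<Rightarrow> (complex \<Rightarrow> complex)) \<Rightarrow> complex \<Rightarrow> complex" where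
  "Rmap \<tau> \<Gamma> z = opker \<tau> \<Gamma> z z / of_real ((1 + (cmod z)\<^sup>2) ^ \<tau>)"

definition ImR :: "nat \<Rightarrow> (complex \<Rightarrow> complex) set" where
  "ImR \<mu> = Rmap \<mu> ` Bop \<mu>"

definition Rstar :: "nat \<Rightarrow> (complex \<Rightarrow> complex) \<Rightarrow> (complex \<Rightarrow> complex) \<Rightarrow> (complex \<Rightarrow> complex)" where
  "Rstar \<tau> f = (\<lambda>h x. (1 / of_nat (\<tau> + 1)) *
      (\<integral>z. f z * h z * (1 + x * cnj z) ^ \<tau> \<partial>iota \<tau>))"

definition Bber :: "nat \<Rightarrow> (complex \<Rightarrow> complex) \<Rightarrow> complex \<Rightarrow> complex" where
  "Bber \<tau> f z = (\<integral>s. of_real ((cmod (1 + z * cnj s)) ^ (2 * \<tau>) /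
        ((1 + (cmod z)\<^sup>2) ^ \<tau> * (1 + (cmod s)\<^sup>2) ^ \<tau>)) * f s \<partial>iota 0)"

definition invB :: "real \<Rightarrow> nat \<Rightarrow> nat \<Rightarrow> (complex \<Rightarrow> complex) \<Rightarrow> (complex \<Rightarrow> complex)" where
  "invB c \<tau> \<mu> g = (THE h. h \<in> ImR \<mu> \<and> (\<lambda>z. of_real c * Bber \<tau> h z) = g)"

text \<open>H_mu tensor H_nu as polynomials F(z,w) of bidegree at most (mu,nu).\<close>
definition Tsp :: "nat \<Rightarrow> nat \<Rightarrow> (complex \<Rightarrow> complex \<Rightarrow> complex) set" where
  "Tsp \<mu> \<nu> = {F. \<exists>a::nat \<Rightarrow> nat \<Rightarrow> complex.
      F = (\<lambda>z w. \<Sum>i\<le>\<mu>. \<Sum>j\<le>\<nu>. a i j * z ^ i * w ^ j)}"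

definition hinner :: "nat \<Rightarrow> (complex \<Rightarrow> complex) \<Rightarrow> (complex \<Rightarrow> complex) \<Rightarrow> complex" where
  "hinner \<tau> f g = (\<integral>z. f z * cnj (g z) \<partial>iota \<tau>)"

definition tinner :: "nat \<Rightarrow> nat \<Rightarrow> (complex \<Rightarrow> complex \<Rightarrow> complex) \<Rightarrow> (complex \<Rightarrow> complex \<Rightarrow> complex) \<Rightarrow> complex" where
  "tinner \<mu> \<nu> F G = (\<integral>p. F (fst p) (snd p) * cnj (G (fst p) (snd p)) \<partial>(iota \<mu> \<Otimes>\<^sub>M iota \<nu>))"

definition Jk :: "nat \<Rightarrow> nat \<Rightarrow> nat \<Rightarrow> (complex \<Rightarrow> complex \<Rightarrow> complex) \<Rightarrow> complex \<Rightarrow> complex" where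
  "Jk \<mu> \<nu> k F = (\<lambda>\<xi>. \<integral>p. F (fst p) (snd p) * (cnj (fst p) - cnj (snd p)) ^ k
       * (1 + \<xi> * cnj (fst p)) ^ (\<mu> - k) * (1 + \<xi> * cnj (snd p)) ^ (\<nu> - k)
       \<partial>(iota \<mu> \<Otimes>\<^sub>M iota \<nu>))"

definition Cconst :: "nat \<Rightarrow> nat \<Rightarrow> nat \<Rightarrow> real" where
  "Cconst \<mu> \<nu> k = sqrt (pochhammer (- real \<nu>) k * pochhammer (- real \<mu>) k /
      (fact k * pochhammer (real (\<mu> + \<nu> - 2 * k) + 2) k))"

definition Pk :: "nat \<Rightarrow> nat \<Rightarrow> nat \<Rightarrow> (complex \<Rightarrow> complex \<Rightarrow> complex) \<Rightarrow> complex \<Rightarrow> complex" where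
  "Pk \<mu> \<nu> k F = (\<lambda>\<xi>. of_real (Cconst \<mu> \<nu> k) * Jk \<mu> \<nu> k F \<xi>)"

definition Pkadj :: "nat \<Rightarrow> nat \<Rightarrow> nat \<Rightarrow> (complex \<Rightarrow> complex) \<Rightarrow> (complex \<Rightarrow> complex \<Rightarrow> complex)" where
  "Pkadj \<mu> \<nu> k g = (THE F. F \<in> Tsp \<mu> \<nu> \<and>
      (\<forall>G\<in>Tsp \<mu> \<nu>. hinner (\<mu> + \<nu> - 2 * k) (Pk \<mu> \<nu> k G) g = tinner \<mu> \<nu> G F))"

definition tensorI :: "((complex \<Rightarrow> complex) \<Rightarrow> (complex \<Rightarrow> complex)) \<Rightarrow> (complex \<Rightarrow> complex \<Rightarrow> complex) \<Rightarrow> (complex \<Rightarrow> complex \<Rightarrow> complex)" where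
  "tensorI A F = (\<lambda>z w. A (\<lambda>z'. F z' w) z)"

definition Top :: "nat \<Rightarrow> nat \<Rightarrow> nat \<Rightarrow> ((complex \<Rightarrow> complex) \<Rightarrow> (complex \<Rightarrow> complex)) \<Rightarrow> ((complex \<Rightarrow> complex) \<Rightarrow> (complex \<Rightarrow> complex))" where
  "Top \<mu> \<nu> k A = (\<lambda>g. Pk \<mu> \<nu> k (tensorI A (Pkadj \<mu> \<nu> k g)))"

definition Enu :: "nat \<Rightarrow> nat \<Rightarrow> nat \<Rightarrow> (complex \<Rightarrow> complex) \<Rightarrow> complex \<Rightarrow> complex" where
  "Enu \<mu> \<nu> k f = Rmap (\<mu> + \<nu> - 2 * k) (Top \<mu> \<nu> k (Rstar \<mu> f))"

definition Emk :: "nat \<Rightarrow> nat \<Rightarrow> (complex \<Rightarrow> complex) \<Rightarrow> complex \<Rightarrow> complex" where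
  "Emk \<mu> k f = (\<lambda>z. of_nat (\<mu> choose k) *
      (\<Sum>l\<le>k. (-1) ^ (k - l) * of_nat (k choose l) * Bber (\<mu> - l) f z))"

text \<open>C(CP^1): continuous functions on C with a limit at infinity.\<close>
definition CP1 :: "(complex \<Rightarrow> complex) set" where
  "CP1 = {f. continuous_on UNIV f \<and> (\<exists>L. (f \<longlongrightarrow> L) at_infinity)}"

end

theory Submission
  imports Defs "HOL-Computational_Algebra.Polynomial"
begin

text \<open>
  Write \<open>t = sphker z s\<close> for the normalised kernel \<open>|1 + z cnj s|^2 / ((1 + |z|^2) (1 + |s|^2))\<close>. Everything rests on
  the permanent-type formula for inner products of products of powers of linear forms with respect to \<open>iota N\<close>.

  It shows that \<open>(\<tau> + 1) B\<^sub>\<tau>\<close> maps \<open>t ^ m\<close>, and its polarisations, to \<open>\<Sum>j\<le>m. a\<^sub>m\<^sub>j(\<tau>) t ^ j\<close>, a triangular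
  system whose coefficients tend to those of the identity as \<open>\<tau>\<close> grows. The polarised zonal functions span \<open>ImR \<mu>\<close>
  (by a discrete Fourier transform), so inverting the triangular system gives preimages converging uniformly. Injectivity
  follows from surjectivity because \<open>B\<^sub>\<tau>\<close> is self-adjoint.

  For the second claim, \<open>P\<^sub>k\<^sup>*\<close> sends the reproducing kernel at \<open>\<xi>\<close> to a multiple of
  \<open>(z - w) ^ k (1 + cnj \<xi> z) ^ (\<mu> - k) (1 + cnj \<xi> w) ^ (\<nu> - k)\<close>, and the same formula, applied in the variable \<open>w\<close>,
  writes \<open>E\<^sup>\<nu>\<^sub>\<mu>\<^sub>,\<^sub>k f\<close> as a combination, with convergent coefficients, of the \<open>\<nu>\<close>-independent functions
  \<open>\<integral> f t ^ (\<mu> - k) (1 - t) ^ j d\<iota>\<close>, \<open>j \<le> k\<close>, of which only \<open>j = k\<close> survives in the limit.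
\<close>

section \<open>The measures iota\<close>

text \<open>Both \<open>invB\<close> and \<open>Pkadj\<close> are definite descriptions, so
  existence and uniqueness have to precede any statement about them. Diagonalising the Berezin
  transform would go through the decomposition of \<open>ImR \<mu>\<close> under rotations; a
  triangular system with nonzero diagonal is enough for explicit preimages.

  Uniform convergence never calls for an estimate in \<open>z\<close>: every function that occurs is
  ultimately a combination of a fixed number of fixed bounded functions, so only scalars have to
  converge. In the second claim these scalars contain
  \<open>((\<nu> - k) choose j) / ((\<mu> + \<nu> - k + 1) choose k)\<close>, which is of order
  \<open>\<nu> ^ (j - k)\<close>; this is why only the top term survives, and the binomial expansion
  of \<open>(1 - t) ^ k\<close> is the origin of the alternating sum in \<open>Emk\<close>.

  The geometric input is Lagrange's identity in two complex dimensions,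
  \<open>norm_identity\<close>: it converts the mutual pairings of the linear forms
  \<open>1 + cnj \<xi> * w\<close> and \<open>z - w\<close> into \<open>1 - t\<close>.\<close>

lemma borel_measurable_cnj [measurable]: "cnj \<in> borel_measurable borel"
  by (intro borel_measurable_continuous_onI continuous_intros)

lemma nn_integral_lborel_translate:
  fixes f :: "complex \<Rightarrow> ennreal"
  assumes [measurable]: "f \<in> borel_measurable borel"
  shows "(\<integral>\<^sup>+x. f (x + a) \<partial>lborel) = (\<integral>\<^sup>+x. f x \<partial>lborel)"
proof -
  have "(\<integral>\<^sup>+x. f x \<partial>lborel) = (\<integral>\<^sup>+x. f x \<partial>(distr lborel borel ((+) a)))"
    by (simp add: lborel_distr_plus)
  also have "\<dots> = (\<integral>\<^sup>+x. f (a + x) \<partial>lborel)"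
    by (rule nn_integral_distr) auto
  finally show ?thesis by (simp add: add.commute)
qed

text \<open>Convolving with the indicator of the unit ball, which is rotation invariant, reduces rotation invariance
  of Lebesgue measure to its translation invariance.\<close>

lemma nn_integral_lborel_rotate:
  fixes f :: "complex \<Rightarrow> ennreal"
  assumes [measurable]: "f \<in> borel_measurable borel" and w: "cmod w = 1"
  shows "(\<integral>\<^sup>+x. f (w * x) \<partial>lborel) = (\<integral>\<^sup>+x. f x \<partial>lborel)"
proof -
  have wc: "w * cnj w = 1" using w by (simp add: complex_norm_square[symmetric])
  define g :: "complex \<Rightarrow> ennreal" where "g = indicator (ball 0 1)"
  have gm[measurable]: "g \<in> borel_measurable borel" unfolding g_def by (intro borel_measurable_indicator) simp
  have g_rot: "g (y - w * x) = g (cnj w * y - x)" for x y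
  proof -
    have "y - w * x = w * (cnj w * y - x)"
      by (simp add: right_diff_distrib wc flip: mult.assoc)
    then have "cmod (y - w * x) = cmod (cnj w * y - x)" using w by (simp add: norm_mult)
    then show ?thesis by (simp add: g_def indicator_def)
  qed
  have g_neg: "g (- x) = g x" for x by (simp add: g_def indicator_def)
  define c where "c = (\<integral>\<^sup>+y. g y \<partial>lborel)"
  have c: "c = emeasure lborel (ball (0::complex) 1)" by (simp add: c_def g_def)
  have c0: "c \<noteq> 0"
    unfolding c using content_ball_pos[of 1 "0::complex"]
    by (auto simp: measure_def)
  have cinf: "c \<noteq> \<infinity>" unfolding c using emeasure_lborel_ball_finite[of "0::complex" 1] by simp
  have "(\<integral>\<^sup>+x. f (w * x) \<partial>lborel) * c = (\<integral>\<^sup>+x. (f (w * x) * c) \<partial>lborel)"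
    by (simp add: nn_integral_multc)
  also have "\<dots> = (\<integral>\<^sup>+x. (\<integral>\<^sup>+y. f (w * x) * g (y + - (w * x)) \<partial>lborel) \<partial>lborel)"
    by (intro nn_integral_cong, subst nn_integral_cmult) (simp_all add: nn_integral_lborel_translate c_def del: add_uminus_conv_diff)
  also have "\<dots> = (\<integral>\<^sup>+y. (\<integral>\<^sup>+x. f (w * x) * g (y + - (w * x)) \<partial>lborel) \<partial>lborel)"
    by (rule lborel_pair.Fubini') measurable
  also have "\<dots> = (\<integral>\<^sup>+y. (\<integral>\<^sup>+x. f (w * x + y) * g x \<partial>lborel) \<partial>lborel)"
  proof (rule nn_integral_cong)
    fix y
    have "(\<integral>\<^sup>+x. f (w * x) * g (y + - (w * x)) \<partial>lborel) = (\<integral>\<^sup>+x. f (w * x) * g (cnj w * y - x) \<partial>lborel)"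
      by (simp add: g_rot)
    \<comment> \<open>Translating by \<open>cnj w * y\<close> removes \<open>y\<close> from the
      argument of \<open>g\<close>, which becomes \<open>- x\<close>; symmetry of the ball applies,
      and \<open>y\<close> can then be integrated out of \<open>f\<close> alone.\<close>
    also have "\<dots> = (\<integral>\<^sup>+x. f (w * (x + cnj w * y)) * g (cnj w * y - (x + cnj w * y)) \<partial>lborel)"
      by (rule nn_integral_lborel_translate[symmetric]) measurable
    also have "\<dots> = (\<integral>\<^sup>+x. f (w * x + y) * g x \<partial>lborel)"
    proof (intro nn_integral_cong)
      fix x
      have "w * (x + cnj w * y) = w * x + y"
        by (simp add: distrib_left wc flip: mult.assoc)
      then show "f (w * (x + cnj w * y)) * g (cnj w * y - (x + cnj w * y)) = f (w * x + y) * g x"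
        by (simp add: g_neg)
    qed
    finally show "(\<integral>\<^sup>+x. f (w * x) * g (y + - (w * x)) \<partial>lborel) = (\<integral>\<^sup>+x. f (w * x + y) * g x \<partial>lborel)"
      by simp
  qed
  also have "\<dots> = (\<integral>\<^sup>+x. (\<integral>\<^sup>+y. f (w * x + y) * g x \<partial>lborel) \<partial>lborel)"
    by (rule lborel_pair.Fubini') measurable
  also have "\<dots> = (\<integral>\<^sup>+x. (\<integral>\<^sup>+y. f y \<partial>lborel) * g x \<partial>lborel)"
    by (intro nn_integral_cong, subst nn_integral_multc)
       (simp_all add: nn_integral_lborel_translate[of f] add.commute)
  also have "\<dots> = (\<integral>\<^sup>+y. f y \<partial>lborel) * c"
    by (simp add: nn_integral_cmult c_def)
  finally show ?thesis
    using c0 cinf by (simp add: mult.commute[of _ c] ennreal_mult_cancel_left)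
qed

lemma distr_lborel_rotate:
  assumes "cmod w = 1"
  shows "distr lborel borel ((*) w) = (lborel :: complex measure)"
proof (rule measure_eqI)
  fix A assume "A \<in> sets (distr lborel borel ((*) w))"
  then have A[measurable]: "A \<in> sets borel" by simp
  have "emeasure (distr lborel borel ((*) w)) A = (\<integral>\<^sup>+x. indicator A x \<partial>distr lborel borel ((*) w))"
    by simp
  also have "\<dots> = (\<integral>\<^sup>+x. indicator A (w * x) \<partial>lborel)"
    by (rule nn_integral_distr) auto
  also have "\<dots> = (\<integral>\<^sup>+x. indicator A x \<partial>lborel)"
    by (rule nn_integral_lborel_rotate) (use assms in auto)
  also have "\<dots> = emeasure lborel A" by simp
  finally show "emeasure (distr lborel borel ((*) w)) A = emeasure lborel A" .
qed simp

lemma has_real_derivative_inverse_power_one_plus: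
  fixes r :: real
  assumes "1 + r > 0"
  shows "((\<lambda>r. inverse ((1 + r) ^ Suc n)) has_real_derivative - (real (Suc n) / (1 + r) ^ (n + 2))) (at r)"
proof -
  have d: "((\<lambda>r. (1 + r) ^ Suc n) has_real_derivative real (Suc n) * (1 + r) ^ n) (at r)"
    by (rule derivative_eq_intros refl)+ simp
  have "- (inverse ((1 + r) ^ Suc n) * (real (Suc n) * (1 + r) ^ n) * inverse ((1 + r) ^ Suc n))
      = - (real (Suc n) / (1 + r) ^ (n + 2))"
    using assms by (simp add: divide_simps power_add power2_eq_square)
  then show ?thesis using DERIV_inverse'[OF d] assms by simp
qed

text \<open>Layer-cake integration: a disc of squared radius \<open>r\<close> has area \<open>pi * r\<close>.\<close>

lemma nn_integral_radial_power:
  "(\<integral>\<^sup>+z. ennreal (1 / (1 + (cmod z)\<^sup>2) ^ (n + 2)) \<partial>lborel) = ennreal (pi / (real n + 1))"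
proof -
  \<comment> \<open>\<open>h\<close> is the derivative of \<open>- 1 / (1 + r) ^ (n + 2)\<close>, so
    its integral from \<open>x\<close> to infinity is the integrand at
    \<open>x = |z|^2\<close>.\<close>
  define h where "h r = (real n + 2) / (1 + r) ^ (n + 3)" for r :: real
  have hm[measurable]: "h \<in> borel_measurable borel" unfolding h_def by measurable
  have layer: "ennreal (1 / (1 + x) ^ (n + 2)) = (\<integral>\<^sup>+r. ennreal (h r) * indicator {x..} r \<partial>lborel)"
    if "x \<ge> 0" for x :: real
  proof -
    have "(\<integral>\<^sup>+r. ennreal (h r) * indicator {x..} r \<partial>lborel) = ennreal (0 - (- 1 / (1 + x) ^ (n + 2)))"
    proof (rule nn_integral_FTC_atLeast)
      fix r assume r: "x \<le> r"
      have "((\<lambda>r. - inverse ((1 + r) ^ (n + 2))) has_real_derivative h r) (at r)"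
        using DERIV_minus[OF has_real_derivative_inverse_power_one_plus[of r "Suc n"]] r that
        by (simp add: h_def add.commute eval_nat_numeral)
      then show "((\<lambda>r. - 1 / (1 + r) ^ (n + 2)) has_real_derivative h r) (at r)"
        by (simp add: divide_inverse)
    next
      show "((\<lambda>r. - 1 / (1 + r) ^ (n + 2)) \<longlongrightarrow> 0) (at_top :: real filter)"
        by (intro tendsto_divide_0[OF tendsto_const] filterlim_at_top_imp_at_infinity filterlim_pow_at_top
              filterlim_tendsto_add_at_top[OF tendsto_const] filterlim_ident) auto
    qed (use that in \<open>auto simp: h_def\<close>)
    then show ?thesis by simp
  qed
  have "(\<integral>\<^sup>+z. ennreal (1 / (1 + (cmod z)\<^sup>2) ^ (n + 2)) \<partial>lborel) =
        (\<integral>\<^sup>+(z::complex). (\<integral>\<^sup>+r. ennreal (h r) * indicator {(cmod z)\<^sup>2..} r \<partial>lborel) \<partial>lborel)"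
    by (intro nn_integral_cong layer) simp
  also have "\<dots> = (\<integral>\<^sup>+(z::complex). (\<integral>\<^sup>+r. (if (cmod z)\<^sup>2 \<le> r then ennreal (h r) else 0) \<partial>lborel) \<partial>lborel)"
    by (intro nn_integral_cong) (auto simp: indicator_def)
  also have "\<dots> = (\<integral>\<^sup>+r. (\<integral>\<^sup>+(z::complex). (if (cmod z)\<^sup>2 \<le> r then ennreal (h r) else 0) \<partial>lborel) \<partial>lborel)"
    by (rule lborel_pair.Fubini') measurable
  also have "\<dots> = (\<integral>\<^sup>+r. ennreal (pi * r * h r) * indicator {0..} r \<partial>lborel)"
  proof (intro nn_integral_cong)
    fix r :: real
    show "(\<integral>\<^sup>+(z::complex). (if (cmod z)\<^sup>2 \<le> r then ennreal (h r) else 0) \<partial>lborel) = ennreal (pi * r * h r) * indicator {0..} r"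
    proof (cases "r \<ge> 0")
      case True
      have "(\<integral>\<^sup>+(z::complex). (if (cmod z)\<^sup>2 \<le> r then ennreal (h r) else 0) \<partial>lborel)
          = (\<integral>\<^sup>+(z::complex). ennreal (h r) * indicator (cball 0 (sqrt r)) z \<partial>lborel)"
        by (intro nn_integral_cong) (auto simp: indicator_def real_le_rsqrt True sqrt_ge_absD dest: real_le_rsqrt)
      also have "\<dots> = ennreal (h r) * ennreal (pi * r)"
        using True by (subst nn_integral_cmult_indicator) (auto simp: emeasure_cball unit_ball_vol_numeral)
      finally show ?thesis using True by (simp add: ennreal_mult' [symmetric] h_def mult_ac)
    next
      case False
      have "\<not> (cmod z)\<^sup>2 \<le> r" for z
        using False by (meson order_trans zero_le_power2)
      then show ?thesis using False by simp
    qed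
  qed
  \<comment> \<open>Writing \<open>r = (1 + r) - 1\<close> splits \<open>r * h r\<close> into two
    pure powers of \<open>1 + r\<close>, whose antiderivatives are the two terms here.\<close>
  also have "\<dots> = ennreal (0 - (- pi * ((real n + 2) / (real n + 1) * inverse ((1 + 0) ^ (n + 1)) - inverse ((1 + 0) ^ (n + 2)))))"
  proof (rule nn_integral_FTC_atLeast)
    fix r :: real assume r: "0 \<le> r"
    show "((\<lambda>r. - pi * ((real n + 2) / (real n + 1) * inverse ((1 + r) ^ (n + 1)) - inverse ((1 + r) ^ (n + 2))))
        has_real_derivative pi * r * h r) (at r)"
    proof (rule DERIV_cong)
      show "((\<lambda>r. - pi * ((real n + 2) / (real n + 1) * inverse ((1 + r) ^ (n + 1)) - inverse ((1 + r) ^ (n + 2))))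
        has_real_derivative - pi * ((real n + 2) / (real n + 1) * (- (real (Suc n) / (1 + r) ^ (n + 2)))
           - (- (real (Suc (Suc n)) / (1 + r) ^ (Suc n + 2))))) (at r)"
        using has_real_derivative_inverse_power_one_plus[of r n] has_real_derivative_inverse_power_one_plus[of r "Suc n"] r
        by (intro DERIV_cmult DERIV_diff) simp_all
      have "(real n + 2) / (real n + 1) * (- (real (Suc n) / (1 + r) ^ (n + 2))) = - ((real n + 2) * (1 + r) / (1 + r) ^ (n + 3))"
        using r by (simp add: divide_simps power_add power2_eq_square power3_eq_cube) (simp add: algebra_simps)
      then show "- pi * ((real n + 2) / (real n + 1) * (- (real (Suc n) / (1 + r) ^ (n + 2)))
           - (- (real (Suc (Suc n)) / (1 + r) ^ (Suc n + 2)))) = pi * r * h r"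
        by (simp add: h_def eval_nat_numeral del: power_Suc distrib_left_numeral)
          (simp add: algebra_simps add_divide_distrib diff_divide_distrib del: power_Suc)
    qed
  next
    have "((\<lambda>r. - pi * ((real n + 2) / (real n + 1) * inverse ((1 + r) ^ (n + 1)) - inverse ((1 + r) ^ (n + 2))))
       \<longlongrightarrow> - pi * ((real n + 2) / (real n + 1) * 0 - 0)) (at_top :: real filter)"
      by (intro tendsto_mult tendsto_diff tendsto_const tendsto_inverse_0_at_top filterlim_pow_at_top
              filterlim_tendsto_add_at_top[OF tendsto_const] filterlim_ident) auto
    then show "((\<lambda>r. - pi * ((real n + 2) / (real n + 1) * inverse ((1 + r) ^ (n + 1)) - inverse ((1 + r) ^ (n + 2))))
       \<longlongrightarrow> 0) (at_top :: real filter)" by simp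
  qed (auto simp: h_def)
  also have "0 - (- pi * ((real n + 2) / (real n + 1) * inverse ((1 + 0) ^ (n + 1)) - inverse ((1 + 0) ^ (n + 2)))) = pi / (real n + 1)"
    by (simp add: field_simps)
  finally show ?thesis .
qed


section \<open>Normalisation, integrability and moments of the probability measures
  \<open>iota N\<close>\<close>

lemma space_iota [simp]: "space (iota N) = UNIV"
  and sets_iota [simp, measurable_cong]: "sets (iota N) = sets borel"
  by (simp_all add: iota_def)

lemma one_plus_norm_sq_pos [simp]: "0 < 1 + (cmod z)\<^sup>2" "1 + (cmod z)\<^sup>2 \<noteq> 0" "0 \<le> 1 + (cmod z)\<^sup>2"
  by (smt (verit) zero_le_power2)+

lemma emeasure_iota_UNIV: "emeasure (iota N) UNIV = 1"
proof -
  have "emeasure (iota N) UNIV = (\<integral>\<^sup>+z. ennreal ((real N + 1) / (pi * (1 + (cmod z)\<^sup>2) ^ (N + 2))) \<partial>lborel)"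
    by (simp add: iota_def emeasure_density)
  also have "\<dots> = (\<integral>\<^sup>+z. ennreal ((real N + 1) / pi) * ennreal (1 / (1 + (cmod z)\<^sup>2) ^ (N + 2)) \<partial>lborel)"
    by (intro nn_integral_cong) (simp add: ennreal_mult' [symmetric])
  also have "\<dots> = ennreal ((real N + 1) / pi) * ennreal (pi / (real N + 1))"
    by (subst nn_integral_cmult) (simp_all add: nn_integral_radial_power del: add_2_eq_Suc' One_nat_def)
  also have "\<dots> = 1"
    by (simp add: ennreal_mult' [symmetric])
  finally show ?thesis .
qed

lemma finite_measure_iota [simp]: "finite_measure (iota N)"
  by standard (simp add: emeasure_iota_UNIV)

lemma sigma_finite_iota [simp]: "sigma_finite_measure (iota N)"
  using finite_measure_iota finite_measure_def by blast

lemma pair_sigma_finite_iota [simp]: "pair_sigma_finite (iota M) (iota N)"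
  by (simp add: pair_sigma_finite_def)

lemma measure_iota_UNIV [simp]: "measure (iota N) UNIV = 1"
  by (simp add: measure_def emeasure_iota_UNIV)

text \<open>Passing to the single probability measure \<open>iota 0\<close> makes integrability a
  matter of boundedness: a measurable function is integrable against \<open>iota N\<close> once its
  quotient by \<open>(1 + |z|^2) ^ N\<close> is bounded.\<close>

lemma iota_eq_density_iota_0:
  "iota N = density (iota 0) (\<lambda>z. ennreal ((real N + 1) / (1 + (cmod z)\<^sup>2) ^ N))"
  unfolding iota_def
  by (subst density_density_eq)
     (auto intro!: density_cong simp: ennreal_mult' [symmetric] power_add field_simps)

lemma integrable_iotaI:
  fixes f :: "complex \<Rightarrow> complex"
  assumes [measurable]: "f \<in> borel_measurable borel"
    and int: "integrable (iota 0) (\<lambda>z. f z / of_real ((1 + (cmod z)\<^sup>2) ^ N))"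
  shows "integrable (iota N) f"
proof -
  have "(\<lambda>z. ((real N + 1) / (1 + (cmod z)\<^sup>2) ^ N) *\<^sub>R f z) =
      (\<lambda>z. of_real (real N + 1) * (f z / of_real ((1 + (cmod z)\<^sup>2) ^ N)))"
    by (auto simp: scaleR_conv_of_real)
  then have "integrable (iota 0) (\<lambda>z. ((real N + 1) / (1 + (cmod z)\<^sup>2) ^ N) *\<^sub>R f z)"
    using integrable_mult_right[OF int, of "of_real (real N + 1)"] by (simp only:)
  then show ?thesis
    by (subst iota_eq_density_iota_0, subst integrable_density) (auto intro!: AE_I2)
qed

lemma integral_iota:
  fixes f :: "complex \<Rightarrow> complex"
  assumes [measurable]: "f \<in> borel_measurable borel"
  shows "(\<integral>z. f z \<partial>iota N) = of_nat (N + 1) * (\<integral>z. f z / of_real ((1 + (cmod z)\<^sup>2) ^ N) \<partial>iota 0)"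
proof -
  have "(\<integral>z. f z \<partial>iota N) = (\<integral>z. ((real N + 1) / (1 + (cmod z)\<^sup>2) ^ N) *\<^sub>R f z \<partial>iota 0)"
    by (subst iota_eq_density_iota_0, subst integral_density) (auto intro!: AE_I2)
  also have "\<dots> = (\<integral>z. of_nat (N + 1) * (f z / of_real ((1 + (cmod z)\<^sup>2) ^ N)) \<partial>iota 0)"
    by (intro Bochner_Integration.integral_cong) (auto simp: scaleR_conv_of_real)
  also have "\<dots> = of_nat (N + 1) * (\<integral>z. f z / of_real ((1 + (cmod z)\<^sup>2) ^ N) \<partial>iota 0)"
    by (rule integral_mult_right_zero)
  finally show ?thesis .
qed

lemma integrable_iota_bounded:
  fixes f :: "complex \<Rightarrow> complex"
  assumes [measurable]: "f \<in> borel_measurable borel"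
    and bd: "\<And>z. cmod (f z) \<le> C * (1 + (cmod z)\<^sup>2) ^ N"
  shows "integrable (iota N) f"
proof (rule integrable_iotaI)
  have "cmod (f z / of_real ((1 + (cmod z)\<^sup>2) ^ N)) \<le> C" for z
  proof -
    have "cmod (f z / of_real ((1 + (cmod z)\<^sup>2) ^ N)) = cmod (f z) / (1 + (cmod z)\<^sup>2) ^ N"
      by (simp only: norm_divide norm_of_real) simp
    then show ?thesis using bd[of z] by (simp add: divide_le_eq)
  qed
  then show "integrable (iota 0) (\<lambda>z. f z / of_real ((1 + (cmod z)\<^sup>2) ^ N))"
    by (intro finite_measure.integrable_const_bound[where B = C] AE_I2) auto
qed measurable

lemma integrable_iota_0_bounded:
  fixes f :: "complex \<Rightarrow> complex"
  assumes "f \<in> borel_measurable borel" and "\<And>z. cmod (f z) \<le> C"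
  shows "integrable (iota 0) f"
  by (rule integrable_iota_bounded[where C = C]) (use assms in auto)

text \<open>A monomial of degree at most \<open>N\<close> is dominated by the square root of the
  weight \<open>(1 + |z|^2) ^ N\<close>, so a product of two such factors uses up exactly the
  available weight.\<close>

lemma norm_power_le_one_plus:
  assumes "i \<le> N"
  shows "cmod z ^ i \<le> sqrt (1 + (cmod z)\<^sup>2) ^ N"
proof -
  have 1: "cmod z \<le> sqrt (1 + (cmod z)\<^sup>2)" by (simp add: real_le_rsqrt)
  have "cmod z ^ i \<le> sqrt (1 + (cmod z)\<^sup>2) ^ i" by (rule power_mono[OF 1]) simp
  also have "\<dots> \<le> sqrt (1 + (cmod z)\<^sup>2) ^ N" by (rule power_increasing[OF assms]) simp
  finally show ?thesis .
qed

lemma sqrt_power_mult_self: "sqrt (1 + (cmod z)\<^sup>2) ^ N * sqrt (1 + (cmod z)\<^sup>2) ^ N = (1 + (cmod z)\<^sup>2) ^ N"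
  by (simp flip: power_mult_distrib)

lemma integrable_iota_monomial:
  assumes "i \<le> N" "j \<le> N"
  shows "integrable (iota N) (\<lambda>z. z ^ i * cnj z ^ j)"
proof (rule integrable_iota_bounded[where C = 1])
  fix z
  have "cmod (z ^ i * cnj z ^ j) = cmod z ^ i * cmod z ^ j" by (simp add: norm_mult norm_power)
  also have "\<dots> \<le> sqrt (1 + (cmod z)\<^sup>2) ^ N * sqrt (1 + (cmod z)\<^sup>2) ^ N"
    using assms by (intro mult_mono norm_power_le_one_plus) auto
  finally show "cmod (z ^ i * cnj z ^ j) \<le> 1 * (1 + (cmod z)\<^sup>2) ^ N" by (simp add: sqrt_power_mult_self)
qed measurable

text \<open>A beta integral obtained without a change of variables: with \<open>x = |z|^2\<close>,
  the identity \<open>x^(i+1) / (1+x)^(n+1) = x^i / (1+x)^n - x^i / (1+x)^(n+1)\<close> lowers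
  \<open>i\<close> at the price of two values of \<open>N\<close>, which is why \<open>N\<close> is
  generalised. The base case is the total mass of \<open>iota N\<close>.\<close>

lemma integral_iota_0_power:
  "i \<le> N \<Longrightarrow> (\<integral>z. of_real (((cmod z)\<^sup>2) ^ i / (1 + (cmod z)\<^sup>2) ^ N) \<partial>iota 0)
     = (1 / (of_nat (N + 1) * of_nat (N choose i)) :: complex)"
proof (induction i arbitrary: N)
  case 0
  have "(1::complex) = (\<integral>z. 1 \<partial>iota N)" by simp
  also have "\<dots> = of_nat (N + 1) * (\<integral>z. 1 / of_real ((1 + (cmod z)\<^sup>2) ^ N) \<partial>iota 0)"
    by (rule integral_iota) simp
  finally have "of_nat (N + 1) * (\<integral>z. 1 / of_real ((1 + (cmod z)\<^sup>2) ^ N) \<partial>iota 0) = (1::complex)" ..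
  moreover have "of_nat (N + 1) \<noteq> (0::complex)" by (simp only: of_nat_eq_0_iff)
  ultimately have "(\<integral>z. 1 / of_real ((1 + (cmod z)\<^sup>2) ^ N) \<partial>iota 0) = 1 / (of_nat (N + 1) :: complex)"
    by (metis nonzero_mult_div_cancel_left)
  then show ?case by simp
next
  case (Suc i)
  then obtain n where N: "N = Suc n" "i \<le> n" by (cases N) auto
  have int: "integrable (iota 0) (\<lambda>z. complex_of_real (((cmod z)\<^sup>2) ^ i / (1 + (cmod z)\<^sup>2) ^ M))"
    if "i \<le> M" for M
  proof (rule integrable_iota_0_bounded)
    fix z
    have "((cmod z)\<^sup>2) ^ i \<le> (1 + (cmod z)\<^sup>2) ^ i" by (rule power_mono) auto
    also have "\<dots> \<le> (1 + (cmod z)\<^sup>2) ^ M" using that by (intro power_increasing) auto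
    finally show "cmod (complex_of_real (((cmod z)\<^sup>2) ^ i / (1 + (cmod z)\<^sup>2) ^ M)) \<le> 1"
      unfolding norm_of_real by simp
  qed measurable
  have "(\<integral>z. complex_of_real (((cmod z)\<^sup>2) ^ Suc i / (1 + (cmod z)\<^sup>2) ^ N) \<partial>iota 0) =
    (\<integral>z. complex_of_real (((cmod z)\<^sup>2) ^ i / (1 + (cmod z)\<^sup>2) ^ n)
        - complex_of_real (((cmod z)\<^sup>2) ^ i / (1 + (cmod z)\<^sup>2) ^ N) \<partial>iota 0)"
  proof (intro Bochner_Integration.integral_cong refl)
    fix z
    show "complex_of_real (((cmod z)\<^sup>2) ^ Suc i / (1 + (cmod z)\<^sup>2) ^ N) =
      complex_of_real (((cmod z)\<^sup>2) ^ i / (1 + (cmod z)\<^sup>2) ^ n) - complex_of_real (((cmod z)\<^sup>2) ^ i / (1 + (cmod z)\<^sup>2) ^ N)"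
      unfolding of_real_diff[symmetric] of_real_eq_iff N(1)
      by (simp add: divide_simps) (simp add: algebra_simps)
  qed
  also have "\<dots> = 1 / (of_nat (n + 1) * of_nat (n choose i)) - 1 / (of_nat (N + 1) * of_nat (N choose i))"
    unfolding Bochner_Integration.integral_diff[OF int[OF N(2)] int[OF le_trans[OF N(2) le_SucI[OF le_refl]], folded N(1)]]
    using N by (subst (1 2) Suc.IH) simp_all
  also have "\<dots> = 1 / (of_nat (N + 1) * of_nat (N choose Suc i))"
  proof -
    define A B where "A = real (n choose i)" and "B = real (N choose Suc i)"
    have A0: "A > 0" "B > 0" unfolding A_def B_def of_nat_0_less_iff zero_less_binomial_iff using N by auto
    have e1: "(real n + 1) * A = B * (real i + 1)"
      using Suc_times_binomial_eq[of n i] unfolding A_def B_def N(1)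
      by (metis Suc_eq_plus1 of_nat_1 of_nat_add of_nat_mult)
    define C where "C = real (N choose i)"
    have C0: "C > 0" unfolding C_def using N by auto
    have e2: "(real n + 1 - real i) * C = (real n + 1) * A"
    proof -
      have "(Suc n choose i) * (Suc n - i) = Suc n * (n choose i)"
        using binomial_absorb_comp[of "Suc n" i] by (simp add: mult.commute)
      then have "real (Suc n choose i) * real (Suc n - i) = real (Suc n) * real (n choose i)"
        by (metis of_nat_mult)
      then show ?thesis using N by (simp add: A_def C_def of_nat_diff algebra_simps)
    qed
    have "1 / ((real n + 1) * A) - 1 / ((real n + 2) * C) = 1 / ((real n + 2) * B)"
    proof -
      have p: "real n + 1 - real i > 0" using N by linarith
      define X where "X = (real n + 1) * A"
      have X0: "X > 0" using A0 by (simp add: X_def)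
      have "1 / B = (real i + 1) / X" "1 / C = (real n + 1 - real i) / X"
        using e1 e2 p A0 C0 X0 unfolding X_def[symmetric] by (auto simp: frac_eq_eq mult.commute)
      moreover have "1 / X - (real n + 1 - real i) / X / (real n + 2) = (real i + 1) / X / (real n + 2)"
        using X0 by (simp add: divide_simps)
      ultimately show ?thesis unfolding X_def[symmetric]
        by (metis divide_divide_eq_left mult.commute)
    qed
    then have "complex_of_real (1 / ((real n + 1) * A) - 1 / ((real n + 2) * C)) = complex_of_real (1 / ((real n + 2) * B))"
      by simp
    then show ?thesis unfolding A_def B_def C_def N(1) by (simp add: add_ac)
  qed
  finally show ?case .
qed

lemma distr_iota_rotate:
  assumes "cmod w = 1"
  shows "distr (iota N) borel ((*) w) = iota N"
proof -
  have "distr (iota N) borel ((*) w) =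
     density (distr lborel borel ((*) w)) (\<lambda>z. ennreal ((real N + 1) / (pi * (1 + (cmod z)\<^sup>2) ^ (N + 2))))"
    unfolding iota_def by (subst density_distr) (auto simp: norm_mult assms)
  then show ?thesis by (simp add: distr_lborel_rotate[OF assms] iota_def)
qed

lemma integral_iota_rotate:
  fixes f :: "complex \<Rightarrow> complex"
  assumes "cmod w = 1" and [measurable]: "f \<in> borel_measurable borel"
  shows "(\<integral>z. f (w * z) \<partial>iota N) = (\<integral>z. f z \<partial>iota N)"
proof -
  have "(\<integral>z. f z \<partial>iota N) = (\<integral>z. f z \<partial>distr (iota N) borel ((*) w))"
    by (simp add: distr_iota_rotate assms)
  also have "\<dots> = (\<integral>z. f (w * z) \<partial>iota N)"
    by (rule integral_distr) auto
  finally show ?thesis ..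
qed

lemma integral_iota_monomial:
  assumes "i \<le> N" "j \<le> N"
  shows "(\<integral>z. z ^ i * cnj z ^ j \<partial>iota N) = (if i = j then 1 / of_nat (N choose i) else 0)"
proof (cases "i = j")
  case True
  have "(\<integral>z. z ^ i * cnj z ^ j \<partial>iota N) = of_nat (N + 1) * (\<integral>z. z ^ i * cnj z ^ j / of_real ((1 + (cmod z)\<^sup>2) ^ N) \<partial>iota 0)"
    by (rule integral_iota) measurable
  also have "(\<lambda>z. z ^ i * cnj z ^ j / of_real ((1 + (cmod z)\<^sup>2) ^ N)) = (\<lambda>z. of_real (((cmod z)\<^sup>2) ^ i / (1 + (cmod z)\<^sup>2) ^ N))"
    by (rule ext) (simp add: True flip: power_mult_distrib complex_norm_square)
  also have "of_nat (N + 1) * (\<integral>z. of_real (((cmod z)\<^sup>2) ^ i / (1 + (cmod z)\<^sup>2) ^ N) \<partial>iota 0)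
      = of_nat (N + 1) * (1 / (of_nat (N + 1) * of_nat (N choose i)) :: complex)"
    by (subst integral_iota_0_power) (use assms in auto)
  also have "\<dots> = 1 / of_nat (N choose i)"
    by (simp del: of_nat_Suc of_nat_add add: divide_simps)
  finally show ?thesis using True by simp
next
  case False
  \<comment> \<open>The angle is chosen so that rotation by \<open>w\<close> multiplies the
    integrand by \<open>w ^ i * cnj w ^ j = -1\<close>; rotation invariance then makes the integral
    its own negative.\<close>
  define w where "w = cis (pi / (real i - real j))"
  have w: "cmod w = 1" by (simp add: w_def)
  have wij: "w ^ i * cnj w ^ j = -1"
  proof -
    have "w ^ i * cnj w ^ j = cis (real i * (pi / (real i - real j)) - real j * (pi / (real i - real j)))"
      by (simp add: w_def Complex.DeMoivre cis_cnj cis_mult del: cis_pi)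
    also have "real i * (pi / (real i - real j)) - real j * (pi / (real i - real j)) = pi"
      using False by (simp flip: diff_divide_distrib left_diff_distrib)
    finally show ?thesis by simp
  qed
  have "(\<integral>z. z ^ i * cnj z ^ j \<partial>iota N) = (\<integral>z. (w * z) ^ i * cnj (w * z) ^ j \<partial>iota N)"
    by (rule integral_iota_rotate[symmetric]) (use w in measurable)
  also have "\<dots> = (\<integral>z. (w ^ i * cnj w ^ j) * (z ^ i * cnj z ^ j) \<partial>iota N)"
    by (simp add: power_mult_distrib mult_ac)
  also have "\<dots> = - (\<integral>z. z ^ i * cnj z ^ j \<partial>iota N)" by (simp add: wij)
  finally show ?thesis using False by simp
qed

section \<open>Inner products of products of linear forms\<close>

lemma integral_iota_poly_cnj_poly:
  "integrable (iota N) (\<lambda>w. (\<Sum>i\<le>N. p i * w ^ i) * cnj (\<Sum>j\<le>N. q j * w ^ j))" (is ?int)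
  "(\<integral>w. (\<Sum>i\<le>N. p i * w ^ i) * cnj (\<Sum>j\<le>N. q j * w ^ j) \<partial>iota N)
     = (\<Sum>i\<le>N. p i * cnj (q i) / of_nat (N choose i))" (is ?eq)
proof -
  have expand: "(\<lambda>w. (\<Sum>i\<le>N. p i * w ^ i) * cnj (\<Sum>j\<le>N. q j * w ^ j)) =
    (\<lambda>w. \<Sum>i\<le>N. \<Sum>j\<le>N. p i * cnj (q j) * (w ^ i * cnj w ^ j))"
    by (auto simp: sum_product mult_ac)
  have int: "integrable (iota N) (\<lambda>w. p i * cnj (q j) * (w ^ i * cnj w ^ j))" if "i \<le> N" "j \<le> N" for i j
    using that by (intro integrable_mult_right integrable_iota_monomial)
  show ?int unfolding expand by (intro Bochner_Integration.integrable_sum int) auto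
  have "(\<integral>w. (\<Sum>i\<le>N. \<Sum>j\<le>N. p i * cnj (q j) * (w ^ i * cnj w ^ j)) \<partial>iota N)
     = (\<Sum>i\<le>N. \<Sum>j\<le>N. p i * cnj (q j) * (\<integral>w. w ^ i * cnj w ^ j \<partial>iota N))"
    using int by (subst Bochner_Integration.integral_sum)
      (auto intro!: Bochner_Integration.integrable_sum sum.cong simp: Bochner_Integration.integral_sum)
  also have "\<dots> = (\<Sum>i\<le>N. \<Sum>j\<le>N. if i = j then p i * cnj (q i) / of_nat (N choose i) else 0)"
    by (intro sum.cong) (auto simp: integral_iota_monomial)
  also have "\<dots> = (\<Sum>i\<le>N. p i * cnj (q i) / of_nat (N choose i))"
    by (intro sum.cong) (auto simp: sum.delta)
  finally show ?eq unfolding expand .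
qed

lemma linear_form_power:
  fixes c0 c1 w :: complex
  shows "(c0 + c1 * w) ^ N = (\<Sum>j\<le>N. (of_nat (N choose j) * c1 ^ j * c0 ^ (N - j)) * w ^ j)"
  by (subst add.commute, subst binomial_ring) (auto simp: power_mult_distrib mult_ac)

text \<open>The binomials in the expansion of the power cancel the squared norms
  \<open>1 / (N choose i)\<close> of the monomials, so pairing with an \<open>N\<close>-th power of
  a linear form evaluates the homogenised polynomial at \<open>(cnj c0, cnj c1)\<close>. The case
  \<open>c0 = 1\<close> is the reproducing property.\<close>

lemma integral_iota_poly_cnj_linear_form_power:
  "(\<integral>w. (\<Sum>i\<le>N. p i * w ^ i) * cnj ((c0 + c1 * w) ^ N) \<partial>iota N)
     = (\<Sum>i\<le>N. p i * cnj c0 ^ (N - i) * cnj c1 ^ i)"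
  unfolding linear_form_power
  by (subst integral_iota_poly_cnj_poly(2)) (auto intro!: sum.cong)

lemma poly_reproducing:
  "(\<integral>w. (\<Sum>i\<le>N. p i * w ^ i) * (1 + x * cnj w) ^ N \<partial>iota N) = (\<Sum>i\<le>N. p i * x ^ i)"
  using integral_iota_poly_cnj_linear_form_power[of N p 1 "cnj x"] by simp

text \<open>Degrees are tracked homogeneously because a form \<open>b0 + b1 * w\<close> may have
  \<open>b1 = 0\<close> and drop in degree; in two variables the degree, and with it the index of
  the measure, stays fixed.\<close>

definition hom_form :: "nat \<Rightarrow> (complex \<Rightarrow> complex \<Rightarrow> complex) \<Rightarrow> bool" where
  "hom_form N f \<longleftrightarrow> (\<exists>p. \<forall>x y. f x y = (\<Sum>i\<le>N. p i * x ^ (N - i) * y ^ i))"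

lemma hom_form_mult_linear:
  assumes "hom_form N f"
  shows "hom_form (Suc N) (\<lambda>x y. (a * x + b * y) * f x y)"
proof -
  obtain p where p: "\<And>x y. f x y = (\<Sum>i\<le>N. p i * x ^ (N - i) * y ^ i)"
    using assms by (auto simp: hom_form_def)
  define q where "q i = a * (if i \<le> N then p i else 0) + b * (if i = 0 then 0 else p (i - 1))" for i
  have "(a * x + b * y) * f x y = (\<Sum>i\<le>Suc N. q i * x ^ (Suc N - i) * y ^ i)" for x y
  proof -
    have 1: "(\<Sum>i\<le>Suc N. (a * (if i \<le> N then p i else 0)) * x ^ (Suc N - i) * y ^ i) = a * x * f x y"
      by (simp add: p sum_distrib_left Suc_diff_le mult_ac)
    have 2: "(\<Sum>i\<le>Suc N. (b * (if i = 0 then 0 else p (i - 1))) * x ^ (Suc N - i) * y ^ i) = b * y * f x y"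
      by (subst sum.atMost_Suc_shift) (simp add: p sum_distrib_left mult_ac)
    show ?thesis unfolding q_def ring_distribs sum.distrib 1[unfolded mult.assoc] 2[unfolded mult.assoc]
      using 1 2 by (simp add: sum.distrib algebra_simps)
  qed
  then show ?thesis by (auto simp: hom_form_def)
qed

lemma hom_form_mult_linear_power:
  assumes "hom_form N f"
  shows "hom_form (N + n) (\<lambda>x y. (a * x + b * y) ^ n * f x y)"
proof (induction n)
  case (Suc n)
  from hom_form_mult_linear[OF this, of a b] show ?case by (simp add: mult.assoc)
qed (use assms in simp)

lemma hom_form_linear_powers:
  "hom_form (n + m) (\<lambda>x y. (a0 * x + a1 * y) ^ n * (b0 * x + b1 * y) ^ m)"
proof -
  have "hom_form 0 (\<lambda>x y. 1)" by (auto simp: hom_form_def intro!: exI[of _ "\<lambda>_. 1"])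
  from hom_form_mult_linear_power[OF hom_form_mult_linear_power[OF this, of m b0 b1], of n a0 a1]
  show ?thesis by (simp add: add.commute)
qed

text \<open>The inner product of two products of powers of linear forms is (up to normalisation) a permanent.
  It is read off as the coefficient of \<open>y ^ m\<close> in the inner product of the first factor with the \<open>N\<close>-th power
  of the pencil \<open>c + cnj y * d\<close>.\<close>

lemma integral_iota_linear_forms:
  fixes a0 a1 b0 b1 c0 c1 d0 d1 :: complex
  defines "ac \<equiv> a0 * cnj c0 + a1 * cnj c1" and "ad \<equiv> a0 * cnj d0 + a1 * cnj d1"
      and "bc \<equiv> b0 * cnj c0 + b1 * cnj c1" and "bd \<equiv> b0 * cnj d0 + b1 * cnj d1"
  shows "(\<integral>w. (a0 + a1 * w) ^ n * (b0 + b1 * w) ^ m * cnj ((c0 + c1 * w) ^ n * (d0 + d1 * w) ^ m) \<partial>iota (n + m))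
     = (\<Sum>j\<le>m. of_nat (m choose j) * of_nat (n choose j) * ac ^ (n - j) * bd ^ (m - j) * (ad * bc) ^ j)
          / of_nat ((n + m) choose m)"
proof -
  define N where "N = n + m"
  obtain p where p: "\<And>x y. (a0 * x + a1 * y) ^ n * (b0 * x + b1 * y) ^ m = (\<Sum>i\<le>N. p i * x ^ (N - i) * y ^ i)"
    using hom_form_linear_powers[of n m a0 a1 b0 b1] unfolding hom_form_def N_def by blast
  have Q: "(a0 + a1 * w) ^ n * (b0 + b1 * w) ^ m = (\<Sum>i\<le>N. p i * w ^ i)" for w
    using p[of 1 w] by simp
  define I where "I l = (\<integral>w. (\<Sum>i\<le>N. p i * w ^ i) * cnj ((c0 + c1 * w) ^ (N - l) * (d0 + d1 * w) ^ l) \<partial>iota N)" for l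
  have int: "integrable (iota N) (\<lambda>w. (\<Sum>i\<le>N. p i * w ^ i) * cnj ((c0 + c1 * w) ^ (N - l) * (d0 + d1 * w) ^ l))"
    if l: "l \<le> N" for l
  proof -
    obtain q where q: "\<And>x y. (c0 * x + c1 * y) ^ (N - l) * (d0 * x + d1 * y) ^ l = (\<Sum>i\<le>N. q i * x ^ (N - i) * y ^ i)"
      using hom_form_linear_powers[of "N - l" l c0 c1 d0 d1] l unfolding hom_form_def by auto
    have q1: "(c0 + c1 * w) ^ (N - l) * (d0 + d1 * w) ^ l = (\<Sum>i\<le>N. q i * w ^ i)" for w
      using q[of 1 w] by simp
    show ?thesis unfolding q1 by (rule integral_iota_poly_cnj_poly(1))
  qed
  have key: "(\<Sum>l\<le>N. of_nat (N choose l) * I l * y ^ l) = (ac + ad * y) ^ n * (bc + bd * y) ^ m" for y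
  proof -
    \<comment> \<open>Conjugating the pencil turns \<open>x\<close> back into \<open>y\<close>, so
      that the integral becomes a polynomial in \<open>y\<close> itself.\<close>
    define x where "x = cnj y"
    have "(\<integral>w. (\<Sum>i\<le>N. p i * w ^ i) * cnj (((c0 + x * d0) + (c1 + x * d1) * w) ^ N) \<partial>iota N)
        = (\<Sum>i\<le>N. p i * cnj (c0 + x * d0) ^ (N - i) * cnj (c1 + x * d1) ^ i)"
      by (rule integral_iota_poly_cnj_linear_form_power)
    also have "\<dots> = (a0 * cnj (c0 + x * d0) + a1 * cnj (c1 + x * d1)) ^ n * (b0 * cnj (c0 + x * d0) + b1 * cnj (c1 + x * d1)) ^ m"
      by (rule p[symmetric])
    also have "\<dots> = (ac + ad * y) ^ n * (bc + bd * y) ^ m"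
      by (simp add: ac_def ad_def bc_def bd_def x_def algebra_simps)
    finally have 1: "(\<integral>w. (\<Sum>i\<le>N. p i * w ^ i) * cnj (((c0 + x * d0) + (c1 + x * d1) * w) ^ N) \<partial>iota N)
       = (ac + ad * y) ^ n * (bc + bd * y) ^ m" .
    have "(\<Sum>i\<le>N. p i * w ^ i) * cnj (((c0 + x * d0) + (c1 + x * d1) * w) ^ N)
      = (\<Sum>l\<le>N. of_nat (N choose l) * y ^ l * ((\<Sum>i\<le>N. p i * w ^ i) * cnj ((c0 + c1 * w) ^ (N - l) * (d0 + d1 * w) ^ l)))" for w
    proof -
      have "((c0 + x * d0) + (c1 + x * d1) * w) ^ N = ((d0 + d1 * w) * x + (c0 + c1 * w)) ^ N"
        by (simp add: algebra_simps)
      also have "\<dots> = (\<Sum>l\<le>N. of_nat (N choose l) * ((d0 + d1 * w) * x) ^ l * (c0 + c1 * w) ^ (N - l))"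
        by (rule binomial_ring)
      finally show ?thesis
        by (simp only: cnj_sum sum_distrib_left) (simp add: x_def power_mult_distrib mult_ac)
    qed
    then have "(\<integral>w. (\<Sum>i\<le>N. p i * w ^ i) * cnj (((c0 + x * d0) + (c1 + x * d1) * w) ^ N) \<partial>iota N)
       = (\<Sum>l\<le>N. of_nat (N choose l) * y ^ l * I l)"
      unfolding I_def
      by (simp only:, subst Bochner_Integration.integral_sum)
         (auto simp only: integral_mult_right_zero intro!: integrable_mult_right int)
    with 1 show ?thesis by (simp add: mult_ac)
  qed
  \<comment> \<open>An identity for all complex \<open>y\<close> is one of formal polynomials, which
    permits comparing coefficients of degree \<open>m\<close>; since \<open>N - m = n\<close>,
    \<open>I m\<close> is the integral sought.\<close>
  have "poly (\<Sum>l\<le>N. monom (of_nat (N choose l) * I l) l) = poly ([:ac, ad:] ^ n * [:bc, bd:] ^ m)"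
    by (rule ext) (simp add: poly_sum poly_monom key mult.commute[of _ ad] mult.commute[of _ bd])
  then have "(\<Sum>l\<le>N. monom (of_nat (N choose l) * I l) l) = [:ac, ad:] ^ n * [:bc, bd:] ^ m"
    by (simp add: poly_eq_poly_eq_iff)
  then have "coeff (\<Sum>l\<le>N. monom (of_nat (N choose l) * I l) l) m = coeff ([:ac, ad:] ^ n * [:bc, bd:] ^ m) m"
    by simp
  moreover have "coeff (\<Sum>l\<le>N. monom (of_nat (N choose l) * I l) l) m = of_nat (N choose m) * I m"
    by (simp add: coeff_sum N_def)
  moreover have "coeff ([:ac, ad:] ^ n * [:bc, bd:] ^ m) m =
      (\<Sum>j\<le>m. of_nat (m choose j) * of_nat (n choose j) * ac ^ (n - j) * bd ^ (m - j) * (ad * bc) ^ j)"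
    unfolding coeff_mult
  proof (intro sum.cong refl)
    fix j assume j: "j \<in> {..m}"
    have "coeff ([:ac, ad:] ^ n) j = of_nat (n choose j) * ad ^ j * ac ^ (n - j)"
    proof (cases "j \<le> n")
      \<comment> \<open>For \<open>j > n\<close> the truncated exponent \<open>n - j\<close> does no
        harm, since the coefficient and the binomial are both zero.\<close>
      case False
      have "degree ([:ac, ad:] ^ n) \<le> n" 
        by (rule order.trans[OF degree_power_le]) simp
      with False show ?thesis by (simp add: coeff_eq_0)
    qed (rule coeff_linear_poly_power)
    moreover have "coeff ([:bc, bd:] ^ m) (m - j) = of_nat (m choose j) * bd ^ (m - j) * bc ^ j"
      using j by (subst coeff_linear_poly_power) (auto simp: binomial_symmetric[symmetric])
    ultimately show "coeff ([:ac, ad:] ^ n) j * coeff ([:bc, bd:] ^ m) (m - j) =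
       of_nat (m choose j) * of_nat (n choose j) * ac ^ (n - j) * bd ^ (m - j) * (ad * bc) ^ j"
      by (simp add: power_mult_distrib mult_ac)
  qed
  ultimately have "of_nat (N choose m) * I m = 
      (\<Sum>j\<le>m. of_nat (m choose j) * of_nat (n choose j) * ac ^ (n - j) * bd ^ (m - j) * (ad * bc) ^ j)" by simp
  moreover have "N choose m \<noteq> 0" by (simp add: N_def)
  ultimately have "I m = (\<Sum>j\<le>m. of_nat (m choose j) * of_nat (n choose j) * ac ^ (n - j) * bd ^ (m - j) * (ad * bc) ^ j)
          / of_nat (N choose m)"
    by (metis nonzero_mult_div_cancel_left of_nat_eq_0_iff)
  then show ?thesis unfolding I_def N_def Q[unfolded N_def, symmetric] by simp
qed

section \<open>The space ImR and the Berezin transform\<close>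

lemma Tsp_eq: "Tsp a b = {F. \<exists>c. F = (\<lambda>z w. \<Sum>i\<le>a. \<Sum>j\<le>b. c i j * (z ^ i * w ^ j))}"
  unfolding Tsp_def mult.assoc ..

lemma Tsp_monomial:
  assumes "i \<le> a" "j \<le> b"
  shows "(\<lambda>z w. c * (z ^ i * w ^ j)) \<in> Tsp a b"
proof -
  have "c * (z ^ i * w ^ j) = (\<Sum>i'\<le>a. \<Sum>j'\<le>b. (if i' = i then if j' = j then c else 0 else 0) * (z ^ i' * w ^ j'))" for z w
  proof -
    have "(\<Sum>i'\<le>a. \<Sum>j'\<le>b. (if i' = i then if j' = j then c else 0 else 0) * (z ^ i' * w ^ j'))
      = (\<Sum>i'\<le>a. if i' = i then c * (z ^ i * w ^ j) else 0)"
    proof (intro sum.cong refl)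
      fix i' assume "i' \<in> {..a}"
      have "(\<Sum>j'\<le>b. (if i' = i then if j' = j then c else 0 else 0) * (z ^ i' * w ^ j'))
         = (\<Sum>j'\<le>b. if j' = j then (if i' = i then c * (z ^ i * w ^ j) else 0) else 0)"
        by (intro sum.cong) auto
      then show "(\<Sum>j'\<le>b. (if i' = i then if j' = j then c else 0 else 0) * (z ^ i' * w ^ j'))
         = (if i' = i then c * (z ^ i * w ^ j) else 0)" using assms by simp
    qed
    then show ?thesis using assms by simp
  qed
  then show ?thesis unfolding Tsp_eq
    by (intro CollectI exI[of _ "\<lambda>i' j'. if i' = i then if j' = j then c else 0 else 0"] ext)
qed

lemma Tsp_add:
  assumes "F \<in> Tsp a b" "G \<in> Tsp a b"
  shows "(\<lambda>z w. F z w + G z w) \<in> Tsp a b"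
proof -
  obtain c d where "F = (\<lambda>z w. \<Sum>i\<le>a. \<Sum>j\<le>b. c i j * (z ^ i * w ^ j))"
     "G = (\<lambda>z w. \<Sum>i\<le>a. \<Sum>j\<le>b. d i j * (z ^ i * w ^ j))"
    using assms unfolding Tsp_eq by blast
  then have "(\<lambda>z w. F z w + G z w) = (\<lambda>z w. \<Sum>i\<le>a. \<Sum>j\<le>b. (c i j + d i j) * (z ^ i * w ^ j))"
    by (simp add: sum.distrib distrib_right)
  then show ?thesis unfolding Tsp_eq by (intro CollectI exI[of _ "\<lambda>i j. c i j + d i j"])
qed

lemma Tsp_const: "(\<lambda>z w. c) \<in> Tsp a b"
  using Tsp_monomial[of 0 a 0 b c] by simp

lemma Tsp_sum:
  "(\<And>x. x \<in> S \<Longrightarrow> F x \<in> Tsp a b) \<Longrightarrow> (\<lambda>z w. \<Sum>x\<in>S. F x z w) \<in> Tsp a b"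
  by (induction S rule: infinite_finite_induct) (auto intro: Tsp_const Tsp_add)

lemma Tsp_mult:
  assumes "F \<in> Tsp a b" "G \<in> Tsp a' b'"
  shows "(\<lambda>z w. F z w * G z w) \<in> Tsp (a + a') (b + b')"
proof -
  obtain c d where F: "F = (\<lambda>z w. \<Sum>i\<le>a. \<Sum>j\<le>b. c i j * (z ^ i * w ^ j))"
     and G: "G = (\<lambda>z w. \<Sum>i\<le>a'. \<Sum>j\<le>b'. d i j * (z ^ i * w ^ j))"
    using assms unfolding Tsp_eq by blast
  have "(\<lambda>z w. F z w * G z w) = (\<lambda>z w. \<Sum>i\<le>a. \<Sum>k\<le>a'. \<Sum>j\<le>b. \<Sum>l\<le>b'.
      (c i j * d k l) * (z ^ (i + k) * w ^ (j + l)))"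
    by (simp add: F G sum_product power_add mult_ac)
  also have "\<dots> \<in> Tsp (a + a') (b + b')"
    by (intro Tsp_sum Tsp_monomial) auto
  finally show ?thesis .
qed

lemma Tsp_cmult: "F \<in> Tsp a b \<Longrightarrow> (\<lambda>z w. c * F z w) \<in> Tsp a b"
  using Tsp_mult[OF Tsp_const[of c 0 0]] by simp

lemma Tsp_power:
  assumes "F \<in> Tsp a b"
  shows "(\<lambda>z w. F z w ^ n) \<in> Tsp (n * a) (n * b)"
proof (induction n)
  case (Suc n)
  then show ?case using Tsp_mult[OF assms Suc] by simp
qed (simp add: Tsp_const)

lemma Tsp_linear_power:
  "(\<lambda>z w. (1 + x * z) ^ n) \<in> Tsp n 0" "(\<lambda>z w. (1 + y * w) ^ n) \<in> Tsp 0 n" "(\<lambda>z w. (z - w) ^ n) \<in> Tsp n n"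
proof -
  have "(\<lambda>z w. 1 + x * (z ^ 1 * w ^ 0)) \<in> Tsp 1 0" "(\<lambda>z w. 1 + y * (z ^ 0 * w ^ 1)) \<in> Tsp 0 1"
    "(\<lambda>z w. 1 * (z ^ 1 * w ^ 0) + (-1) * (z ^ 0 * w ^ 1)) \<in> Tsp 1 1"
    by (intro Tsp_add Tsp_monomial Tsp_const; simp)+
  from this[THEN Tsp_power, of n]
  show "(\<lambda>z w. (1 + x * z) ^ n) \<in> Tsp n 0" "(\<lambda>z w. (1 + y * w) ^ n) \<in> Tsp 0 n" "(\<lambda>z w. (z - w) ^ n) \<in> Tsp n n"
    by simp_all
qed

text \<open>Restricting \<open>Tsp a b\<close> to \<open>w = cnj z\<close> lets the closure
  properties under sums, products and powers be inherited.\<close>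

definition bipoly :: "nat \<Rightarrow> nat \<Rightarrow> (complex \<Rightarrow> complex) set" where
  "bipoly a b = (\<lambda>F z. F z (cnj z)) ` Tsp a b"

lemma bipoly_eq: "bipoly a b = {F. \<exists>c. F = (\<lambda>z. \<Sum>i\<le>a. \<Sum>j\<le>b. c i j * (z ^ i * cnj z ^ j))}"
  unfolding bipoly_def Tsp_eq by auto

lemma bipoly_of_Tsp: "F \<in> Tsp a b \<Longrightarrow> (\<lambda>z. F z (cnj z)) \<in> bipoly a b"
  by (auto simp: bipoly_def)

lemma bipoly_monomial: "i \<le> a \<Longrightarrow> j \<le> b \<Longrightarrow> (\<lambda>z. c * (z ^ i * cnj z ^ j)) \<in> bipoly a b"
  by (rule bipoly_of_Tsp) (rule Tsp_monomial)

lemma bipoly_add: "F \<in> bipoly a b \<Longrightarrow> G \<in> bipoly a b \<Longrightarrow> (\<lambda>z. F z + G z) \<in> bipoly a b"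
  unfolding bipoly_def using Tsp_add by fastforce

lemma bipoly_zero: "(\<lambda>z. 0) \<in> bipoly a b"
  using bipoly_monomial[of 0 a 0 b 0] by simp

lemma bipoly_sum:
  "(\<And>x. x \<in> S \<Longrightarrow> F x \<in> bipoly a b) \<Longrightarrow> (\<lambda>z. \<Sum>x\<in>S. F x z) \<in> bipoly a b"
  by (induction S rule: infinite_finite_induct) (auto intro: bipoly_zero bipoly_add)

lemma bipoly_mult: "F \<in> bipoly a b \<Longrightarrow> G \<in> bipoly a' b' \<Longrightarrow> (\<lambda>z. F z * G z) \<in> bipoly (a + a') (b + b')"
  unfolding bipoly_def using Tsp_mult by fastforce

lemma bipoly_cmult: "F \<in> bipoly a b \<Longrightarrow> (\<lambda>z. k * F z) \<in> bipoly a b"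
  unfolding bipoly_def using Tsp_cmult by fastforce

lemma bipoly_power: "F \<in> bipoly a b \<Longrightarrow> (\<lambda>z. F z ^ n) \<in> bipoly (n * a) (n * b)"
  unfolding bipoly_def using Tsp_power by fastforce

lemma bipoly_one_plus_norm_sq: "(\<lambda>z. of_real ((1 + (cmod z)\<^sup>2) ^ n)) \<in> bipoly n n"
proof -
  have "(\<lambda>z. 1 * (z ^ 0 * cnj z ^ 0) + 1 * (z ^ 1 * cnj z ^ 1)) \<in> bipoly 1 1"
    by (intro bipoly_add bipoly_monomial) auto
  from bipoly_power[OF this, of n] show ?thesis
    by (simp add: complex_norm_square[symmetric])
qed

lemma bipoly_kernel: "(\<lambda>z. (1 + z * x) ^ n) \<in> bipoly n 0" "(\<lambda>z. (1 + cnj z * y) ^ n) \<in> bipoly 0 n"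
  using Tsp_linear_power(1)[THEN bipoly_of_Tsp, of x n] Tsp_linear_power(2)[THEN bipoly_of_Tsp, of y n]
  by (simp_all add: mult.commute)

lemma bipoly_bound:
  assumes "F \<in> bipoly N N"
  shows "\<exists>C. \<forall>z. cmod (F z) \<le> C * (1 + (cmod z)\<^sup>2) ^ N"
proof -
  obtain c where F: "F = (\<lambda>z. \<Sum>i\<le>N. \<Sum>j\<le>N. c i j * (z ^ i * cnj z ^ j))"
    using assms unfolding bipoly_eq by blast
  have "cmod (F z) \<le> (\<Sum>i\<le>N. \<Sum>j\<le>N. cmod (c i j)) * (1 + (cmod z)\<^sup>2) ^ N" for z
    unfolding F sum_distrib_right
  proof (intro order.trans[OF norm_sum] sum_mono)
    fix i j assume ij: "i \<in> {..N}" "j \<in> {..N}"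
    have "cmod (z ^ i * cnj z ^ j) = cmod z ^ i * cmod z ^ j" by (simp add: norm_mult norm_power)
    also have "\<dots> \<le> sqrt (1 + (cmod z)\<^sup>2) ^ N * sqrt (1 + (cmod z)\<^sup>2) ^ N"
      using ij by (intro mult_mono norm_power_le_one_plus) auto
    finally have "cmod (z ^ i * cnj z ^ j) \<le> (1 + (cmod z)\<^sup>2) ^ N" by (simp add: sqrt_power_mult_self)
    then show "cmod (c i j * (z ^ i * cnj z ^ j)) \<le> cmod (c i j) * (1 + (cmod z)\<^sup>2) ^ N"
      unfolding norm_mult[of "c i j"] by (intro mult_left_mono) auto
  qed
  then show ?thesis by blast
qed

lemma bipoly_continuous:
  assumes "F \<in> bipoly a b"
  shows "continuous_on UNIV F"
proof -
  obtain c where F: "F = (\<lambda>z. \<Sum>i\<le>a. \<Sum>j\<le>b. c i j * (z ^ i * cnj z ^ j))"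
    using assms unfolding bipoly_eq by blast
  show ?thesis unfolding F by (intro continuous_intros)
qed

section \<open>Operators on \<open>Hsp N\<close> and the description of \<open>ImR \<mu>\<close> by
  bidegree\<close>

lemma monomial_in_Hsp: "i \<le> N \<Longrightarrow> (\<lambda>z. z ^ i) \<in> Hsp N"
  unfolding Hsp_def by (auto intro!: exI[of _ "\<lambda>j. if j = i then 1 else 0"] simp: if_distrib if_distribR sum.delta cong: if_cong)

lemma Hsp_lincomb:
  assumes "g \<in> Hsp N" "h \<in> Hsp N"
  shows "(\<lambda>z. c * g z + h z) \<in> Hsp N"
proof -
  obtain a b where "g = (\<lambda>z. \<Sum>i\<le>N. a i * z ^ i)" "h = (\<lambda>z. \<Sum>i\<le>N. b i * z ^ i)"
    using assms unfolding Hsp_def by blast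
  then show ?thesis unfolding Hsp_def
    by (auto intro!: exI[of _ "\<lambda>i. c * a i + b i"] simp: sum.distrib sum_distrib_left algebra_simps)
qed

lemma Hsp_zero: "(\<lambda>z. 0) \<in> Hsp N"
  unfolding Hsp_def by (auto intro!: exI[of _ "\<lambda>i. 0"])

lemma Bop_lincomb:
  assumes "\<Gamma> \<in> Bop N" "g \<in> Hsp N" "h \<in> Hsp N"
  shows "\<Gamma> (\<lambda>z. c * g z + h z) = (\<lambda>z. c * \<Gamma> g z + \<Gamma> h z)"
  using assms by (simp add: Bop_def)

lemma Bop_sum:
  assumes G: "\<Gamma> \<in> Bop N" and "finite S" and "\<And>i. i \<in> S \<Longrightarrow> h i \<in> Hsp N"
  shows "(\<lambda>z. \<Sum>i\<in>S. c i * h i z) \<in> Hsp N \<and> \<Gamma> (\<lambda>z. \<Sum>i\<in>S. c i * h i z) = (\<lambda>z. \<Sum>i\<in>S. c i * \<Gamma> (h i) z)"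
  using assms(2,3)
proof (induction S rule: finite_induct)
  case empty
  \<comment> \<open>Linearity is available only in the form \<open>c * g + h\<close>; with both
    functions zero and \<open>c = 1\<close> it says that
    \<open>\<Gamma> 0 = \<Gamma> 0 + \<Gamma> 0\<close>.\<close>
  have "\<Gamma> (\<lambda>z. 1 * (0::complex) + 0) = (\<lambda>z. 1 * \<Gamma> (\<lambda>z. 0) z + \<Gamma> (\<lambda>z. 0) z)"
    by (rule Bop_lincomb[OF G Hsp_zero Hsp_zero])
  then have "\<Gamma> (\<lambda>z. 0) z = 1 * \<Gamma> (\<lambda>z. 0) z + \<Gamma> (\<lambda>z. 0) z" for z
    by (simp add: fun_eq_iff)
  then have "\<Gamma> (\<lambda>z. 0) = (\<lambda>z. 0)" by (intro ext) simp
  then show ?case by (simp add: Hsp_zero)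
next
  case (insert i S)
  then show ?case using Hsp_lincomb[of "h i" N "\<lambda>z. \<Sum>i\<in>S. c i * h i z" "c i"]
      Bop_lincomb[OF G, of "h i" "\<lambda>z. \<Sum>i\<in>S. c i * h i z" "c i"] by simp
qed

text \<open>Reduces membership to a degree condition: expanding the kernel in powers of
  \<open>cnj z\<close> gives one direction, and combinations of rank-one operators realise every
  coefficient matrix in the other.\<close>

lemma ImR_iff: "f \<in> ImR \<mu> \<longleftrightarrow> (\<exists>F\<in>bipoly \<mu> \<mu>. f = (\<lambda>z. F z / of_real ((1 + (cmod z)\<^sup>2) ^ \<mu>)))"
proof
  assume "f \<in> ImR \<mu>"
  then obtain \<Gamma> where G: "\<Gamma> \<in> Bop \<mu>" and f: "f = Rmap \<mu> \<Gamma>" unfolding ImR_def by blast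
  have "\<forall>j\<le>\<mu>. \<exists>a. \<Gamma> (\<lambda>z. z ^ j) = (\<lambda>z. \<Sum>i\<le>\<mu>. a i * z ^ i)"
    using G monomial_in_Hsp unfolding Bop_def Hsp_def by blast
  then obtain a where a: "\<And>j. j \<le> \<mu> \<Longrightarrow> \<Gamma> (\<lambda>z. z ^ j) = (\<lambda>z. \<Sum>i\<le>\<mu>. a j i * z ^ i)"
    by metis
  have "opker \<mu> \<Gamma> z z = (\<Sum>j\<le>\<mu>. \<Sum>i\<le>\<mu>. (of_nat (\<mu> choose j) * a j i) * (z ^ i * cnj z ^ j))" for z
  proof -
    have "(\<lambda>x. Kker \<mu> x z) = (\<lambda>x. \<Sum>j\<le>\<mu>. (of_nat (\<mu> choose j) * cnj z ^ j) * x ^ j)"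
      unfolding Kker_def using linear_form_power[of 1 "cnj z" _ \<mu>] by (simp add: mult.commute)
    then have "opker \<mu> \<Gamma> z z = \<Gamma> (\<lambda>x. \<Sum>j\<le>\<mu>. (of_nat (\<mu> choose j) * cnj z ^ j) * x ^ j) z"
      unfolding opker_def by simp
    also have "\<dots> = (\<Sum>j\<le>\<mu>. (of_nat (\<mu> choose j) * cnj z ^ j) * \<Gamma> (\<lambda>x. x ^ j) z)"
      by (subst Bop_sum[OF G, THEN conjunct2]) (auto intro: monomial_in_Hsp)
    finally show ?thesis by (simp add: a sum_distrib_left mult_ac)
  qed
  then have "(\<lambda>z. opker \<mu> \<Gamma> z z) \<in> bipoly \<mu> \<mu>"
    by (simp only:) (intro bipoly_sum bipoly_monomial, auto)
  then show "\<exists>F\<in>bipoly \<mu> \<mu>. f = (\<lambda>z. F z / of_real ((1 + (cmod z)\<^sup>2) ^ \<mu>))"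
    unfolding f Rmap_def[abs_def] by (intro bexI[of _ "\<lambda>z. opker \<mu> \<Gamma> z z"]) auto
next
  assume "\<exists>F\<in>bipoly \<mu> \<mu>. f = (\<lambda>z. F z / of_real ((1 + (cmod z)\<^sup>2) ^ \<mu>))"
  then obtain F where "F \<in> bipoly \<mu> \<mu>" and fF: "f = (\<lambda>z. F z / of_real ((1 + (cmod z)\<^sup>2) ^ \<mu>))"
    by blast
  then obtain c where "F = (\<lambda>z. \<Sum>i\<le>\<mu>. \<Sum>j\<le>\<mu>. c i j * (z ^ i * cnj z ^ j))"
    unfolding bipoly_eq by blast
  with fF have f: "f = (\<lambda>z. (\<Sum>i\<le>\<mu>. \<Sum>j\<le>\<mu>. c i j * (z ^ i * cnj z ^ j)) / of_real ((1 + (cmod z)\<^sup>2) ^ \<mu>))"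
    by simp
  \<comment> \<open>The operator that multiplies \<open>x ^ i\<close> by the inner product of
    \<open>h\<close> with \<open>w ^ j\<close> sends the kernel at \<open>z\<close> to
    \<open>cnj z ^ j * x ^ i\<close>, by the reproducing property; \<open>\<Gamma>\<close> combines
    these operators with weights \<open>c i j\<close>.\<close>
  define \<Gamma> where "\<Gamma> h = (\<lambda>x. \<Sum>i\<le>\<mu>. (\<Sum>j\<le>\<mu>. c i j * (\<integral>w. h w * cnj (w ^ j) \<partial>iota \<mu>)) * x ^ i)" for h
  have int: "integrable (iota \<mu>) (\<lambda>w. h w * cnj (w ^ j))" if h: "h \<in> Hsp \<mu>" and "j \<le> \<mu>" for h j
  proof -
    obtain a where a: "h = (\<lambda>z. \<Sum>i\<le>\<mu>. a i * z ^ i)"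
      using h unfolding Hsp_def by blast
    have "(\<lambda>w. h w * cnj (w ^ j)) = (\<lambda>w. \<Sum>i\<le>\<mu>. a i * (w ^ i * cnj w ^ j))"
      by (simp add: a sum_distrib_right mult.assoc)
    then show ?thesis
      using \<open>j \<le> \<mu>\<close> by (simp only:) (intro Bochner_Integration.integrable_sum integrable_mult_right integrable_iota_monomial, auto)
  qed
  have "\<Gamma> \<in> Bop \<mu>"
    unfolding Bop_def
  proof (intro CollectI conjI ballI allI)
    show "\<Gamma> h \<in> Hsp \<mu>" for h
      unfolding Hsp_def \<Gamma>_def by (intro CollectI exI) (rule refl)
    fix g h :: "complex \<Rightarrow> complex" and k :: complex
    assume gh: "g \<in> Hsp \<mu>" "h \<in> Hsp \<mu>"
    have "(\<integral>w. (k * g w + h w) * cnj (w ^ j) \<partial>iota \<mu>) =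
        k * (\<integral>w. g w * cnj (w ^ j) \<partial>iota \<mu>) + (\<integral>w. h w * cnj (w ^ j) \<partial>iota \<mu>)" if "j \<le> \<mu>" for j
    proof -
      have "(\<integral>w. (k * g w + h w) * cnj (w ^ j) \<partial>iota \<mu>) = (\<integral>w. k * (g w * cnj (w ^ j)) + h w * cnj (w ^ j) \<partial>iota \<mu>)"
        by (simp add: distrib_right mult.assoc)
      also have "\<dots> = (\<integral>w. k * (g w * cnj (w ^ j)) \<partial>iota \<mu>) + (\<integral>w. h w * cnj (w ^ j) \<partial>iota \<mu>)"
        by (intro Bochner_Integration.integral_add integrable_mult_right int gh that)
      finally show ?thesis by simp
    qed
    then have "(\<Sum>j\<le>\<mu>. c i j * (\<integral>w. (k * g w + h w) * cnj (w ^ j) \<partial>iota \<mu>)) =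
        k * (\<Sum>j\<le>\<mu>. c i j * (\<integral>w. g w * cnj (w ^ j) \<partial>iota \<mu>)) + (\<Sum>j\<le>\<mu>. c i j * (\<integral>w. h w * cnj (w ^ j) \<partial>iota \<mu>))" for i
      by (simp only: sum_distrib_left flip: sum.distrib) (intro sum.cong refl, simp add: algebra_simps)
    then show "\<Gamma> (\<lambda>z. k * g z + h z) = (\<lambda>z. k * \<Gamma> g z + \<Gamma> h z)"
      unfolding \<Gamma>_def by (simp only: distrib_right[where a = "_ * _"] sum.distrib mult.assoc flip: sum_distrib_left)
  qed
  moreover have "Rmap \<mu> \<Gamma> = f"
  proof
    fix z
    have "(\<integral>w. Kker \<mu> w z * cnj (w ^ j) \<partial>iota \<mu>) = cnj z ^ j" if "j \<le> \<mu>" for j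
    proof -
      have "cnj (\<integral>w. Kker \<mu> w z * cnj (w ^ j) \<partial>iota \<mu>) = (\<integral>w. cnj (Kker \<mu> w z * cnj (w ^ j)) \<partial>iota \<mu>)"
        by (rule Bochner_Integration.integral_cnj[symmetric])
      also have "\<dots> = (\<integral>w. (\<Sum>i\<le>\<mu>. (if i = j then 1 else 0) * w ^ i) * (1 + z * cnj w) ^ \<mu> \<partial>iota \<mu>)"
        using that by (intro Bochner_Integration.integral_cong)
          (auto simp: Kker_def mult.commute if_distribR if_distrib sum.delta cong: if_cong)
      also have "\<dots> = z ^ j"
        unfolding poly_reproducing using that by (simp add: if_distribR if_distrib sum.delta cong: if_cong)
      finally have "cnj (cnj (\<integral>w. Kker \<mu> w z * cnj (w ^ j) \<partial>iota \<mu>)) = cnj (z ^ j)" by (rule arg_cong)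
      then show ?thesis by (simp only: complex_cnj_cnj complex_cnj_power)
    qed
    then have "(\<Sum>j\<le>\<mu>. c i j * (\<integral>w. Kker \<mu> w z * cnj (w ^ j) \<partial>iota \<mu>)) * z ^ i = (\<Sum>j\<le>\<mu>. c i j * (z ^ i * cnj z ^ j))" for i
      by (simp only: sum_distrib_right) (intro sum.cong refl, simp)
    then show "Rmap \<mu> \<Gamma> z = f z"
      unfolding Rmap_def opker_def \<Gamma>_def f by (simp only:)
  qed
  ultimately show "f \<in> ImR \<mu>" unfolding ImR_def by blast
qed


text \<open>Multiplying numerator and denominator by a power of \<open>1 + |z|^2\<close> embeds
  \<open>ImR m\<close> in \<open>ImR \<mu>\<close>; this keeps the Berezin transforms of all levels
  up to \<open>\<mu>\<close> in one space.\<close>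

lemma ImR_I:
  assumes "F \<in> bipoly m m" "m \<le> \<mu>"
  shows "(\<lambda>z. F z / of_real ((1 + (cmod z)\<^sup>2) ^ m)) \<in> ImR \<mu>"
proof -
  have "(\<lambda>z. F z * of_real ((1 + (cmod z)\<^sup>2) ^ (\<mu> - m))) \<in> bipoly \<mu> \<mu>"
    using bipoly_mult[OF assms(1) bipoly_one_plus_norm_sq[of "\<mu> - m"]] assms(2) by simp
  moreover have "F z / of_real ((1 + (cmod z)\<^sup>2) ^ m)
      = F z * of_real ((1 + (cmod z)\<^sup>2) ^ (\<mu> - m)) / of_real ((1 + (cmod z)\<^sup>2) ^ \<mu>)" for z
  proof -
    have "(1 + (cmod z)\<^sup>2) ^ \<mu> = (1 + (cmod z)\<^sup>2) ^ m * (1 + (cmod z)\<^sup>2) ^ (\<mu> - m)"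
      using assms(2) by (simp flip: power_add)
    moreover have "complex_of_real ((1 + (cmod z)\<^sup>2) ^ (\<mu> - m)) \<noteq> 0"
      unfolding of_real_eq_0_iff by simp
    ultimately show ?thesis by (simp only: of_real_mult) simp
  qed
  ultimately show ?thesis unfolding ImR_iff
    by (intro bexI[of _ "\<lambda>z. F z * of_real ((1 + (cmod z)\<^sup>2) ^ (\<mu> - m))"] ext)
qed

lemma ImR_add:
  assumes "f \<in> ImR \<mu>" "g \<in> ImR \<mu>"
  shows "(\<lambda>z. f z + g z) \<in> ImR \<mu>"
proof -
  obtain F G where "F \<in> bipoly \<mu> \<mu>" "G \<in> bipoly \<mu> \<mu>"
    "f = (\<lambda>z. F z / of_real ((1 + (cmod z)\<^sup>2) ^ \<mu>))" "g = (\<lambda>z. G z / of_real ((1 + (cmod z)\<^sup>2) ^ \<mu>))"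
    using assms unfolding ImR_iff by blast
  then show ?thesis unfolding ImR_iff
    by (intro bexI[of _ "\<lambda>z. F z + G z"] bipoly_add) (simp_all add: add_divide_distrib)
qed

lemma ImR_cmult:
  assumes "f \<in> ImR \<mu>"
  shows "(\<lambda>z. c * f z) \<in> ImR \<mu>"
proof -
  obtain F where "F \<in> bipoly \<mu> \<mu>" "f = (\<lambda>z. F z / of_real ((1 + (cmod z)\<^sup>2) ^ \<mu>))"
    using assms unfolding ImR_iff by blast
  then show ?thesis unfolding ImR_iff
    by (intro bexI[of _ "\<lambda>z. c * F z"] bipoly_cmult) simp_all
qed

lemma ImR_zero: "(\<lambda>z. 0) \<in> ImR \<mu>"
  using ImR_I[OF bipoly_zero, of \<mu> \<mu>] by simp

lemma ImR_sum: "(\<And>x. x \<in> S \<Longrightarrow> f x \<in> ImR \<mu>) \<Longrightarrow> (\<lambda>z. \<Sum>x\<in>S. f x z) \<in> ImR \<mu>"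
  by (induction S rule: infinite_finite_induct) (auto intro: ImR_zero ImR_add)

lemma bipoly_cnj:
  assumes "F \<in> bipoly a b"
  shows "(\<lambda>z. cnj (F z)) \<in> bipoly b a"
proof -
  obtain c where F: "F = (\<lambda>z. \<Sum>i\<le>a. \<Sum>j\<le>b. c i j * (z ^ i * cnj z ^ j))"
    using assms unfolding bipoly_eq by blast
  have "(\<lambda>z. cnj (F z)) = (\<lambda>z. \<Sum>i\<le>a. \<Sum>j\<le>b. cnj (c i j) * (z ^ j * cnj z ^ i))"
    by (simp add: F mult_ac)
  also have "\<dots> \<in> bipoly b a" by (intro bipoly_sum bipoly_monomial) auto
  finally show ?thesis .
qed

lemma ImR_cnj:
  assumes "f \<in> ImR \<mu>"
  shows "(\<lambda>z. cnj (f z)) \<in> ImR \<mu>"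
proof -
  obtain F where "F \<in> bipoly \<mu> \<mu>" "f = (\<lambda>z. F z / of_real ((1 + (cmod z)\<^sup>2) ^ \<mu>))"
    using assms unfolding ImR_iff by blast
  then show ?thesis unfolding ImR_iff
    by (intro bexI[of _ "\<lambda>z. cnj (F z)"] bipoly_cnj) simp_all
qed

lemma ImR_continuous:
  assumes "f \<in> ImR \<mu>"
  shows "continuous_on UNIV f"
proof -
  obtain F where F: "F \<in> bipoly \<mu> \<mu>" "f = (\<lambda>z. F z / of_real ((1 + (cmod z)\<^sup>2) ^ \<mu>))"
    using assms unfolding ImR_iff by blast
  have "complex_of_real ((1 + (cmod z)\<^sup>2) ^ \<mu>) \<noteq> 0" for z
    unfolding of_real_eq_0_iff by simp
  then show ?thesis unfolding F(2) by (intro continuous_intros bipoly_continuous[OF F(1)]) auto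
qed

section \<open>Bounded Borel functions, the normalised kernel and the Berezin transform as an
  integral operator\<close>

definition bdd_borel :: "(complex \<Rightarrow> complex) set" where
  "bdd_borel = {f \<in> borel_measurable borel. \<exists>C. \<forall>z. cmod (f z) \<le> C}"

lemma ImR_bdd_borel: assumes "f \<in> ImR \<mu>" shows "f \<in> bdd_borel"
proof -
  obtain F where F: "F \<in> bipoly \<mu> \<mu>" "f = (\<lambda>z. F z / of_real ((1 + (cmod z)\<^sup>2) ^ \<mu>))"
    using assms unfolding ImR_iff by blast
  obtain C where C: "\<And>z. cmod (F z) \<le> C * (1 + (cmod z)\<^sup>2) ^ \<mu>"
    using bipoly_bound[OF F(1)] by blast
  have "cmod (f z) \<le> C" for z
    unfolding F(2) norm_divide norm_of_real using C[of z] by (simp add: divide_le_eq)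
  moreover have "f \<in> borel_measurable borel"
    using ImR_continuous[OF assms] by (rule borel_measurable_continuous_onI)
  ultimately show ?thesis unfolding bdd_borel_def by blast
qed

lemma bdd_borel_mult: "f \<in> bdd_borel \<Longrightarrow> g \<in> bdd_borel \<Longrightarrow> (\<lambda>z. f z * g z) \<in> bdd_borel"
proof -
  assume f: "f \<in> bdd_borel" and g: "g \<in> bdd_borel"
  then obtain C D where CD: "\<And>z. cmod (f z) \<le> C" "\<And>z. cmod (g z) \<le> D" unfolding bdd_borel_def by blast
  have [measurable]: "f \<in> borel_measurable borel" "g \<in> borel_measurable borel"
    using f g by (auto simp: bdd_borel_def)
  have "cmod (f z * g z) \<le> C * D" for z
    unfolding norm_mult using CD[of z] order_trans[OF norm_ge_zero CD(1)[of z]] by (intro mult_mono) auto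
  then show ?thesis unfolding bdd_borel_def by (auto intro!: exI[of _ "C * D"])
qed

lemma bdd_borel_integrable: "f \<in> bdd_borel \<Longrightarrow> integrable (iota 0) f"
  unfolding bdd_borel_def by (auto intro: integrable_iota_0_bounded)

text \<open>The squared modulus of the inner product of the unit vectors along \<open>(1, z)\<close>
  and \<open>(1, s)\<close>, that is, the transition probability between two points of the
  sphere.\<close>

definition sphker :: "complex \<Rightarrow> complex \<Rightarrow> real" where
  "sphker z s = (cmod (1 + z * cnj s))\<^sup>2 / ((1 + (cmod z)\<^sup>2) * (1 + (cmod s)\<^sup>2))"

text \<open>Lagrange's identity for the vectors \<open>(1, z)\<close> and \<open>(1, s)\<close>:
  inner product and determinant together exhaust the product of the squared norms. It yields both
  \<open>t \<le> 1\<close> and the closed form of \<open>1 - t\<close>.\<close>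

lemma norm_identity:
  "(cmod (1 + z * cnj s))\<^sup>2 + (cmod (z - s))\<^sup>2 = (1 + (cmod z)\<^sup>2) * (1 + (cmod s)\<^sup>2)"
  unfolding cmod_power2 by (simp add: algebra_simps power2_eq_square)

lemma one_minus_sphker: "1 - sphker z s = (cmod (z - s))\<^sup>2 / ((1 + (cmod z)\<^sup>2) * (1 + (cmod s)\<^sup>2))"
proof -
  have "sphker z s + (cmod (z - s))\<^sup>2 / ((1 + (cmod z)\<^sup>2) * (1 + (cmod s)\<^sup>2)) = 1"
    unfolding sphker_def add_divide_distrib[symmetric] norm_identity by simp
  then show ?thesis by simp
qed

lemma sphker_bounds: "0 \<le> sphker z s" "sphker z s \<le> 1"
proof -
  show "0 \<le> sphker z s" by (simp add: sphker_def)
  have "0 \<le> 1 - sphker z s" unfolding one_minus_sphker by simp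
  then show "sphker z s \<le> 1" by simp
qed

lemma sphker_commute: "sphker z s = sphker s z"
proof -
  have "cmod (1 + z * cnj s) = cmod (cnj (1 + z * cnj s))" by (simp only: complex_mod_cnj)
  also have "\<dots> = cmod (1 + s * cnj z)" by (simp add: mult.commute)
  finally show ?thesis by (simp add: sphker_def mult.commute)
qed

lemma sphker_measurable [measurable]: "(\<lambda>s. sphker z s) \<in> borel_measurable borel"
  unfolding sphker_def by measurable

lemma sphker_measurable_pair [measurable]: "(\<lambda>p. sphker (fst p) (snd p)) \<in> borel_measurable (borel \<Otimes>\<^sub>M borel)"
  unfolding sphker_def by measurable

lemma Bber_eq: "Bber \<tau> f z = (\<integral>s. of_real (sphker z s ^ \<tau>) * f s \<partial>iota 0)"
  unfolding Bber_def sphker_def by (simp only: power_divide power_mult_distrib power_mult)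

lemma sphker_power_bdd_borel: "(\<lambda>s. of_real (sphker z s ^ n)) \<in> bdd_borel"
  unfolding bdd_borel_def using sphker_bounds[of z]
  by (auto intro!: exI[of _ 1] power_le_one simp: norm_power abs_of_nonneg simp del: of_real_power)

lemma Bber_integrable: "f \<in> bdd_borel \<Longrightarrow> integrable (iota 0) (\<lambda>s. of_real (sphker z s ^ \<tau>) * f s)"
  by (intro bdd_borel_integrable bdd_borel_mult sphker_power_bdd_borel)

lemma Bber_add:
  assumes "f \<in> bdd_borel" "g \<in> bdd_borel"
  shows "Bber \<tau> (\<lambda>z. f z + g z) z = Bber \<tau> f z + Bber \<tau> g z"
  unfolding Bber_eq distrib_left
  by (intro Bochner_Integration.integral_add Bber_integrable assms)

lemma Bber_cmult: "Bber \<tau> (\<lambda>z. c * f z) z = c * Bber \<tau> f z"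
  unfolding Bber_eq by (simp add: mult.left_commute[of _ c])

lemma Bber_sum:
  assumes "\<And>x. x \<in> S \<Longrightarrow> f x \<in> bdd_borel"
  shows "Bber \<tau> (\<lambda>z. \<Sum>x\<in>S. f x z) z = (\<Sum>x\<in>S. Bber \<tau> (f x) z)"
  unfolding Bber_eq sum_distrib_left
  by (intro Bochner_Integration.integral_sum Bber_integrable assms)

text \<open>The kernel is real and symmetric, so Fubini moves the transform across. The pairing is
  bilinear; conjugates are supplied by \<open>ImR_cnj\<close> where a norm is wanted.\<close>

lemma Bber_selfadjoint:
  assumes f: "f \<in> bdd_borel" and g: "g \<in> bdd_borel"
  shows "(\<integral>z. Bber \<tau> f z * g z \<partial>iota 0) = (\<integral>z. f z * Bber \<tau> g z \<partial>iota 0)"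
proof -
  interpret pair_sigma_finite "iota 0" "iota 0" by simp
  have [measurable]: "f \<in> borel_measurable borel" "g \<in> borel_measurable borel"
    using f g by (auto simp: bdd_borel_def)
  obtain C D where CD: "\<And>z. cmod (f z) \<le> C" "\<And>z. cmod (g z) \<le> D"
    using f g unfolding bdd_borel_def by blast
  have int: "integrable (iota 0 \<Otimes>\<^sub>M iota 0) (\<lambda>(z, s). of_real (sphker z s ^ \<tau>) * f s * g z)"
  proof (rule finite_measure.integrable_const_bound[where B = "1 * C * D"])
    show "finite_measure (iota 0 \<Otimes>\<^sub>M iota 0)"
      by (intro finite_measure_pair_measure) auto
    have "cmod (of_real (sphker z s ^ \<tau>) * f s * g z) \<le> 1 * C * D" for z s
      unfolding norm_mult using CD[of s] CD[of z] order_trans[OF norm_ge_zero CD(1)[of z]] sphker_bounds[of z s]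
      by (intro mult_mono) (auto intro: power_le_one simp: norm_power)
    then show "AE x in iota 0 \<Otimes>\<^sub>M iota 0. cmod (case x of (z, s) \<Rightarrow> of_real (sphker z s ^ \<tau>) * f s * g z) \<le> 1 * C * D"
      by (intro AE_I2) (auto split: prod.split)
  qed (simp add: split_beta')
  have "(\<integral>z. Bber \<tau> f z * g z \<partial>iota 0) = (\<integral>z. (\<integral>s. of_real (sphker z s ^ \<tau>) * f s * g z \<partial>iota 0) \<partial>iota 0)"
    unfolding Bber_eq by simp
  also have "\<dots> = (\<integral>s. (\<integral>z. of_real (sphker z s ^ \<tau>) * f s * g z \<partial>iota 0) \<partial>iota 0)"
    by (rule Fubini_integral[symmetric]) (rule int)
  also have "\<dots> = (\<integral>s. (\<integral>z. f s * (of_real (sphker s z ^ \<tau>) * g z) \<partial>iota 0) \<partial>iota 0)"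
    by (intro Bochner_Integration.integral_cong refl) (subst sphker_commute, simp)
  also have "\<dots> = (\<integral>s. f s * Bber \<tau> g s \<partial>iota 0)"
    unfolding Bber_eq by simp
  finally show ?thesis .
qed

section \<open>Triangular action of the Berezin transform on zonal functions\<close>

text \<open>For \<open>x = cnj y\<close> this is \<open>sphker z y ^ m\<close> up to a constant; the polarised version
  for independent \<open>x\<close> and \<open>y\<close> is what spans \<open>ImR \<mu>\<close>.\<close>

definition zonal :: "nat \<Rightarrow> complex \<Rightarrow> complex \<Rightarrow> nat \<Rightarrow> complex \<Rightarrow> complex" where
  "zonal \<mu> x y m z = (1 + z * x) ^ m * (1 + cnj z * y) ^ m * (1 + x * y) ^ (\<mu> - m) / of_real ((1 + (cmod z)\<^sup>2) ^ m)"

lemma zonal_in_ImR: "m \<le> \<mu> \<Longrightarrow> zonal \<mu> x y m \<in> ImR \<mu>"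
proof -
  assume m: "m \<le> \<mu>"
  have "(\<lambda>z. (1 + x * y) ^ (\<mu> - m) * ((1 + z * x) ^ m * (1 + cnj z * y) ^ m)) \<in> bipoly m m"
    using bipoly_cmult[OF bipoly_mult[OF bipoly_kernel(1)[of x m] bipoly_kernel(2)[of y m]]] by simp
  from ImR_I[OF this m] show ?thesis unfolding zonal_def[abs_def] by (simp add: mult_ac)
qed

text \<open>The first quotient compares \<open>\<tau> + 1\<close> with the normalising factor of
  \<open>iota (\<tau> + m)\<close>, against which the integral is evaluated; the second is the
  numerical part of a summand in \<open>integral_iota_linear_forms\<close> for the powers
  \<open>\<tau>\<close> and \<open>m\<close>.\<close>

definition Bcoeff :: "nat \<Rightarrow> nat \<Rightarrow> nat \<Rightarrow> real" where
  "Bcoeff \<tau> m j = (real \<tau> + 1) / (real \<tau> + real m + 1) *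
     (real (m choose j) * real (\<tau> choose j) / real ((\<tau> + m) choose m))"

lemma one_plus_norm_sq_complex: "complex_of_real (1 + (cmod z)\<^sup>2) = 1 + cnj z * z"
  using complex_norm_square[of z] by (simp add: mult.commute)

lemma of_real_sphker: "complex_of_real (sphker z s) = (1 + cnj z * s) * cnj (1 + cnj z * s) / (of_real (1 + (cmod z)\<^sup>2) * of_real (1 + (cmod s)\<^sup>2))"
proof -
  have "complex_of_real ((cmod (1 + z * cnj s))\<^sup>2) = (1 + z * cnj s) * cnj (1 + z * cnj s)"
    by (rule complex_norm_square)
  then show ?thesis unfolding sphker_def by (simp only: of_real_divide of_real_mult) (simp add: mult.commute)
qed

text \<open>The integrand pairs the forms \<open>(1, cnj z)\<close> and \<open>(1, x)\<close>, to
  the powers \<open>\<tau>\<close> and \<open>m\<close>, with \<open>(1, cnj z)\<close> and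
  \<open>(1, cnj y)\<close>. The pairings are \<open>1 + |z|^2\<close>, \<open>1 + x * y\<close>,
  \<open>1 + cnj z * y\<close> and \<open>1 + x * z\<close>. The leftover
  \<open>(1 + x * y) ^ (m - j)\<close> is absorbed by the constant factor built into
  \<open>zonal\<close>, which is the reason for that factor.\<close>

lemma Bber_zonal:
  assumes "m \<le> \<tau>" "m \<le> \<mu>"
  shows "of_real (real \<tau> + 1) * Bber \<tau> (zonal \<mu> x y m) z = (\<Sum>j\<le>m. of_real (Bcoeff \<tau> m j) * zonal \<mu> x y j z)"
proof -
  define N where "N = \<tau> + m"
  define Z where "Z = complex_of_real (1 + (cmod z)\<^sup>2)"
  define h where "h s = (1 + cnj z * s) ^ \<tau> * (1 + x * s) ^ m * cnj ((1 + cnj z * s) ^ \<tau> * (1 + cnj y * s) ^ m)" for s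
  define K where "K = (1 + x * y) ^ (\<mu> - m) / Z ^ \<tau>"
  have Z0: "Z \<noteq> 0" unfolding Z_def of_real_eq_0_iff by simp
  have hm: "h \<in> borel_measurable borel" unfolding h_def by measurable
  have "of_real (sphker z s ^ \<tau>) * zonal \<mu> x y m s = K * (h s / of_real ((1 + (cmod s)\<^sup>2) ^ N))" for s
    unfolding of_real_power of_real_sphker zonal_def K_def h_def Z_def[symmetric] N_def
    by (simp only: power_divide power_mult_distrib power_add of_real_mult of_real_power complex_cnj_mult complex_cnj_power
        complex_cnj_add complex_cnj_one complex_cnj_cnj) (simp add: mult_ac)
  then have "Bber \<tau> (zonal \<mu> x y m) z = (\<integral>s. K * (h s / of_real ((1 + (cmod s)\<^sup>2) ^ N)) \<partial>iota 0)"
    unfolding Bber_eq by (simp only:)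
  also have "\<dots> = K * (\<integral>s. h s / of_real ((1 + (cmod s)\<^sup>2) ^ N) \<partial>iota 0)"
    by (rule integral_mult_right_zero)
  also have "(\<integral>s. h s / of_real ((1 + (cmod s)\<^sup>2) ^ N) \<partial>iota 0) = (\<integral>s. h s \<partial>iota N) / of_nat (N + 1)"
    unfolding integral_iota[OF hm] by (simp del: of_nat_Suc of_nat_add)
  also have "(\<integral>s. h s \<partial>iota N) =
     (\<Sum>j\<le>m. of_nat (m choose j) * of_nat (\<tau> choose j) * Z ^ (\<tau> - j) * (1 + x * y) ^ (m - j) * ((1 + cnj z * y) * (1 + x * z)) ^ j)
          / of_nat (N choose m)"
    unfolding h_def N_def Z_def one_plus_norm_sq_complex
    by (subst integral_iota_linear_forms) simp
  finally have B: "Bber \<tau> (zonal \<mu> x y m) z = K * ((\<Sum>j\<le>m. of_nat (m choose j) * of_nat (\<tau> choose j) * Z ^ (\<tau> - j) * (1 + x * y) ^ (m - j) * ((1 + cnj z * y) * (1 + x * z)) ^ j)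
          / of_nat (N choose m) / of_nat (N + 1))" .
  have summand: "of_real (real \<tau> + 1) * (K * (of_nat (m choose j) * of_nat (\<tau> choose j) * Z ^ (\<tau> - j) * (1 + x * y) ^ (m - j) * ((1 + cnj z * y) * (1 + x * z)) ^ j
          / of_nat (N choose m) / of_nat (N + 1))) = of_real (Bcoeff \<tau> m j) * zonal \<mu> x y j z" if "j \<le> m" for j
  proof -
    have 1: "(1 + x * y) ^ (\<mu> - j) = (1 + x * y) ^ (\<mu> - m) * (1 + x * y) ^ (m - j)"
      using that assms by (simp flip: power_add)
    have 2: "Z ^ \<tau> = Z ^ (\<tau> - j) * Z ^ j"
      using that assms by (simp flip: power_add)
    have 3: "complex_of_real (Bcoeff \<tau> m j) = of_real (real \<tau> + 1) * (of_nat (m choose j) * of_nat (\<tau> choose j)) / of_nat (N choose m) / of_nat (N + 1)"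
      unfolding Bcoeff_def N_def by simp
    show ?thesis unfolding 3 K_def zonal_def of_real_power Z_def[symmetric] 1 2
      using Z0 by (simp add: power_mult_distrib mult_ac)
  qed
  show ?thesis unfolding B sum_divide_distrib sum_distrib_left
    by (intro sum.cong refl summand) auto
qed

section \<open>Limits of the triangular coefficients and of the inverse matrix\<close>

lemma binomial_over_power_tendsto: "(\<lambda>n. real ((n + d) choose j) / real n ^ j) \<longlonglongrightarrow> 1 / fact j"
proof -
  have "(\<lambda>n. (\<Prod>i = 0..<j. (real n + real d - real i) / real n) / fact j) \<longlonglongrightarrow> (\<Prod>i = 0..<j. 1) / fact j"
  proof (intro tendsto_divide tendsto_prod tendsto_const)
    fix i
    have "(\<lambda>n. 1 + (real d - real i) / real n) \<longlonglongrightarrow> 1 + 0"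
      by (intro tendsto_add tendsto_const lim_const_over_n)
    moreover have "eventually (\<lambda>n. 1 + (real d - real i) / real n = (real n + real d - real i) / real n) sequentially"
      using eventually_gt_at_top[of 0] by eventually_elim (simp add: field_simps)
    ultimately show "(\<lambda>n. (real n + real d - real i) / real n) \<longlonglongrightarrow> 1"
      by (simp add: tendsto_cong)
  qed auto
  moreover have "real ((n + d) choose j) / real n ^ j = (\<Prod>i = 0..<j. (real n + real d - real i) / real n) / fact j" for n
    by (simp add: binomial_gbinomial gbinomial_prod_rev prod_dividef)
  ultimately show ?thesis by simp
qed

text \<open>As polynomials in \<open>n\<close> the two binomials have degrees \<open>j\<close> and
  \<open>m\<close>, and the shifts \<open>d\<close> and \<open>e\<close> change neither degree nor
  leading coefficient.\<close>

lemma binomial_ratio_tendsto: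
  assumes "j \<le> m"
  shows "(\<lambda>n. real ((n + d) choose j) / real ((n + e) choose m)) \<longlonglongrightarrow> (if j = m then 1 else 0)"
proof -
  have "(\<lambda>n. (real ((n + d) choose j) / real n ^ j) / (real ((n + e) choose m) / real n ^ m) * (1 / real n) ^ (m - j))
      \<longlonglongrightarrow> (1 / fact j) / (1 / fact m) * 0 ^ (m - j)"
    by (intro tendsto_mult tendsto_divide tendsto_power binomial_over_power_tendsto lim_const_over_n) auto
  moreover have "eventually (\<lambda>n. (real ((n + d) choose j) / real n ^ j) / (real ((n + e) choose m) / real n ^ m) * (1 / real n) ^ (m - j)
     = real ((n + d) choose j) / real ((n + e) choose m)) sequentially"
    using eventually_gt_at_top[of 0]
  proof eventually_elim
    case (elim n)
    have "real n ^ m = real n ^ j * real n ^ (m - j)" using assms by (simp flip: power_add)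
    then show ?case using elim by (simp add: power_divide)
  qed
  moreover have "(1 / fact j) / (1 / fact m) * 0 ^ (m - j) = (if j = m then 1 else (0::real))"
    using assms by (auto simp: power_0_left)
  ultimately show ?thesis by (simp add: tendsto_cong)
qed

lemma Bcoeff_tendsto:
  assumes "j \<le> m"
  shows "(\<lambda>\<tau>. Bcoeff \<tau> m j) \<longlonglongrightarrow> (if j = m then 1 else 0)"
proof -
  have "(\<lambda>\<tau>. real ((\<tau> + 1) choose 1) / real ((\<tau> + (m + 1)) choose 1)) \<longlonglongrightarrow> 1"
    using binomial_ratio_tendsto[of 1 1 1 "m + 1"] by simp
  then have "(\<lambda>\<tau>. (real \<tau> + 1) / (real \<tau> + real m + 1)) \<longlonglongrightarrow> 1" by (simp add: add_ac)
  moreover have "(\<lambda>\<tau>. real (m choose j) * (real ((\<tau> + 0) choose j) / real ((\<tau> + m) choose m))) \<longlonglongrightarrow> real (m choose j) * (if j = m then 1 else 0)"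
    by (intro tendsto_mult tendsto_const binomial_ratio_tendsto assms)
  ultimately have "(\<lambda>\<tau>. (real \<tau> + 1) / (real \<tau> + real m + 1) * (real (m choose j) * (real ((\<tau> + 0) choose j) / real ((\<tau> + m) choose m))))
     \<longlonglongrightarrow> 1 * (real (m choose j) * (if j = m then 1 else 0))"
    by (rule tendsto_mult)
  then show ?thesis unfolding Bcoeff_def by (cases "j = m") simp_all
qed

lemma Bcoeff_diag_pos: "m \<le> \<tau> \<Longrightarrow> Bcoeff \<tau> m m > 0"
  unfolding Bcoeff_def by (auto intro!: mult_pos_pos divide_pos_pos)

context notes sum.cong [fundef_cong]
begin

text \<open>Forward substitution for the inverse of the lower triangular matrix
  \<open>Bcoeff \<tau>\<close>, meaningful in the rows \<open>m \<le> \<tau>\<close>, where the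
  diagonal is positive. The congruence rule for sums exposes \<open>l < m\<close> to the termination
  proof.\<close>

function Binv :: "nat \<Rightarrow> nat \<Rightarrow> nat \<Rightarrow> real" where
  "Binv \<tau> m j = ((if j = m then 1 else 0) - (\<Sum>l<m. Bcoeff \<tau> m l * Binv \<tau> l j)) / Bcoeff \<tau> m m"
  by pat_completeness auto
termination by (relation "Wellfounded.measure (\<lambda>(\<tau>, m, j). m)") auto

end

declare Binv.simps [simp del]

lemma Binv_eq_0: "m < j \<Longrightarrow> Binv \<tau> m j = 0"
proof (induction m rule: less_induct)
  case (less m)
  then show ?case by (subst Binv.simps) simp
qed

text \<open>The recursion expresses row \<open>m\<close> through finitely many earlier rows, with
  off-diagonal weights tending to 0 and a divisor tending to 1.\<close>

lemma Binv_tendsto: "(\<lambda>\<tau>. Binv \<tau> m j) \<longlonglongrightarrow> (if j = m then 1 else 0)"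
proof (induction m rule: less_induct)
  case (less m)
  have "(\<lambda>\<tau>. ((if j = m then 1 else 0) - (\<Sum>l<m. Bcoeff \<tau> m l * Binv \<tau> l j)) / Bcoeff \<tau> m m)
    \<longlonglongrightarrow> ((if j = m then 1 else 0) - (\<Sum>l<m. 0 * (if j = l then 1 else 0))) / 1"
  proof (intro tendsto_divide tendsto_diff tendsto_const tendsto_sum tendsto_mult)
    show "(\<lambda>\<tau>. Bcoeff \<tau> m m) \<longlonglongrightarrow> 1" using Bcoeff_tendsto[of m m] by simp
    fix l assume l: "l \<in> {..<m}"
    then show "(\<lambda>\<tau>. Bcoeff \<tau> m l) \<longlonglongrightarrow> 0" using Bcoeff_tendsto[of l m] by simp
    show "(\<lambda>\<tau>. Binv \<tau> l j) \<longlonglongrightarrow> (if j = l then 1 else 0)" using less l by simp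
  qed simp
  then show ?case by (subst Binv.simps) simp
qed

definition zonal_inv :: "nat \<Rightarrow> nat \<Rightarrow> complex \<Rightarrow> complex \<Rightarrow> nat \<Rightarrow> complex \<Rightarrow> complex" where
  "zonal_inv \<tau> \<mu> x y m z = (\<Sum>j\<le>m. of_real (Binv \<tau> m j) * zonal \<mu> x y j z)"

lemma zonal_inv_in_ImR: "m \<le> \<mu> \<Longrightarrow> zonal_inv \<tau> \<mu> x y m \<in> ImR \<mu>"
  unfolding zonal_inv_def[abs_def] by (intro ImR_sum ImR_cmult zonal_in_ImR) auto

lemma zonal_inv_rec:
  assumes "m \<le> \<tau>"
  shows "zonal_inv \<tau> \<mu> x y m z =
    (1 / of_real (Bcoeff \<tau> m m)) * (zonal \<mu> x y m z + (\<Sum>l<m. - of_real (Bcoeff \<tau> m l) * zonal_inv \<tau> \<mu> x y l z))"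
proof -
  \<comment> \<open>\<open>Binv \<tau> l j\<close> vanishes for \<open>j > l\<close>, so all rows
    can be summed over the common range \<open>j \<le> m\<close> and the two sums
    interchanged.\<close>
  have *: "(\<Sum>j\<le>m. of_real (Binv \<tau> l j) * zonal \<mu> x y j z) = zonal_inv \<tau> \<mu> x y l z" if "l < m" for l
    unfolding zonal_inv_def
    using that by (intro sum.mono_neutral_right) (auto simp: Binv_eq_0)
  have "zonal_inv \<tau> \<mu> x y m z =
     (\<Sum>j\<le>m. (1 / of_real (Bcoeff \<tau> m m)) * (((if j = m then 1 else 0) - (\<Sum>l<m. of_real (Bcoeff \<tau> m l) * of_real (Binv \<tau> l j))) * zonal \<mu> x y j z))"
    unfolding zonal_inv_def by (subst Binv.simps) (simp add: if_distrib[of complex_of_real] cong: if_cong)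
  also have "\<dots> = (1 / of_real (Bcoeff \<tau> m m)) * ((\<Sum>j\<le>m. (if j = m then 1 else 0) * zonal \<mu> x y j z)
     - (\<Sum>j\<le>m. \<Sum>l<m. of_real (Bcoeff \<tau> m l) * (of_real (Binv \<tau> l j) * zonal \<mu> x y j z)))"
    by (simp only: sum_distrib_left[symmetric] left_diff_distrib sum_subtractf sum_distrib_right mult.assoc)
  also have "(\<Sum>j\<le>m. (if j = m then 1 else 0) * zonal \<mu> x y j z) = zonal \<mu> x y m z"
    by (simp add: if_distribR if_distrib sum.delta cong: if_cong)
  also have "(\<Sum>j\<le>m. \<Sum>l<m. of_real (Bcoeff \<tau> m l) * (of_real (Binv \<tau> l j) * zonal \<mu> x y j z)) =
     (\<Sum>l<m. of_real (Bcoeff \<tau> m l) * zonal_inv \<tau> \<mu> x y l z)"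
    by (subst sum.swap) (intro sum.cong refl, simp add: sum_distrib_left[symmetric] *)
  finally show ?thesis by (simp add: sum_negf)
qed

text \<open>When the transform is applied to the recursion, the induction hypothesis replaces every
  lower preimage by the zonal function itself, and these cancel the off-diagonal terms of
  \<open>Bber_zonal\<close>.\<close>

lemma Bber_zonal_inv:
  assumes "m \<le> \<tau>" "m \<le> \<mu>"
  shows "of_real (real \<tau> + 1) * Bber \<tau> (zonal_inv \<tau> \<mu> x y m) z = zonal \<mu> x y m z"
  using assms
proof (induction m rule: less_induct)
  case (less m)
  have a0: "complex_of_real (Bcoeff \<tau> m m) \<noteq> 0" using Bcoeff_diag_pos[OF less.prems(1)] by simp
  have zb: "zonal \<mu> x y m \<in> bdd_borel" "\<And>l. l < m \<Longrightarrow> zonal_inv \<tau> \<mu> x y l \<in> bdd_borel"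
    using less.prems by (auto intro!: ImR_bdd_borel zonal_in_ImR zonal_inv_in_ImR)
  have sb: "(\<lambda>z. \<Sum>l<m. - of_real (Bcoeff \<tau> m l) * zonal_inv \<tau> \<mu> x y l z) \<in> ImR \<mu>"
    using less.prems by (intro ImR_sum ImR_cmult zonal_inv_in_ImR) auto
  have cb: "(\<lambda>z. - of_real (Bcoeff \<tau> m l) * zonal_inv \<tau> \<mu> x y l z) \<in> bdd_borel" if "l < m" for l
    using less.prems that by (intro ImR_bdd_borel[of _ \<mu>] ImR_cmult zonal_inv_in_ImR) auto
  have "Bber \<tau> (zonal_inv \<tau> \<mu> x y m) z = (1 / of_real (Bcoeff \<tau> m m)) *
      (Bber \<tau> (zonal \<mu> x y m) z + (\<Sum>l<m. - of_real (Bcoeff \<tau> m l) * Bber \<tau> (zonal_inv \<tau> \<mu> x y l) z))"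
    unfolding zonal_inv_rec[OF less.prems(1), abs_def] Bber_cmult
    using zb cb by (subst Bber_add[OF zb(1) ImR_bdd_borel[OF sb]], subst Bber_sum) (auto simp only: Bber_cmult lessThan_iff)
  then have "of_real (real \<tau> + 1) * Bber \<tau> (zonal_inv \<tau> \<mu> x y m) z = (1 / of_real (Bcoeff \<tau> m m)) *
      (of_real (real \<tau> + 1) * Bber \<tau> (zonal \<mu> x y m) z + (\<Sum>l<m. - of_real (Bcoeff \<tau> m l) * (of_real (real \<tau> + 1) * Bber \<tau> (zonal_inv \<tau> \<mu> x y l) z)))"
    by (simp only: distrib_left sum_distrib_left mult_ac)
  also have "of_real (real \<tau> + 1) * Bber \<tau> (zonal \<mu> x y m) z = (\<Sum>j<m. of_real (Bcoeff \<tau> m j) * zonal \<mu> x y j z) + of_real (Bcoeff \<tau> m m) * zonal \<mu> x y m z"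
    unfolding Bber_zonal[OF less.prems] lessThan_Suc_atMost[symmetric] by simp
  also have "(\<Sum>l<m. - of_real (Bcoeff \<tau> m l) * (of_real (real \<tau> + 1) * Bber \<tau> (zonal_inv \<tau> \<mu> x y l) z))
      = (\<Sum>l<m. - of_real (Bcoeff \<tau> m l) * zonal \<mu> x y l z)"
    using less by (intro sum.cong refl) simp
  finally show ?case using a0 by (simp add: sum_negf)
qed

lemma uniform_limit_sum_fun:
  fixes f :: "'i \<Rightarrow> 'n \<Rightarrow> complex \<Rightarrow> complex"
  assumes "\<And>i. i \<in> S \<Longrightarrow> uniform_limit X (f i) (g i) F"
  shows "uniform_limit X (\<lambda>n z. \<Sum>i\<in>S. f i n z) (\<lambda>z. \<Sum>i\<in>S. g i z) F"
  using assms
  by (induction S rule: infinite_finite_induct) (auto intro!: uniform_limit_add uniform_limit_const)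

lemma uniform_limit_coeff_mult:
  fixes g :: "complex \<Rightarrow> complex"
  assumes "(c \<longlongrightarrow> c0) F" and g: "\<And>z. cmod (g z) \<le> C"
  shows "uniform_limit UNIV (\<lambda>n z. c n * g z) (\<lambda>z. c0 * g z) F"
proof (rule uniform_lim_mult)
  show "uniform_limit UNIV (\<lambda>n z. c n) (\<lambda>z. c0) F"
    using assms(1) by (auto simp: uniform_limit_iff tendsto_iff)
  show "bounded (g ` UNIV)" using g by (auto simp: bounded_iff)
qed (auto simp: uniform_limit_const)

lemma zonal_inv_tendsto:
  assumes "m \<le> \<mu>"
  shows "uniform_limit UNIV (\<lambda>\<tau>. zonal_inv \<tau> \<mu> x y m) (zonal \<mu> x y m) sequentially"
proof -
  have "uniform_limit UNIV (\<lambda>\<tau> z. \<Sum>j\<le>m. of_real (Binv \<tau> m j) * zonal \<mu> x y j z)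
     (\<lambda>z. \<Sum>j\<le>m. of_real (if j = m then 1 else 0) * zonal \<mu> x y j z) sequentially"
  proof (intro uniform_limit_sum_fun)
    fix j assume "j \<in> {..m}"
    then have "zonal \<mu> x y j \<in> bdd_borel" using assms by (auto intro!: ImR_bdd_borel zonal_in_ImR)
    then obtain C where "\<And>z. cmod (zonal \<mu> x y j z) \<le> C" unfolding bdd_borel_def by blast
    then show "uniform_limit UNIV (\<lambda>\<tau> z. of_real (Binv \<tau> m j) * zonal \<mu> x y j z)
     (\<lambda>z. of_real (if j = m then 1 else 0) * zonal \<mu> x y j z) sequentially"
      by (intro uniform_limit_coeff_mult tendsto_of_real Binv_tendsto)
  qed
  moreover have "(\<Sum>j\<le>m. complex_of_real (if j = m then 1 else 0) * zonal \<mu> x y j z) = zonal \<mu> x y m z" for z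
    by (simp add: if_distribR if_distrib sum.delta cong: if_cong)
  ultimately show ?thesis unfolding zonal_inv_def[abs_def] by simp
qed

section \<open>Inverting the Berezin transform on ImR\<close>

text \<open>Orthogonality of characters of the cyclic group of order \<open>n\<close>; the bounds on
  \<open>i\<close> and \<open>j\<close> keep distinct exponents distinct modulo
  \<open>n\<close>.\<close>

lemma root_of_unity_sum:
  fixes n i j :: nat
  assumes "i < n" "j < n"
  defines "w \<equiv> cis (2 * pi / real n)"
  shows "(\<Sum>p<n. (w ^ p) ^ j * cnj (w ^ p) ^ i) = (if i = j then of_nat n else 0)"
proof -
  define \<zeta> where "\<zeta> = w ^ j * cnj w ^ i"
  have n: "n > 0" using assms by simp
  have "(w ^ p) ^ j * cnj (w ^ p) ^ i = \<zeta> ^ p" for p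
    by (simp add: \<zeta>_def power_mult_distrib power_mult[symmetric] mult.commute)
  then have S: "(\<Sum>p<n. (w ^ p) ^ j * cnj (w ^ p) ^ i) = (\<Sum>p<n. \<zeta> ^ p)" by simp
  have z: "\<zeta> = cis (2 * pi * (real j - real i) / real n)"
    unfolding \<zeta>_def w_def cis_cnj Complex.DeMoivre cis_mult
    by (rule arg_cong[of _ _ cis]) (simp add: algebra_simps diff_divide_distrib)
  have zn: "\<zeta> ^ n = 1"
  proof -
    have "\<zeta> ^ n = cis (2 * pi * of_int (int j - int i))"
      unfolding z Complex.DeMoivre using n by simp
    then show ?thesis by (simp add: cis_multiple_2pi)
  qed
  show ?thesis
  proof (cases "i = j")
    case True
    then show ?thesis unfolding S z by simp
  next
    case False
    have "\<zeta> \<noteq> 1"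
    proof
      assume "\<zeta> = 1"
      then have "Re \<zeta> = 1" by simp
      then have "cos (2 * pi * (real j - real i) / real n) = 1" by (simp add: z)
      then obtain k :: int where "2 * pi * (real j - real i) / real n = of_int k * 2 * pi"
        unfolding cos_one_2pi_int by blast
      then have "2 * pi * ((real j - real i) / real n) = 2 * pi * of_int k" by simp
      then have "(real j - real i) / real n = of_int k" by (subst (asm) mult_cancel_left) simp
      then have "real j - real i = of_int k * real n" using n by (simp add: divide_eq_eq)
      then have k: "int j - int i = k * int n"
        by (metis of_int_diff of_int_eq_iff of_int_mult of_int_of_nat_eq)
      then have "\<bar>k * int n\<bar> < int n" using assms(1,2) by linarith
      then have "\<bar>k\<bar> * int n < 1 * int n" by (simp add: abs_mult)
      then have "k = 0" using n by (simp only: mult_less_cancel_right) auto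
      with k False show False by simp
    qed
    then show ?thesis using zn False unfolding S by (simp add: sum_gp_strict)
  qed
qed

text \<open>As a polynomial in \<open>x\<close>, \<open>(1 + z * x) ^ \<mu>\<close> has coefficients
  \<open>(\<mu> choose i) * z ^ i\<close>. Sampling at the roots of unity of order
  \<open>\<mu> + 1\<close>, one for each coefficient, and inverting the discrete Fourier transform
  isolates them; the denominator of \<open>\<alpha>\<close> removes the binomial and the number of
  nodes.\<close>

lemma monomial_as_kernel_sum:
  "\<exists>\<alpha> x. \<forall>i\<le>\<mu>. \<forall>z::complex. z ^ i = (\<Sum>p\<le>\<mu>. \<alpha> i p * (1 + z * x p) ^ \<mu>)"
proof -
  define n where "n = Suc \<mu>"
  define w where "w = cis (2 * pi / real n)"
  define x where "x p = w ^ p" for p :: nat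
  define \<alpha> where "\<alpha> i p = cnj (x p) ^ i / (of_nat n * of_nat (\<mu> choose i))" for i p
  have "z ^ i = (\<Sum>p\<le>\<mu>. \<alpha> i p * (1 + z * x p) ^ \<mu>)" if "i \<le> \<mu>" for i z
  proof -
    have "(\<Sum>p\<le>\<mu>. cnj (x p) ^ i * (1 + z * x p) ^ \<mu>) = (\<Sum>p\<le>\<mu>. \<Sum>j\<le>\<mu>. of_nat (\<mu> choose j) * z ^ j * ((w ^ p) ^ j * cnj (w ^ p) ^ i))"
      unfolding linear_form_power x_def sum_distrib_left by (simp add: mult_ac)
    also have "\<dots> = (\<Sum>j\<le>\<mu>. of_nat (\<mu> choose j) * z ^ j * (\<Sum>p<n. (w ^ p) ^ j * cnj (w ^ p) ^ i))"
      unfolding n_def lessThan_Suc_atMost sum_distrib_left by (rule sum.swap)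
    also have "\<dots> = (\<Sum>j\<le>\<mu>. of_nat (\<mu> choose j) * z ^ j * (if i = j then of_nat n else 0))"
      using that unfolding w_def by (intro sum.cong refl, subst root_of_unity_sum) (auto simp: n_def)
    also have "\<dots> = of_nat (\<mu> choose i) * z ^ i * of_nat n"
      using that by (simp add: if_distrib sum.delta cong: if_cong)
    finally have E: "(\<Sum>p\<le>\<mu>. cnj (x p) ^ i * (1 + z * x p) ^ \<mu>) = of_nat (\<mu> choose i) * z ^ i * of_nat n" .
    have "(\<Sum>p\<le>\<mu>. \<alpha> i p * (1 + z * x p) ^ \<mu>) = (\<Sum>p\<le>\<mu>. cnj (x p) ^ i * (1 + z * x p) ^ \<mu>) / (of_nat n * of_nat (\<mu> choose i))"
      unfolding \<alpha>_def sum_divide_distrib by simp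
    also have "\<dots> = z ^ i"
      unfolding E using that by (simp add: n_def del: of_nat_Suc)
    finally show ?thesis ..
  qed
  then show ?thesis by blast
qed

text \<open>At the top index \<open>m = \<mu>\<close> the constant factor of \<open>zonal\<close> is
  1, so the kernel expansions of \<open>z ^ i\<close> and \<open>cnj z ^ j\<close>, taken at the
  same nodes, multiply to zonal functions.\<close>

lemma ImR_zonal_span:
  assumes "f \<in> ImR \<mu>"
  shows "\<exists>c x. f = (\<lambda>z. \<Sum>p\<le>\<mu>. \<Sum>q\<le>\<mu>. c p q * zonal \<mu> (x p) (x q) \<mu> z)"
proof -
  obtain F where "F \<in> bipoly \<mu> \<mu>" and f: "f = (\<lambda>z. F z / of_real ((1 + (cmod z)\<^sup>2) ^ \<mu>))"
    using assms unfolding ImR_iff by blast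
  then obtain c where F: "F = (\<lambda>z. \<Sum>i\<le>\<mu>. \<Sum>j\<le>\<mu>. c i j * (z ^ i * cnj z ^ j))"
    unfolding bipoly_eq by blast
  obtain \<alpha> :: "nat \<Rightarrow> nat \<Rightarrow> complex" and x :: "nat \<Rightarrow> complex"
    where a: "\<And>i z. i \<le> \<mu> \<Longrightarrow> z ^ i = (\<Sum>p\<le>\<mu>. \<alpha> i p * (1 + z * x p) ^ \<mu>)"
    using monomial_as_kernel_sum[of \<mu>] by blast
  define d where "d p q = (\<Sum>i\<le>\<mu>. \<Sum>j\<le>\<mu>. c i j * (\<alpha> i p * \<alpha> j q))" for p q
  have "f z = (\<Sum>p\<le>\<mu>. \<Sum>q\<le>\<mu>. d p q * zonal \<mu> (x p) (x q) \<mu> z)" for z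
  proof -
    define G where "G p q = (1 + z * x p) ^ \<mu> * (1 + cnj z * x q) ^ \<mu>" for p q
    have "z ^ i * cnj z ^ j = (\<Sum>p\<le>\<mu>. \<Sum>q\<le>\<mu>. (\<alpha> i p * \<alpha> j q) * G p q)" if "i \<le> \<mu>" "j \<le> \<mu>" for i j
      unfolding a[OF that(1)] a[OF that(2)] sum_product G_def by (simp add: mult_ac)
    then have "F z = (\<Sum>i\<le>\<mu>. \<Sum>j\<le>\<mu>. c i j * (\<Sum>p\<le>\<mu>. \<Sum>q\<le>\<mu>. (\<alpha> i p * \<alpha> j q) * G p q))"
      unfolding F by (intro sum.cong refl) simp
    also have "\<dots> = (\<Sum>i\<le>\<mu>. \<Sum>j\<le>\<mu>. \<Sum>p\<le>\<mu>. \<Sum>q\<le>\<mu>. c i j * (\<alpha> i p * \<alpha> j q) * G p q)"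
      by (simp only: sum_distrib_left mult.assoc)
    also have "\<dots> = (\<Sum>i\<le>\<mu>. \<Sum>p\<le>\<mu>. \<Sum>j\<le>\<mu>. \<Sum>q\<le>\<mu>. c i j * (\<alpha> i p * \<alpha> j q) * G p q)"
      by (rule sum.cong[OF refl], rule sum.swap)
    also have "\<dots> = (\<Sum>p\<le>\<mu>. \<Sum>i\<le>\<mu>. \<Sum>j\<le>\<mu>. \<Sum>q\<le>\<mu>. c i j * (\<alpha> i p * \<alpha> j q) * G p q)"
      by (rule sum.swap)
    also have "\<dots> = (\<Sum>p\<le>\<mu>. \<Sum>i\<le>\<mu>. \<Sum>q\<le>\<mu>. \<Sum>j\<le>\<mu>. c i j * (\<alpha> i p * \<alpha> j q) * G p q)"
      by (rule sum.cong[OF refl], rule sum.cong[OF refl], rule sum.swap)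
    also have "\<dots> = (\<Sum>p\<le>\<mu>. \<Sum>q\<le>\<mu>. \<Sum>i\<le>\<mu>. \<Sum>j\<le>\<mu>. c i j * (\<alpha> i p * \<alpha> j q) * G p q)"
      by (rule sum.cong[OF refl], rule sum.swap)
    also have "\<dots> = (\<Sum>p\<le>\<mu>. \<Sum>q\<le>\<mu>. d p q * G p q)"
      unfolding d_def sum_distrib_right ..
    finally show ?thesis unfolding f zonal_def G_def by (simp add: sum_divide_distrib)
  qed
  then show ?thesis by blast
qed

text \<open>The zonal expansion of \<open>f\<close> does not involve \<open>\<tau>\<close>, so
  replacing each zonal function by its preimage gives preimages of \<open>f\<close> whose limit is
  taken term by term.\<close>

lemma ImR_inverse_family:
  assumes "f \<in> ImR \<mu>"
  obtains h where "\<And>\<tau>. \<mu> \<le> \<tau> \<Longrightarrow> h \<tau> \<in> ImR \<mu>"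
    and "\<And>\<tau> z. \<mu> \<le> \<tau> \<Longrightarrow> of_real (real \<tau> + 1) * Bber \<tau> (h \<tau>) z = f z"
    and "uniform_limit UNIV h f sequentially"
proof -
  obtain c x where f: "f = (\<lambda>z. \<Sum>p\<le>\<mu>. \<Sum>q\<le>\<mu>. c p q * zonal \<mu> (x p) (x q) \<mu> z)"
    using ImR_zonal_span[OF assms] by blast
  define h where "h \<tau> = (\<lambda>z. \<Sum>p\<le>\<mu>. \<Sum>q\<le>\<mu>. c p q * zonal_inv \<tau> \<mu> (x p) (x q) \<mu> z)" for \<tau>
  have "h \<tau> \<in> ImR \<mu>" for \<tau>
    unfolding h_def by (intro ImR_sum ImR_cmult zonal_inv_in_ImR) auto
  moreover have "of_real (real \<tau> + 1) * Bber \<tau> (h \<tau>) z = f z" if "\<mu> \<le> \<tau>" for \<tau> z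
  proof -
    have "Bber \<tau> (h \<tau>) z = (\<Sum>p\<le>\<mu>. \<Sum>q\<le>\<mu>. c p q * Bber \<tau> (zonal_inv \<tau> \<mu> (x p) (x q) \<mu>) z)"
    proof -
      have i: "(\<lambda>z. c p q * zonal_inv \<tau> \<mu> (x p) (x q) \<mu> z) \<in> ImR \<mu>" for p q
        by (intro ImR_cmult zonal_inv_in_ImR) auto
      have "Bber \<tau> (h \<tau>) z = (\<Sum>p\<le>\<mu>. Bber \<tau> (\<lambda>z. \<Sum>q\<le>\<mu>. c p q * zonal_inv \<tau> \<mu> (x p) (x q) \<mu> z) z)"
        unfolding h_def by (rule Bber_sum) (intro ImR_bdd_borel[of _ \<mu>] ImR_sum i)
      also have "\<dots> = (\<Sum>p\<le>\<mu>. \<Sum>q\<le>\<mu>. Bber \<tau> (\<lambda>z. c p q * zonal_inv \<tau> \<mu> (x p) (x q) \<mu> z) z)"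
        by (intro sum.cong refl Bber_sum ImR_bdd_borel[of _ \<mu>] i)
      finally show ?thesis by (simp only: Bber_cmult)
    qed
    then have "of_real (real \<tau> + 1) * Bber \<tau> (h \<tau>) z =
       (\<Sum>p\<le>\<mu>. \<Sum>q\<le>\<mu>. c p q * (of_real (real \<tau> + 1) * Bber \<tau> (zonal_inv \<tau> \<mu> (x p) (x q) \<mu>) z))"
      by (simp only: sum_distrib_left mult.left_commute)
    then show ?thesis unfolding f by (simp only: Bber_zonal_inv[OF that le_refl])
  qed
  moreover have "uniform_limit UNIV h f sequentially"
    unfolding f h_def[abs_def]
  proof (intro uniform_limit_sum_fun)
    fix p q
    obtain C where C: "\<And>z. cmod (zonal \<mu> (x p) (x q) \<mu> z) \<le> C"
      using ImR_bdd_borel[OF zonal_in_ImR[of \<mu> \<mu> "x p" "x q"]] unfolding bdd_borel_def by blast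
    show "uniform_limit UNIV (\<lambda>n z. c p q * zonal_inv n \<mu> (x p) (x q) \<mu> z) (\<lambda>z. c p q * zonal \<mu> (x p) (x q) \<mu> z) sequentially"
      by (rule uniform_lim_mult) (use C in \<open>auto simp: bounded_iff intro!: uniform_limit_const zonal_inv_tendsto\<close>)
  qed
  ultimately show ?thesis using that by blast
qed

text \<open>The density of \<open>iota 0\<close> is everywhere positive, so its null sets are
  Lebesgue null, whereas a nonempty open set is not negligible.\<close>

lemma continuous_AE_iota_zero:
  fixes h :: "complex \<Rightarrow> complex"
  assumes "continuous_on UNIV h" "AE z in iota 0. h z = 0"
  shows "h z = 0"
proof (rule ccontr)
  assume "h z \<noteq> 0"
  define S where "S = {z. h z \<noteq> 0}"
  have hm[measurable]: "h \<in> borel_measurable borel" using assms(1) by (rule borel_measurable_continuous_onI)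
  have "open (h -` (- {0}))" using assms(1) by (intro open_vimage) auto
  moreover have "h -` (- {0}) = S" by (auto simp: S_def)
  ultimately have "open S" by simp
  moreover have "S \<noteq> {}" using \<open>h z \<noteq> 0\<close> by (auto simp: S_def)
  ultimately have "\<not> negligible S" using open_not_negligible by blast
  have "AE z in lborel. h z = 0"
    using assms(2) unfolding iota_def
    by (subst (asm) AE_density) auto
  then have "S \<in> null_sets lborel"
    by (subst (asm) AE_iff_null) (auto simp: S_def)
  then have "S \<in> null_sets lebesgue" by (rule null_sets_completionI)
  then show False using \<open>\<not> negligible S\<close> by (simp add: negligible_iff_null_sets)
qed

text \<open>Self-adjointness turns the surjectivity of \<open>Bber \<tau>\<close> on \<open>ImR \<mu>\<close> into injectivity.\<close>

lemma Bber_injective: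
  assumes h: "h \<in> ImR \<mu>" and "\<mu> \<le> \<tau>" and zero: "\<And>z. Bber \<tau> h z = 0"
  shows "h z = 0"
proof -
  \<comment> \<open>Choosing a preimage of \<open>cnj h\<close> writes the integral of
    \<open>|h|^2\<close> as a multiple of that of \<open>h * Bber \<tau> (g \<tau>)\<close>; moving
    the transform onto \<open>h\<close> makes it 0.\<close>
  obtain g where g: "g \<tau> \<in> ImR \<mu>" "\<And>z. of_real (real \<tau> + 1) * Bber \<tau> (g \<tau>) z = cnj (h z)"
    using ImR_inverse_family[OF ImR_cnj[OF h]] \<open>\<mu> \<le> \<tau>\<close> by metis
  have hb: "h \<in> bdd_borel" and gb: "g \<tau> \<in> bdd_borel" using h g by (auto intro: ImR_bdd_borel)
  have "complex_of_real (\<integral>z. (cmod (h z))\<^sup>2 \<partial>iota 0) = (\<integral>z. complex_of_real ((cmod (h z))\<^sup>2) \<partial>iota 0)"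
    by (rule integral_complex_of_real[symmetric])
  also have "\<dots> = (\<integral>z. of_real (real \<tau> + 1) * (h z * Bber \<tau> (g \<tau>) z) \<partial>iota 0)"
    by (intro Bochner_Integration.integral_cong refl)
       (simp only: complex_norm_square g(2)[symmetric] mult.left_commute)
  also have "\<dots> = of_real (real \<tau> + 1) * (\<integral>z. Bber \<tau> h z * g \<tau> z \<partial>iota 0)"
    unfolding Bber_selfadjoint[OF hb gb] by (rule integral_mult_right_zero)
  also have "\<dots> = 0" by (simp add: zero)
  finally have "(\<integral>z. (cmod (h z))\<^sup>2 \<partial>iota 0) = 0" by simp
  moreover have "integrable (iota 0) (\<lambda>z. (cmod (h z))\<^sup>2)"
  proof -
    have "integrable (iota 0) (\<lambda>z. complex_of_real ((cmod (h z))\<^sup>2))"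
      unfolding complex_norm_square by (intro bdd_borel_integrable bdd_borel_mult hb ImR_bdd_borel[OF ImR_cnj[OF h]])
    then show ?thesis by (simp only: complex_of_real_integrable_eq)
  qed
  ultimately have "AE z in iota 0. (cmod (h z))\<^sup>2 = 0"
    by (subst (asm) integral_nonneg_eq_0_iff_AE) auto
  then have "AE z in iota 0. h z = 0" by simp
  then show ?thesis using continuous_AE_iota_zero ImR_continuous[OF h] by blast
qed

text \<open>Makes the definite description usable: any explicit preimage in \<open>ImR \<mu>\<close>
  is the value, because the difference of two preimages is annihilated by the transform.\<close>

lemma invB_eq:
  assumes h: "h \<in> ImR \<mu>" and "\<mu> \<le> \<tau>" and eq: "\<And>z. of_real (real \<tau> + 1) * Bber \<tau> h z = g z"
  shows "invB (real \<tau> + 1) \<tau> \<mu> g = h"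
  unfolding invB_def
proof (rule the_equality)
  show "h \<in> ImR \<mu> \<and> (\<lambda>z. of_real (real \<tau> + 1) * Bber \<tau> h z) = g" using h eq by auto
  fix h' assume h': "h' \<in> ImR \<mu> \<and> (\<lambda>z. of_real (real \<tau> + 1) * Bber \<tau> h' z) = g"
  define d where "d = (\<lambda>z. h' z + (-1) * h z)"
  have d: "d \<in> ImR \<mu>" unfolding d_def using h h' by (intro ImR_add ImR_cmult) auto
  have "Bber \<tau> d z = 0" for z
  proof -
    have "Bber \<tau> d z = Bber \<tau> h' z + (-1) * Bber \<tau> h z"
      unfolding d_def Bber_cmult[symmetric]
      using h h' by (intro Bber_add ImR_bdd_borel[of _ \<mu>] ImR_cmult) auto
    moreover have "of_real (real \<tau> + 1) * Bber \<tau> h' z = of_real (real \<tau> + 1) * Bber \<tau> h z"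
      using h' eq by metis
    moreover have "complex_of_real (real \<tau> + 1) \<noteq> 0" unfolding of_real_eq_0_iff by simp
    ultimately show ?thesis by simp
  qed
  then have "d z = 0" for z using Bber_injective[OF d \<open>\<mu> \<le> \<tau>\<close>] by blast
  then show "h' = h" unfolding d_def by (intro ext) simp
qed

lemma invB_tendsto:
  assumes f: "f \<in> ImR \<mu>"
  shows "uniform_limit UNIV (\<lambda>\<tau>. invB (real \<tau> + 1) \<tau> \<mu> f) f sequentially"
proof -
  obtain h where h: "\<And>\<tau>. \<mu> \<le> \<tau> \<Longrightarrow> h \<tau> \<in> ImR \<mu>"
    "\<And>\<tau> z. \<mu> \<le> \<tau> \<Longrightarrow> of_real (real \<tau> + 1) * Bber \<tau> (h \<tau>) z = f z"
    "uniform_limit UNIV h f sequentially"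
    using ImR_inverse_family[OF f] by blast
  \<comment> \<open>The preimages are available only for \<open>\<tau> \<ge> \<mu>\<close>, so
    \<open>invB\<close> is identified from \<open>\<mu>\<close> on, which determines the
    limit.\<close>
  have "eventually (\<lambda>\<tau>. \<forall>z\<in>UNIV. h \<tau> z = invB (real \<tau> + 1) \<tau> \<mu> f z) sequentially"
    using eventually_ge_at_top[of \<mu>]
    by eventually_elim (subst invB_eq[OF h(1) _ h(2)], auto)
  from uniform_limit_cong[OF this, of f f] h(3) show ?thesis by simp
qed

lemma invB_in_ImR_and_eq:
  assumes f: "f \<in> ImR \<mu>" and "\<mu> \<le> \<tau>"
  shows "invB (real \<tau> + 1) \<tau> \<mu> f \<in> ImR \<mu>" "of_real (real \<tau> + 1) * Bber \<tau> (invB (real \<tau> + 1) \<tau> \<mu> f) z = f z"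
proof -
  obtain h where h: "h \<tau> \<in> ImR \<mu>" "\<And>z. of_real (real \<tau> + 1) * Bber \<tau> (h \<tau>) z = f z"
    using ImR_inverse_family[OF f] \<open>\<mu> \<le> \<tau>\<close> by metis
  have "invB (real \<tau> + 1) \<tau> \<mu> f = h \<tau>"
    by (rule invB_eq[OF h(1) \<open>\<mu> \<le> \<tau>\<close> h(2)])
  then show "invB (real \<tau> + 1) \<tau> \<mu> f \<in> ImR \<mu>" "of_real (real \<tau> + 1) * Bber \<tau> (invB (real \<tau> + 1) \<tau> \<mu> f) z = f z"
    using h by auto
qed

text \<open>Linearity is recovered from uniqueness. It is needed because
  \<open>Enu \<mu> \<nu> k f\<close> varies with \<open>\<nu>\<close>, while
  \<open>invB_tendsto\<close> concerns a fixed argument; linearity confines the variation to scalar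
  coefficients.\<close>

lemma invB_lincomb:
  assumes f: "\<And>j. j \<in> S \<Longrightarrow> f j \<in> ImR \<mu>" and "\<mu> \<le> \<tau>"
  shows "invB (real \<tau> + 1) \<tau> \<mu> (\<lambda>z. \<Sum>j\<in>S. c j * f j z) = (\<lambda>z. \<Sum>j\<in>S. c j * invB (real \<tau> + 1) \<tau> \<mu> (f j) z)"
proof (rule invB_eq)
  note inv = invB_in_ImR_and_eq[OF f \<open>\<mu> \<le> \<tau>\<close>]
  show "(\<lambda>z. \<Sum>j\<in>S. c j * invB (real \<tau> + 1) \<tau> \<mu> (f j) z) \<in> ImR \<mu>"
    by (intro ImR_sum ImR_cmult inv)
  fix z
  have "Bber \<tau> (\<lambda>z. \<Sum>j\<in>S. c j * invB (real \<tau> + 1) \<tau> \<mu> (f j) z) z = (\<Sum>j\<in>S. c j * Bber \<tau> (invB (real \<tau> + 1) \<tau> \<mu> (f j)) z)"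
    by (subst Bber_sum) (auto simp only: Bber_cmult intro!: ImR_bdd_borel[of _ \<mu>] ImR_cmult inv)
  then have "of_real (real \<tau> + 1) * Bber \<tau> (\<lambda>z. \<Sum>j\<in>S. c j * invB (real \<tau> + 1) \<tau> \<mu> (f j) z) z =
     (\<Sum>j\<in>S. c j * (of_real (real \<tau> + 1) * Bber \<tau> (invB (real \<tau> + 1) \<tau> \<mu> (f j)) z))"
    by (simp only: sum_distrib_left mult.left_commute)
  also have "\<dots> = (\<Sum>j\<in>S. c j * f j z)" by (intro sum.cong refl) (simp only: inv)
  finally show "of_real (real \<tau> + 1) * Bber \<tau> (\<lambda>z. \<Sum>j\<in>S. c j * invB (real \<tau> + 1) \<tau> \<mu> (f j) z) z = (\<Sum>j\<in>S. c j * f j z)" .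
qed fact

section \<open>The tensor product and the adjoint of Pk\<close>

lemma integrable_iota_pair_bounded:
  fixes F :: "complex \<times> complex \<Rightarrow> complex"
  assumes F[measurable]: "F \<in> borel_measurable (borel \<Otimes>\<^sub>M borel)"
    and bd: "\<And>z w. cmod (F (z, w)) \<le> C * ((1 + (cmod z)\<^sup>2) ^ \<mu> * (1 + (cmod w)\<^sup>2) ^ \<nu>)"
  shows "integrable (iota \<mu> \<Otimes>\<^sub>M iota \<nu>) F"
proof -
  interpret pair_sigma_finite "iota \<mu>" "iota \<nu>" by simp
  have int: "integrable (iota N) (\<lambda>z. (1 + (cmod z)\<^sup>2) ^ N)" for N
  proof -
    have "integrable (iota N) (\<lambda>z. complex_of_real ((1 + (cmod z)\<^sup>2) ^ N))"
    proof (rule integrable_iota_bounded)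
      show "cmod (complex_of_real ((1 + (cmod z)\<^sup>2) ^ N)) \<le> 1 * (1 + (cmod z)\<^sup>2) ^ N" for z
        unfolding norm_of_real by simp
    qed measurable
    then show ?thesis by (simp only: complex_of_real_integrable_eq)
  qed
  have "integrable (iota \<mu> \<Otimes>\<^sub>M iota \<nu>) (\<lambda>p. (1 + (cmod (fst p))\<^sup>2) ^ \<mu> * (1 + (cmod (snd p))\<^sup>2) ^ \<nu>)"
    by (rule Fubini_integrable) (auto simp: int abs_mult)
  then have "integrable (iota \<mu> \<Otimes>\<^sub>M iota \<nu>) (\<lambda>p. C * ((1 + (cmod (fst p))\<^sup>2) ^ \<mu> * (1 + (cmod (snd p))\<^sup>2) ^ \<nu>))"
    by simp
  then show ?thesis
  proof (rule Bochner_Integration.integrable_bound)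
    show "AE p in iota \<mu> \<Otimes>\<^sub>M iota \<nu>. cmod (F p) \<le> norm (C * ((1 + (cmod (fst p))\<^sup>2) ^ \<mu> * (1 + (cmod (snd p))\<^sup>2) ^ \<nu>))"
      using bd by (intro AE_I2) (auto intro: order_trans[OF _ abs_ge_self])
  qed measurable
qed

lemma Tsp_bound:
  assumes "F \<in> Tsp \<mu> \<nu>"
  shows "\<exists>C. \<forall>z w. cmod (F z w) \<le> C * (sqrt (1 + (cmod z)\<^sup>2) ^ \<mu> * sqrt (1 + (cmod w)\<^sup>2) ^ \<nu>)"
proof -
  obtain c where F: "F = (\<lambda>z w. \<Sum>i\<le>\<mu>. \<Sum>j\<le>\<nu>. c i j * (z ^ i * w ^ j))"
    using assms unfolding Tsp_eq by blast
  have "cmod (F z w) \<le> (\<Sum>i\<le>\<mu>. \<Sum>j\<le>\<nu>. cmod (c i j)) * (sqrt (1 + (cmod z)\<^sup>2) ^ \<mu> * sqrt (1 + (cmod w)\<^sup>2) ^ \<nu>)" for z w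
    unfolding F sum_distrib_right
  proof (intro order.trans[OF norm_sum] sum_mono)
    fix i j assume ij: "i \<in> {..\<mu>}" "j \<in> {..\<nu>}"
    have "cmod (z ^ i * w ^ j) = cmod z ^ i * cmod w ^ j" by (simp add: norm_mult norm_power)
    also have "\<dots> \<le> sqrt (1 + (cmod z)\<^sup>2) ^ \<mu> * sqrt (1 + (cmod w)\<^sup>2) ^ \<nu>"
      using ij by (intro mult_mono norm_power_le_one_plus) auto
    finally show "cmod (c i j * (z ^ i * w ^ j)) \<le> cmod (c i j) * (sqrt (1 + (cmod z)\<^sup>2) ^ \<mu> * sqrt (1 + (cmod w)\<^sup>2) ^ \<nu>)"
      unfolding norm_mult[of "c i j"] by (intro mult_left_mono) auto
  qed
  then show ?thesis by blast
qed

lemma Tsp_measurable: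
  assumes "F \<in> Tsp \<mu> \<nu>"
  shows "(\<lambda>p. F (fst p) (snd p)) \<in> borel_measurable (borel \<Otimes>\<^sub>M borel)"
proof -
  obtain c where F: "F = (\<lambda>z w. \<Sum>i\<le>\<mu>. \<Sum>j\<le>\<nu>. c i j * (z ^ i * w ^ j))"
    using assms unfolding Tsp_eq by blast
  show ?thesis unfolding F by measurable
qed

text \<open>Each polynomial takes up the square root of the weight in either variable, and
  \<open>f\<close> contributes only a constant.\<close>

lemma integrable_Tsp:
  assumes F: "F \<in> Tsp \<mu> \<nu>" and G: "G \<in> Tsp \<mu> \<nu>" and f: "f \<in> bdd_borel"
  shows "integrable (iota \<mu> \<Otimes>\<^sub>M iota \<nu>) (\<lambda>p. f (fst p) * (F (fst p) (snd p) * cnj (G (fst p) (snd p))))"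
proof -
  obtain C where C: "\<And>z w. cmod (F z w) \<le> C * (sqrt (1 + (cmod z)\<^sup>2) ^ \<mu> * sqrt (1 + (cmod w)\<^sup>2) ^ \<nu>)"
    using Tsp_bound[OF F] by blast
  obtain D where D: "\<And>z w. cmod (G z w) \<le> D * (sqrt (1 + (cmod z)\<^sup>2) ^ \<mu> * sqrt (1 + (cmod w)\<^sup>2) ^ \<nu>)"
    using Tsp_bound[OF G] by blast
  obtain B where B: "\<And>z. cmod (f z) \<le> B" using f unfolding bdd_borel_def by blast
  have [measurable]: "f \<in> borel_measurable borel" using f by (simp add: bdd_borel_def)
  note [measurable] = Tsp_measurable[OF F] Tsp_measurable[OF G]
  show ?thesis
  proof (rule integrable_iota_pair_bounded)
    show "(\<lambda>p. f (fst p) * (F (fst p) (snd p) * cnj (G (fst p) (snd p)))) \<in> borel_measurable (borel \<Otimes>\<^sub>M borel)"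
      by measurable
    fix z w
    let ?s = "sqrt (1 + (cmod z)\<^sup>2) ^ \<mu> * sqrt (1 + (cmod w)\<^sup>2) ^ \<nu>"
    have "cmod (f z * (F z w * cnj (G z w))) \<le> B * ((C * ?s) * (D * ?s))"
      unfolding norm_mult complex_mod_cnj
      using B[of z] C[of z w] D[of z w] order_trans[OF norm_ge_zero B[of z]] order_trans[OF norm_ge_zero C[of z w]]
      by (intro mult_mono) auto
    also have "\<dots> = B * C * D * ((1 + (cmod z)\<^sup>2) ^ \<mu> * (1 + (cmod w)\<^sup>2) ^ \<nu>)"
      unfolding sqrt_power_mult_self[symmetric] by (simp add: mult_ac)
    finally show "cmod (f (fst (z, w)) * (F (fst (z, w)) (snd (z, w)) * cnj (G (fst (z, w)) (snd (z, w)))))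
       \<le> B * C * D * ((1 + (cmod z)\<^sup>2) ^ \<mu> * (1 + (cmod w)\<^sup>2) ^ \<nu>)" by simp
  qed
qed

lemma one_bdd_borel: "(\<lambda>z. 1) \<in> bdd_borel"
  unfolding bdd_borel_def by (auto intro!: exI[of _ 1])

lemma integrable_tinner:
  assumes "F \<in> Tsp \<mu> \<nu>" "G \<in> Tsp \<mu> \<nu>"
  shows "integrable (iota \<mu> \<Otimes>\<^sub>M iota \<nu>) (\<lambda>p. F (fst p) (snd p) * cnj (G (fst p) (snd p)))"
  using integrable_Tsp[OF assms one_bdd_borel] by simp

lemma Tsp_section:
  assumes "F \<in> Tsp \<mu> \<nu>"
  shows "(\<lambda>z. F z w) \<in> Hsp \<mu>" "F z \<in> Hsp \<nu>"
proof -
  obtain c where F: "F = (\<lambda>z w. \<Sum>i\<le>\<mu>. \<Sum>j\<le>\<nu>. c i j * z ^ i * w ^ j)"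
    using assms unfolding Tsp_def by blast
  have "(\<lambda>z. F z w) = (\<lambda>z. \<Sum>i\<le>\<mu>. (\<Sum>j\<le>\<nu>. c i j * w ^ j) * z ^ i)"
    unfolding F sum_distrib_right by (simp add: mult_ac)
  then show "(\<lambda>z. F z w) \<in> Hsp \<mu>" unfolding Hsp_def by (intro CollectI exI)
  have "F z = (\<lambda>w. \<Sum>j\<le>\<nu>. (\<Sum>i\<le>\<mu>. c i j * z ^ i) * w ^ j)"
    unfolding F sum_distrib_right by (rule ext, rule sum.swap)
  then show "F z \<in> Hsp \<nu>" unfolding Hsp_def by (intro CollectI exI)
qed

lemma Hsp_reproducing:
  assumes "p \<in> Hsp N"
  shows "(\<integral>w. p w * (1 + x * cnj w) ^ N \<partial>iota N) = p x"
  using assms poly_reproducing[of N _ x] unfolding Hsp_def by auto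

text \<open>The reproducing kernel of the tensor product at \<open>(x, y)\<close>; pairing with it
  recovers point values, hence the uniqueness that \<open>Pkadj\<close> requires.\<close>

definition Ktensor :: "nat \<Rightarrow> nat \<Rightarrow> complex \<Rightarrow> complex \<Rightarrow> complex \<Rightarrow> complex \<Rightarrow> complex" where
  "Ktensor \<mu> \<nu> x y z w = (1 + cnj x * z) ^ \<mu> * (1 + cnj y * w) ^ \<nu>"

lemma Ktensor_in_Tsp: "Ktensor \<mu> \<nu> x y \<in> Tsp \<mu> \<nu>"
  using Tsp_mult[OF Tsp_linear_power(1)[of "cnj x" \<mu>] Tsp_linear_power(2)[of "cnj y" \<nu>]]
  unfolding Ktensor_def[abs_def] by simp

lemma tinner_Ktensor:
  assumes F: "F \<in> Tsp \<mu> \<nu>"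
  shows "tinner \<mu> \<nu> (Ktensor \<mu> \<nu> x y) F = cnj (F x y)"
proof -
  interpret pair_sigma_finite "iota \<mu>" "iota \<nu>" by simp
  have "cnj (tinner \<mu> \<nu> (Ktensor \<mu> \<nu> x y) F) = (\<integral>p. F (fst p) (snd p) * cnj (Ktensor \<mu> \<nu> x y (fst p) (snd p)) \<partial>(iota \<mu> \<Otimes>\<^sub>M iota \<nu>))"
    unfolding tinner_def by (subst Bochner_Integration.integral_cnj[symmetric]) (simp add: mult.commute)
  also have "\<dots> = (\<integral>z. (\<integral>w. F z w * cnj (Ktensor \<mu> \<nu> x y z w) \<partial>iota \<nu>) \<partial>iota \<mu>)"
    using integral_fst'[OF integrable_tinner[OF F Ktensor_in_Tsp]] by simp
  also have "\<dots> = (\<integral>z. F z y * (1 + x * cnj z) ^ \<mu> \<partial>iota \<mu>)"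
  proof (intro Bochner_Integration.integral_cong refl)
    fix z
    have "(\<integral>w. F z w * cnj (Ktensor \<mu> \<nu> x y z w) \<partial>iota \<nu>) = (\<integral>w. (1 + x * cnj z) ^ \<mu> * (F z w * (1 + y * cnj w) ^ \<nu>) \<partial>iota \<nu>)"
      unfolding Ktensor_def by (simp add: mult_ac)
    also have "\<dots> = (1 + x * cnj z) ^ \<mu> * F z y"
      by (simp add: Hsp_reproducing[OF Tsp_section(2)[OF F]])
    finally show "(\<integral>w. F z w * cnj (Ktensor \<mu> \<nu> x y z w) \<partial>iota \<nu>) = F z y * (1 + x * cnj z) ^ \<mu>"
      by (simp add: mult.commute)
  qed
  also have "\<dots> = F x y" by (rule Hsp_reproducing[OF Tsp_section(1)[OF F]])
  finally show ?thesis by (metis complex_cnj_cnj)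
qed

text \<open>The conjugate of the integral kernel of \<open>Jk\<close> at \<open>\<xi>\<close>, so
  that evaluation of \<open>Jk\<close> at \<open>\<xi>\<close> is an inner product with it.\<close>

definition Fxi :: "nat \<Rightarrow> nat \<Rightarrow> nat \<Rightarrow> complex \<Rightarrow> complex \<Rightarrow> complex \<Rightarrow> complex" where
  "Fxi \<mu> \<nu> k \<xi> z w = (z - w) ^ k * (1 + cnj \<xi> * z) ^ (\<mu> - k) * (1 + cnj \<xi> * w) ^ (\<nu> - k)"

lemma Fxi_in_Tsp: "k \<le> \<mu> \<Longrightarrow> k \<le> \<nu> \<Longrightarrow> Fxi \<mu> \<nu> k \<xi> \<in> Tsp \<mu> \<nu>"
  using Tsp_mult[OF Tsp_mult[OF Tsp_linear_power(3)[of k] Tsp_linear_power(1)[of "cnj \<xi>" "\<mu> - k"]] Tsp_linear_power(2)[of "cnj \<xi>" "\<nu> - k"]]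
  unfolding Fxi_def[abs_def] by simp

lemma Jk_eq_tinner: "Jk \<mu> \<nu> k G \<xi> = tinner \<mu> \<nu> G (Fxi \<mu> \<nu> k \<xi>)"
  unfolding Jk_def tinner_def Fxi_def by (simp add: mult.assoc)

lemma Hsp_sum: "(\<And>x. x \<in> S \<Longrightarrow> f x \<in> Hsp N) \<Longrightarrow> (\<lambda>z. \<Sum>x\<in>S. f x z) \<in> Hsp N"
proof (induction S rule: infinite_finite_induct)
  case (insert x F)
  then show ?case using Hsp_lincomb[of "f x" N "\<lambda>z. \<Sum>x\<in>F. f x z" 1] by simp
qed (simp_all add: Hsp_zero)

lemma Hsp_cmult: "f \<in> Hsp N \<Longrightarrow> (\<lambda>z. c * f z) \<in> Hsp N"
  using Hsp_lincomb[OF _ Hsp_zero, of f N c] by simp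

text \<open>Expanding the two powers in \<open>\<xi>\<close> leaves degree
  \<open>(\<mu> - k) + (\<nu> - k)\<close>. The membership licenses the reproducing property for
  \<open>Pk \<mu> \<nu> k G\<close>.\<close>

lemma Jk_in_Hsp:
  assumes G: "G \<in> Tsp \<mu> \<nu>" and k: "k \<le> \<mu>" "k \<le> \<nu>"
  shows "Jk \<mu> \<nu> k G \<in> Hsp (\<mu> + \<nu> - 2 * k)"
proof -
  define a b where "a = \<mu> - k" and "b = \<nu> - k"
  define \<Phi> where "\<Phi> i j = (\<lambda>z w. (z - w) ^ k * (1 * (z ^ i * w ^ j)) :: complex)" for i j
  have \<Phi>: "\<Phi> i j \<in> Tsp \<mu> \<nu>" if "i \<le> a" "j \<le> b" for i j
    using Tsp_mult[OF Tsp_linear_power(3)[of k] Tsp_monomial[OF that, of 1]] k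
    unfolding \<Phi>_def a_def b_def by simp
  have "Jk \<mu> \<nu> k G \<xi> = (\<Sum>i\<le>a. \<Sum>j\<le>b. (of_nat (a choose i) * of_nat (b choose j) * tinner \<mu> \<nu> G (\<Phi> i j)) * \<xi> ^ (i + j))" for \<xi>
  proof -
    have "cnj (Fxi \<mu> \<nu> k \<xi> z w) = (\<Sum>i\<le>a. \<Sum>j\<le>b. (of_nat (a choose i) * of_nat (b choose j) * \<xi> ^ (i + j)) * cnj (\<Phi> i j z w))" for z w
      unfolding Fxi_def \<Phi>_def a_def[symmetric] b_def[symmetric] linear_form_power
      by (simp add: sum_product sum_distrib_left power_add power_mult_distrib mult_ac)
    then have "Jk \<mu> \<nu> k G \<xi> = (\<integral>p. (\<Sum>i\<le>a. \<Sum>j\<le>b. (of_nat (a choose i) * of_nat (b choose j) * \<xi> ^ (i + j)) *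
         (G (fst p) (snd p) * cnj (\<Phi> i j (fst p) (snd p)))) \<partial>(iota \<mu> \<Otimes>\<^sub>M iota \<nu>))"
      unfolding Jk_eq_tinner tinner_def by (simp only: sum_distrib_left mult.left_commute)
    also have "\<dots> = (\<Sum>i\<le>a. \<Sum>j\<le>b. (of_nat (a choose i) * of_nat (b choose j) * \<xi> ^ (i + j)) * tinner \<mu> \<nu> G (\<Phi> i j))"
      unfolding tinner_def integral_mult_right_zero[symmetric]
    proof -
      have int: "integrable (iota \<mu> \<Otimes>\<^sub>M iota \<nu>) (\<lambda>p. (of_nat (a choose i) * of_nat (b choose j) * \<xi> ^ (i + j)) *
         (G (fst p) (snd p) * cnj (\<Phi> i j (fst p) (snd p))))" if "i \<le> a" "j \<le> b" for i j
        using that by (intro integrable_mult_right integrable_tinner G \<Phi>)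
      show "(\<integral>p. (\<Sum>i\<le>a. \<Sum>j\<le>b. (of_nat (a choose i) * of_nat (b choose j) * \<xi> ^ (i + j)) *
         (G (fst p) (snd p) * cnj (\<Phi> i j (fst p) (snd p)))) \<partial>(iota \<mu> \<Otimes>\<^sub>M iota \<nu>)) =
        (\<Sum>i\<le>a. \<Sum>j\<le>b. \<integral>p. (of_nat (a choose i) * of_nat (b choose j) * \<xi> ^ (i + j)) *
         (G (fst p) (snd p) * cnj (\<Phi> i j (fst p) (snd p))) \<partial>(iota \<mu> \<Otimes>\<^sub>M iota \<nu>))"
        using int by (subst Bochner_Integration.integral_sum)
          (auto intro!: Bochner_Integration.integrable_sum sum.cong Bochner_Integration.integral_sum simp del: integral_mult_right_zero)
    qed
    finally show ?thesis by (simp add: mult_ac)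
  qed
  then have "Jk \<mu> \<nu> k G = (\<lambda>\<xi>. \<Sum>i\<le>a. \<Sum>j\<le>b. (of_nat (a choose i) * of_nat (b choose j) * tinner \<mu> \<nu> G (\<Phi> i j)) * \<xi> ^ (i + j))"
    by (rule ext)
  also have "\<dots> \<in> Hsp (\<mu> + \<nu> - 2 * k)"
    by (intro Hsp_sum Hsp_cmult monomial_in_Hsp) (use k in \<open>auto simp: a_def b_def\<close>)
  finally show ?thesis .
qed

text \<open>Pairing with the kernel at \<open>\<xi>\<close> evaluates
  \<open>Pk \<mu> \<nu> k G\<close> there, which is already an inner product with
  \<open>Fxi\<close>; \<open>Cconst\<close> passes through the conjugation because it is real.
  Kernels suffice as arguments, since \<open>opker\<close> applies an operator to nothing
  else.\<close>

lemma Pkadj_Kker: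
  assumes k: "k \<le> \<mu>" "k \<le> \<nu>"
  defines "M \<equiv> \<mu> + \<nu> - 2 * k"
  shows "Pkadj \<mu> \<nu> k (\<lambda>x. Kker M x \<xi>) = (\<lambda>z w. of_real (Cconst \<mu> \<nu> k) * Fxi \<mu> \<nu> k \<xi> z w)" (is "_ = ?F")
  unfolding Pkadj_def M_def[symmetric]
proof (rule the_equality)
  have F: "?F \<in> Tsp \<mu> \<nu>" by (intro Tsp_cmult Fxi_in_Tsp k)
  have eq: "hinner M (Pk \<mu> \<nu> k G) (\<lambda>x. Kker M x \<xi>) = tinner \<mu> \<nu> G ?F" if G: "G \<in> Tsp \<mu> \<nu>" for G
  proof -
    have "Pk \<mu> \<nu> k G \<in> Hsp M"
      unfolding Pk_def M_def by (intro Hsp_cmult Jk_in_Hsp G k)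
    then have "hinner M (Pk \<mu> \<nu> k G) (\<lambda>x. Kker M x \<xi>) = Pk \<mu> \<nu> k G \<xi>"
      unfolding hinner_def Kker_def using Hsp_reproducing[of "Pk \<mu> \<nu> k G" M \<xi>] by (simp add: mult.commute)
    also have "\<dots> = of_real (Cconst \<mu> \<nu> k) * tinner \<mu> \<nu> G (Fxi \<mu> \<nu> k \<xi>)"
      by (simp add: Pk_def Jk_eq_tinner)
    also have "\<dots> = tinner \<mu> \<nu> G ?F"
      unfolding tinner_def integral_mult_right_zero[symmetric] by (simp add: mult_ac)
    finally show ?thesis .
  qed
  show "?F \<in> Tsp \<mu> \<nu> \<and> (\<forall>G\<in>Tsp \<mu> \<nu>. hinner M (Pk \<mu> \<nu> k G) (\<lambda>x. Kker M x \<xi>) = tinner \<mu> \<nu> G ?F)"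
    using F eq by blast
  fix F' assume F': "F' \<in> Tsp \<mu> \<nu> \<and> (\<forall>G\<in>Tsp \<mu> \<nu>. hinner M (Pk \<mu> \<nu> k G) (\<lambda>x. Kker M x \<xi>) = tinner \<mu> \<nu> G F')"
  have "F' x y = ?F x y" for x y
  proof -
    have "cnj (F' x y) = tinner \<mu> \<nu> (Ktensor \<mu> \<nu> x y) F'"
      using F' by (simp add: tinner_Ktensor)
    also have "\<dots> = tinner \<mu> \<nu> (Ktensor \<mu> \<nu> x y) ?F"
      using F' eq[OF Ktensor_in_Tsp] Ktensor_in_Tsp by metis
    also have "\<dots> = cnj (?F x y)" by (rule tinner_Ktensor[OF F])
    finally show ?thesis by (metis complex_cnj_cnj)
  qed
  then show "F' = ?F" by (intro ext)
qed

section \<open>Weak form of \<open>Rstar\<close> on one factor and on the tensor product\<close>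

lemma Rstar_poly:
  assumes f: "f \<in> bdd_borel" and h: "h \<in> Hsp \<mu>"
  shows "Rstar \<mu> f h x = (\<Sum>l\<le>\<mu>. (of_nat (\<mu> choose l) * (\<integral>s. f s * h s * cnj s ^ l \<partial>iota \<mu>) / of_nat (\<mu> + 1)) * x ^ l)"
    and "l \<le> \<mu> \<Longrightarrow> integrable (iota \<mu>) (\<lambda>s. f s * h s * cnj s ^ l)"
proof -
  obtain a where a: "h = (\<lambda>z. \<Sum>i\<le>\<mu>. a i * z ^ i)" using h unfolding Hsp_def by blast
  have [measurable]: "f \<in> borel_measurable borel" using f by (simp add: bdd_borel_def)
  obtain B where B: "\<And>z. cmod (f z) \<le> B" using f unfolding bdd_borel_def by blast
  show int: "integrable (iota \<mu>) (\<lambda>s. f s * h s * cnj s ^ l)" if l: "l \<le> \<mu>" for l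
  proof -
    have "(\<lambda>s. \<Sum>i\<le>\<mu>. a i * (s ^ i * cnj s ^ l)) \<in> bipoly \<mu> \<mu>"
      using l by (intro bipoly_sum bipoly_monomial) auto
    then have "(\<lambda>s. h s * cnj s ^ l) \<in> bipoly \<mu> \<mu>"
      by (simp add: a sum_distrib_right mult.assoc)
    then obtain C where C: "\<And>z. cmod (h z * cnj z ^ l) \<le> C * (1 + (cmod z)\<^sup>2) ^ \<mu>"
      using bipoly_bound by blast
    show ?thesis
    proof (rule integrable_iota_bounded[where C = "B * C"])
      show "(\<lambda>s. f s * h s * cnj s ^ l) \<in> borel_measurable borel" unfolding a by measurable
      fix z
      have "cmod (f z * h z * cnj z ^ l) = cmod (f z) * cmod (h z * cnj z ^ l)"
        by (simp add: norm_mult)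
      also have "\<dots> \<le> B * (C * (1 + (cmod z)\<^sup>2) ^ \<mu>)"
        using B[of z] C[of z] order_trans[OF norm_ge_zero B[of z]] by (intro mult_mono) auto
      finally show "cmod (f z * h z * cnj z ^ l) \<le> B * C * (1 + (cmod z)\<^sup>2) ^ \<mu>" by (simp add: mult.assoc)
    qed
  qed
  have "(\<integral>z. f z * h z * (1 + x * cnj z) ^ \<mu> \<partial>iota \<mu>) = (\<integral>z. (\<Sum>l\<le>\<mu>. of_nat (\<mu> choose l) * x ^ l * (f z * h z * cnj z ^ l)) \<partial>iota \<mu>)"
    unfolding linear_form_power by (simp add: sum_distrib_left mult_ac)
  also have "\<dots> = (\<Sum>l\<le>\<mu>. of_nat (\<mu> choose l) * x ^ l * (\<integral>z. f z * h z * cnj z ^ l \<partial>iota \<mu>))"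
    unfolding integral_mult_right_zero[symmetric]
    by (intro Bochner_Integration.integral_sum integrable_mult_right int) auto
  finally show "Rstar \<mu> f h x = (\<Sum>l\<le>\<mu>. (of_nat (\<mu> choose l) * (\<integral>s. f s * h s * cnj s ^ l \<partial>iota \<mu>) / of_nat (\<mu> + 1)) * x ^ l)"
    unfolding Rstar_def by (simp add: sum_divide_distrib mult_ac del: of_nat_Suc of_nat_add)
qed

text \<open>Up to the factor \<open>1 / (\<mu> + 1)\<close>, \<open>Rstar \<mu> f\<close> is a
  Toeplitz operator: multiplication by \<open>f\<close> followed by projection onto polynomials, and
  the projection disappears when tested against a polynomial.\<close>

lemma Rstar_weak:
  assumes f: "f \<in> bdd_borel" and h: "h \<in> Hsp \<mu>" and q: "q \<in> Hsp \<mu>"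
  shows "(\<integral>z. Rstar \<mu> f h z * cnj (q z) \<partial>iota \<mu>) = (\<integral>z. f z * (h z * cnj (q z)) \<partial>iota \<mu>) / of_nat (\<mu> + 1)"
proof -
  obtain b where b: "q = (\<lambda>z. \<Sum>i\<le>\<mu>. b i * z ^ i)" using q unfolding Hsp_def by blast
  have "(\<integral>z. Rstar \<mu> f h z * cnj (q z) \<partial>iota \<mu>) =
     (\<Sum>l\<le>\<mu>. (of_nat (\<mu> choose l) * (\<integral>s. f s * h s * cnj s ^ l \<partial>iota \<mu>) / of_nat (\<mu> + 1)) * cnj (b l) / of_nat (\<mu> choose l))"
    unfolding Rstar_poly(1)[OF f h] b by (rule integral_iota_poly_cnj_poly(2))
  also have "\<dots> = (\<Sum>l\<le>\<mu>. cnj (b l) * (\<integral>s. f s * h s * cnj s ^ l \<partial>iota \<mu>)) / of_nat (\<mu> + 1)"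
    unfolding sum_divide_distrib by (intro sum.cong refl) (simp del: of_nat_Suc of_nat_add)
  also have "(\<Sum>l\<le>\<mu>. cnj (b l) * (\<integral>s. f s * h s * cnj s ^ l \<partial>iota \<mu>)) = (\<integral>s. (\<Sum>l\<le>\<mu>. cnj (b l) * (f s * h s * cnj s ^ l)) \<partial>iota \<mu>)"
    unfolding integral_mult_right_zero[symmetric]
    by (intro Bochner_Integration.integral_sum[symmetric] integrable_mult_right Rstar_poly(2) f h) auto
  also have "\<dots> = (\<integral>z. f z * (h z * cnj (q z)) \<partial>iota \<mu>)"
    unfolding b by (simp add: sum_distrib_left mult_ac)
  finally show ?thesis .
qed

text \<open>The moments of \<open>f\<close> become coefficients, so neither degree is raised; this
  secures the integrability needed to split the pair integral.\<close>

lemma tensorI_Rstar_in_Tsp: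
  assumes f: "f \<in> bdd_borel" and F: "F \<in> Tsp \<mu> \<nu>"
  shows "tensorI (Rstar \<mu> f) F \<in> Tsp \<mu> \<nu>"
proof -
  obtain c where c: "F = (\<lambda>z w. \<Sum>i\<le>\<mu>. \<Sum>j\<le>\<nu>. c i j * (z ^ i * w ^ j))"
    using F unfolding Tsp_eq by blast
  define m where "m i l = (\<integral>s. f s * s ^ i * cnj s ^ l \<partial>iota \<mu>)" for i l
  have m: "(\<integral>s. f s * F s w * cnj s ^ l \<partial>iota \<mu>) = (\<Sum>i\<le>\<mu>. \<Sum>j\<le>\<nu>. c i j * w ^ j * m i l)" if "l \<le> \<mu>" for w l
  proof -
    have "(\<lambda>s. f s * F s w * cnj s ^ l) = (\<lambda>s. \<Sum>i\<le>\<mu>. (\<Sum>j\<le>\<nu>. c i j * w ^ j) * (f s * s ^ i * cnj s ^ l))"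
      by (simp add: c sum_distrib_left sum_distrib_right mult_ac)
    then have "(\<integral>s. f s * F s w * cnj s ^ l \<partial>iota \<mu>) = (\<Sum>i\<le>\<mu>. (\<Sum>j\<le>\<nu>. c i j * w ^ j) * m i l)"
      unfolding m_def integral_mult_right_zero[symmetric]
      by (simp only:) (intro Bochner_Integration.integral_sum integrable_mult_right Rstar_poly(2) f monomial_in_Hsp that, simp)
    then show ?thesis by (simp only: sum_distrib_right)
  qed
  have "tensorI (Rstar \<mu> f) F = (\<lambda>z w. \<Sum>l\<le>\<mu>. \<Sum>i\<le>\<mu>. \<Sum>j\<le>\<nu>. (of_nat (\<mu> choose l) / of_nat (\<mu> + 1) * c i j * m i l) * (z ^ l * w ^ j))"
    unfolding tensorI_def Rstar_poly(1)[OF f Tsp_section(1)[OF F]]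
  proof (intro ext sum.cong refl)
    fix z w l assume "l \<in> {..\<mu>}"
    then have l: "l \<le> \<mu>" by simp
    show "of_nat (\<mu> choose l) * (\<integral>s. f s * F s w * cnj s ^ l \<partial>iota \<mu>) / of_nat (\<mu> + 1) * z ^ l =
      (\<Sum>i\<le>\<mu>. \<Sum>j\<le>\<nu>. (of_nat (\<mu> choose l) / of_nat (\<mu> + 1) * c i j * m i l) * (z ^ l * w ^ j))"
      unfolding m[OF l] sum_distrib_left sum_distrib_right sum_divide_distrib
      by (simp add: mult_ac del: of_nat_Suc of_nat_add)
  qed
  also have "\<dots> \<in> Tsp \<mu> \<nu>" by (intro Tsp_sum Tsp_monomial) auto
  finally show ?thesis .
qed

text \<open>The weak form is used in the first variable with \<open>w\<close> frozen; Fubini then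
  moves \<open>f\<close> outside, leaving an integral over \<open>w\<close> that has a closed
  form.\<close>

lemma tinner_tensorI_Rstar:
  assumes f: "f \<in> bdd_borel" and F: "F \<in> Tsp \<mu> \<nu>" and G: "G \<in> Tsp \<mu> \<nu>"
  shows "tinner \<mu> \<nu> (tensorI (Rstar \<mu> f) F) G
    = (\<integral>z. f z * (\<integral>w. F z w * cnj (G z w) \<partial>iota \<nu>) \<partial>iota \<mu>) / of_nat (\<mu> + 1)"
proof -
  interpret pair_sigma_finite "iota \<mu>" "iota \<nu>" by simp
  have int: "integrable (iota \<mu> \<Otimes>\<^sub>M iota \<nu>) (\<lambda>(z, w). tensorI (Rstar \<mu> f) F z w * cnj (G z w))"
    using integrable_tinner[OF tensorI_Rstar_in_Tsp[OF f F] G] by (simp add: split_beta')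
  have int2: "integrable (iota \<mu> \<Otimes>\<^sub>M iota \<nu>) (\<lambda>(z, w). f z * (F z w * cnj (G z w)))"
    using integrable_Tsp[OF F G f] by (simp add: split_beta')
  have "tinner \<mu> \<nu> (tensorI (Rstar \<mu> f) F) G = (\<integral>w. (\<integral>z. tensorI (Rstar \<mu> f) F z w * cnj (G z w) \<partial>iota \<mu>) \<partial>iota \<nu>)"
    unfolding tinner_def integral_snd[OF int] by (simp add: split_beta')
  also have "\<dots> = (\<integral>w. (\<integral>z. f z * (F z w * cnj (G z w)) \<partial>iota \<mu>) / of_nat (\<mu> + 1) \<partial>iota \<nu>)"
    unfolding tensorI_def by (subst Rstar_weak[OF f Tsp_section(1)[OF F] Tsp_section(1)[OF G]]) (rule refl)
  also have "\<dots> = (\<integral>w. (\<integral>z. f z * (F z w * cnj (G z w)) \<partial>iota \<mu>) \<partial>iota \<nu>) / of_nat (\<mu> + 1)"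
    by (rule integral_divide_zero)
  also have "(\<integral>w. (\<integral>z. f z * (F z w * cnj (G z w)) \<partial>iota \<mu>) \<partial>iota \<nu>) = (\<integral>z. (\<integral>w. f z * (F z w * cnj (G z w)) \<partial>iota \<nu>) \<partial>iota \<mu>)"
    by (rule Fubini_integral[OF int2])
  finally show ?thesis by simp
qed

section \<open>Asymptotics of Enu\<close>

text \<open>Since \<open>(-n)_k = (-1)^k k! (n choose k)\<close>, the two signs cancel and the
  radicand is nonnegative. The remaining Pochhammer symbol runs from
  \<open>\<mu> + \<nu> - 2k + 2\<close> to \<open>\<mu> + \<nu> - k + 1\<close>, whence the last
  binomial.\<close>

lemma Cconst_squared:
  assumes "k \<le> \<mu>" "k \<le> \<nu>"
  shows "(Cconst \<mu> \<nu> k)\<^sup>2 = real (\<mu> choose k) * real (\<nu> choose k) / real ((\<mu> + \<nu> - k + 1) choose k)"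
proof -
  have p: "pochhammer (- real n) k = (-1) ^ k * fact k * real (n choose k)" for n
  proof -
    have e: "(-1) ^ k * (-1) ^ k = (1::real)" by (simp flip: power_mult_distrib)
    have "(-1) ^ k * fact k * ((-1) ^ k * pochhammer (- real n) k / fact k) = ((-1) ^ k * (-1) ^ k) * pochhammer (- real n) k"
      by simp
    then have "(-1) ^ k * fact k * ((-1) ^ k * pochhammer (- real n) k / fact k) = pochhammer (- real n) k"
      unfolding e by simp
    then show ?thesis by (simp only: binomial_gbinomial gbinomial_pochhammer)
  qed
  have "real ((\<mu> + \<nu> - k + 1) choose k) = pochhammer (real (\<mu> + \<nu> - k + 1) - real k + 1) k / fact k"
    by (simp only: binomial_gbinomial gbinomial_pochhammer')
  also have "real (\<mu> + \<nu> - k + 1) - real k + 1 = real (\<mu> + \<nu> - 2 * k) + 2"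
    using assms by (simp add: of_nat_diff)
  finally have q: "pochhammer (real (\<mu> + \<nu> - 2 * k) + 2) k = fact k * real ((\<mu> + \<nu> - k + 1) choose k)"
    by simp
  have "pochhammer (- real \<nu>) k * pochhammer (- real \<mu>) k / (fact k * pochhammer (real (\<mu> + \<nu> - 2 * k) + 2) k)
     = ((-1) ^ k * (-1) ^ k) * (real (\<mu> choose k) * real (\<nu> choose k) / real ((\<mu> + \<nu> - k + 1) choose k))"
    unfolding p q by (simp add: mult_ac)
  also have "(-1) ^ k * (-1) ^ k = (1::real)" by (simp flip: power_mult_distrib)
  finally show ?thesis unfolding Cconst_def by simp
qed

text \<open>In \<open>w\<close>, both factors are built from the same forms
  \<open>(1, cnj \<xi>)\<close> and \<open>(z, -1)\<close>, to the powers \<open>\<nu> - k\<close>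
  and \<open>k\<close>. Their squared norms are \<open>1 + |\<xi>|^2\<close> and
  \<open>1 + |z|^2\<close>, and the two mixed pairings multiply to \<open>|z - \<xi>|^2\<close>,
  which carries \<open>1 - t\<close>. The factor in \<open>z\<close> alone supplies
  \<open>t ^ (\<mu> - k)\<close>, and \<open>2 * k \<le> \<nu>\<close> keeps the exponents
  \<open>\<nu> - k - j\<close> untruncated.\<close>

lemma integral_norm_Fxi:
  fixes \<xi> z :: complex
  assumes k: "k \<le> \<mu>" "2 * k \<le> \<nu>"
  defines "t \<equiv> complex_of_real (sphker \<xi> z)"
  shows "(\<integral>w. Fxi \<mu> \<nu> k \<xi> z w * cnj (Fxi \<mu> \<nu> k \<xi> z w) \<partial>iota \<nu>) =
    of_real ((1 + (cmod \<xi>)\<^sup>2) ^ (\<mu> + \<nu> - 2 * k)) * of_real ((1 + (cmod z)\<^sup>2) ^ \<mu>) *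
    (\<Sum>j\<le>k. of_real (real (k choose j) * real ((\<nu> - k) choose j) / real (\<nu> choose k)) * (t ^ (\<mu> - k) * (1 - t) ^ j))"
proof -
  define X where "X = complex_of_real (1 + (cmod \<xi>)\<^sup>2)"
  define Y where "Y = complex_of_real (1 + (cmod z)\<^sup>2)"
  define n where "n = \<nu> - k"
  define E where "E = (1 + cnj \<xi> * z) * cnj (1 + cnj \<xi> * z)"
  have nk: "n + k = \<nu>" "k \<le> n" using k by (auto simp: n_def)
  have XY: "X \<noteq> 0" "Y \<noteq> 0" unfolding X_def Y_def of_real_eq_0_iff by simp_all
  have E: "E = t * (X * Y)"
    using XY unfolding t_def of_real_sphker E_def X_def[symmetric] Y_def[symmetric] by simp
  have D: "(cnj z - cnj \<xi>) * (z - \<xi>) = (1 - t) * (X * Y)"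
  proof -
    have "(cnj z - cnj \<xi>) * (z - \<xi>) = complex_of_real ((cmod (\<xi> - z))\<^sup>2)"
      unfolding complex_norm_square by (simp add: algebra_simps)
    also have "(cmod (\<xi> - z))\<^sup>2 = (1 - sphker \<xi> z) * ((1 + (cmod \<xi>)\<^sup>2) * (1 + (cmod z)\<^sup>2))"
      unfolding one_minus_sphker by simp
    finally show ?thesis unfolding t_def X_def Y_def by (simp only: of_real_mult of_real_diff of_real_1)
  qed
  have "(\<integral>w. Fxi \<mu> \<nu> k \<xi> z w * cnj (Fxi \<mu> \<nu> k \<xi> z w) \<partial>iota \<nu>) =
    (\<integral>w. E ^ (\<mu> - k) * ((1 + cnj \<xi> * w) ^ n * (z + (-1) * w) ^ k * cnj ((1 + cnj \<xi> * w) ^ n * (z + (-1) * w) ^ k)) \<partial>iota (n + k))"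
    unfolding Fxi_def E_def nk n_def[symmetric] by (simp add: power_mult_distrib mult_ac)
  also have "\<dots> = E ^ (\<mu> - k) * (\<integral>w. (1 + cnj \<xi> * w) ^ n * (z + (-1) * w) ^ k * cnj ((1 + cnj \<xi> * w) ^ n * (z + (-1) * w) ^ k) \<partial>iota (n + k))"
    by (rule integral_mult_right_zero)
  also have "(\<integral>w. (1 + cnj \<xi> * w) ^ n * (z + (-1) * w) ^ k * cnj ((1 + cnj \<xi> * w) ^ n * (z + (-1) * w) ^ k) \<partial>iota (n + k))
     = (\<Sum>j\<le>k. of_nat (k choose j) * of_nat (n choose j) * X ^ (n - j) * Y ^ (k - j) * ((1 - t) * (X * Y)) ^ j) / of_nat (\<nu> choose k)"
  proof -
    have "1 * cnj 1 + cnj \<xi> * cnj (cnj \<xi>) = X" unfolding X_def one_plus_norm_sq_complex by simp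
    moreover have "z * cnj z + (-1) * cnj (-1) = Y" unfolding Y_def one_plus_norm_sq_complex by (simp add: mult.commute)
    moreover have "(1 * cnj z + cnj \<xi> * cnj (-1)) * (z * cnj 1 + (-1) * cnj (cnj \<xi>)) = (1 - t) * (X * Y)"
      unfolding D[symmetric] by simp
    ultimately show ?thesis
      using integral_iota_linear_forms[where ?a0.0 = 1 and ?a1.0 = "cnj \<xi>" and ?b0.0 = z and ?b1.0 = "-1"
        and ?c0.0 = 1 and ?c1.0 = "cnj \<xi>" and ?d0.0 = z and ?d1.0 = "-1" and n = n and m = k] unfolding nk(1) by (simp only:)
  qed
  also have "\<dots> = (\<Sum>j\<le>k. X ^ n * Y ^ k * (of_real (real (k choose j) * real (n choose j) / real (\<nu> choose k)) * (1 - t) ^ j))"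
    unfolding sum_divide_distrib
  proof (intro sum.cong refl)
    fix j assume "j \<in> {..k}"
    then have "X ^ n = X ^ (n - j) * X ^ j" "Y ^ k = Y ^ (k - j) * Y ^ j"
      using nk by (simp_all flip: power_add)
    then show "of_nat (k choose j) * of_nat (n choose j) * X ^ (n - j) * Y ^ (k - j) * ((1 - t) * (X * Y)) ^ j / of_nat (\<nu> choose k)
       = X ^ n * Y ^ k * (of_real (real (k choose j) * real (n choose j) / real (\<nu> choose k)) * (1 - t) ^ j)"
      by (simp add: power_mult_distrib mult_ac)
  qed
  also have "E ^ (\<mu> - k) * \<dots> = X ^ (\<mu> + \<nu> - 2 * k) * Y ^ \<mu> *
      (\<Sum>j\<le>k. of_real (real (k choose j) * real (n choose j) / real (\<nu> choose k)) * (t ^ (\<mu> - k) * (1 - t) ^ j))"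
  proof -
    have "X ^ (\<mu> + \<nu> - 2 * k) = X ^ (\<mu> - k) * X ^ n" "Y ^ \<mu> = Y ^ (\<mu> - k) * Y ^ k"
      using k by (simp_all add: n_def mult_2 flip: power_add)
    then show ?thesis unfolding E power_mult_distrib sum_distrib_left
      by (intro sum.cong refl) (simp only: mult_ac)
  qed
  finally show ?thesis unfolding X_def Y_def n_def of_real_power .
qed

section \<open>The \<open>\<nu>\<close>-independent integrals and the exact formula for
  \<open>Enu\<close>\<close>

definition Dfun :: "nat \<Rightarrow> nat \<Rightarrow> (complex \<Rightarrow> complex) \<Rightarrow> nat \<Rightarrow> complex \<Rightarrow> complex" where
  "Dfun \<mu> k f j \<xi> = (\<integral>z. of_real (sphker \<xi> z) ^ (\<mu> - k) * (1 - of_real (sphker \<xi> z)) ^ j * f z \<partial>iota 0)"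

lemma Dfun_eq_Bber:
  assumes f: "f \<in> bdd_borel"
  shows "Dfun \<mu> k f j \<xi> = (\<Sum>i\<le>j. (of_nat (j choose i) * (-1) ^ i) * Bber (\<mu> - k + i) f \<xi>)"
proof -
  have "Dfun \<mu> k f j \<xi> = (\<integral>z. (\<Sum>i\<le>j. (of_nat (j choose i) * (-1) ^ i) * (of_real (sphker \<xi> z ^ (\<mu> - k + i)) * f z)) \<partial>iota 0)"
  proof -
    have "x ^ (\<mu> - k) * (1 - x) ^ j * y = (\<Sum>i\<le>j. (of_nat (j choose i) * (-1) ^ i) * (x ^ (\<mu> - k + i) * y))" for x y :: complex
    proof -
      have "(1 - x) ^ j = (\<Sum>i\<le>j. of_nat (j choose i) * (-x) ^ i * 1 ^ (j - i))"
        using binomial_ring[of "-x" 1 j] by simp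
      then show ?thesis
        by (simp add: sum_distrib_left sum_distrib_right power_add power_minus[of x] mult_ac)
    qed
    then show ?thesis unfolding Dfun_def by simp
  qed
  also have "\<dots> = (\<Sum>i\<le>j. (of_nat (j choose i) * (-1) ^ i) * (\<integral>z. of_real (sphker \<xi> z ^ (\<mu> - k + i)) * f z \<partial>iota 0))"
    unfolding integral_mult_right_zero[symmetric]
    by (intro Bochner_Integration.integral_sum integrable_mult_right Bber_integrable f)
  finally show ?thesis unfolding Bber_eq .
qed

text \<open>Cleared of its weights, the kernel is a polynomial of bidegree \<open>(m, m)\<close> in
  \<open>z\<close>, so any bounded function is sent into the finite-dimensional space, with its
  weighted moments \<open>M i j\<close> as coefficients.\<close>

lemma Bber_in_ImR:
  assumes f: "f \<in> bdd_borel" and "m \<le> \<mu>"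
  shows "Bber m f \<in> ImR \<mu>"
proof -
  define M where "M i j = (\<integral>s. cnj s ^ i * s ^ j * f s / of_real ((1 + (cmod s)\<^sup>2) ^ m) \<partial>iota 0)" for i j
  have int: "integrable (iota 0) (\<lambda>s. cnj s ^ i * s ^ j * f s / of_real ((1 + (cmod s)\<^sup>2) ^ m))" if "i \<le> m" "j \<le> m" for i j
  proof -
    have "(\<lambda>s. (1 * (s ^ j * cnj s ^ i)) / of_real ((1 + (cmod s)\<^sup>2) ^ m)) \<in> ImR m"
      using that by (intro ImR_I bipoly_monomial) auto
    from bdd_borel_integrable[OF bdd_borel_mult[OF ImR_bdd_borel[OF this] f]] show ?thesis by (simp add: mult_ac)
  qed
  have "Bber m f z = (\<Sum>i\<le>m. \<Sum>j\<le>m. (of_nat (m choose i) * of_nat (m choose j) * M i j) * (z ^ i * cnj z ^ j))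
       / of_real ((1 + (cmod z)\<^sup>2) ^ m)" for z
  proof -
    define Z where "Z = complex_of_real ((1 + (cmod z)\<^sup>2) ^ m)"
    have *: "of_real (sphker z s ^ m) * f s = (\<Sum>i\<le>m. \<Sum>j\<le>m. (of_nat (m choose i) * of_nat (m choose j) * (z ^ i * cnj z ^ j) / Z) *
        (cnj s ^ i * s ^ j * f s / of_real ((1 + (cmod s)\<^sup>2) ^ m)))" for s
    proof -
      define S where "S = complex_of_real ((1 + (cmod s)\<^sup>2) ^ m)"
      have "complex_of_real (sphker z s ^ m) = (1 + z * cnj s) ^ m * (1 + cnj z * s) ^ m / (Z * S)"
        unfolding of_real_power of_real_sphker Z_def S_def by (simp add: power_divide power_mult_distrib mult_ac)
      also have "(1 + z * cnj s) ^ m * (1 + cnj z * s) ^ m = (\<Sum>i\<le>m. \<Sum>j\<le>m. of_nat (m choose i) * of_nat (m choose j) * (z ^ i * cnj z ^ j) * (cnj s ^ i * s ^ j))"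
        unfolding linear_form_power sum_product by (simp add: mult_ac)
      finally show ?thesis unfolding S_def[symmetric]
        by (simp add: sum_distrib_left sum_distrib_right sum_divide_distrib mult_ac)
    qed
    have "Bber m f z = (\<Sum>i\<le>m. \<Sum>j\<le>m. (of_nat (m choose i) * of_nat (m choose j) * (z ^ i * cnj z ^ j) / Z) * M i j)"
      unfolding Bber_eq * M_def integral_mult_right_zero[symmetric]
    proof (subst Bochner_Integration.integral_sum)
      show "(\<Sum>i\<le>m. \<integral>s. (\<Sum>j\<le>m. (of_nat (m choose i) * of_nat (m choose j) * (z ^ i * cnj z ^ j) / Z) *
        (cnj s ^ i * s ^ j * f s / of_real ((1 + (cmod s)\<^sup>2) ^ m))) \<partial>iota 0) =
        (\<Sum>i\<le>m. \<Sum>j\<le>m. \<integral>s. (of_nat (m choose i) * of_nat (m choose j) * (z ^ i * cnj z ^ j) / Z) *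
        (cnj s ^ i * s ^ j * f s / of_real ((1 + (cmod s)\<^sup>2) ^ m)) \<partial>iota 0)"
        by (rule sum.cong[OF refl], rule Bochner_Integration.integral_sum, rule integrable_mult_right, rule int) auto
    qed (intro Bochner_Integration.integrable_sum integrable_mult_right int, auto)
    then show ?thesis unfolding Z_def[symmetric] by (simp add: sum_divide_distrib mult_ac)
  qed
  then have "Bber m f = (\<lambda>z. (\<Sum>i\<le>m. \<Sum>j\<le>m. (of_nat (m choose i) * of_nat (m choose j) * M i j) * (z ^ i * cnj z ^ j))
       / of_real ((1 + (cmod z)\<^sup>2) ^ m))" by (rule ext)
  also have "\<dots> \<in> ImR \<mu>"
    by (rule ImR_I[OF _ \<open>m \<le> \<mu>\<close>]) (intro bipoly_sum bipoly_monomial, auto)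
  finally show ?thesis .
qed

lemma Dfun_in_ImR:
  assumes f: "f \<in> bdd_borel" and "k \<le> \<mu>" "j \<le> k"
  shows "Dfun \<mu> k f j \<in> ImR \<mu>"
proof -
  have "Dfun \<mu> k f j = (\<lambda>\<xi>. \<Sum>i\<le>j. (of_nat (j choose i) * (-1) ^ i) * Bber (\<mu> - k + i) f \<xi>)"
    by (rule ext) (rule Dfun_eq_Bber[OF f])
  also have "\<dots> \<in> ImR \<mu>"
    using assms by (intro ImR_sum ImR_cmult Bber_in_ImR) auto
  finally show ?thesis .
qed

text \<open>The reflection \<open>i = k - l\<close> matches the alternating sum with the expansion
  of \<open>t ^ (\<mu> - k) * (1 - t) ^ k\<close>.\<close>

lemma Emk_eq_Dfun:
  assumes f: "f \<in> bdd_borel" and "k \<le> \<mu>"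
  shows "Emk \<mu> k f \<xi> = of_nat (\<mu> choose k) * Dfun \<mu> k f k \<xi>"
proof -
  have "(\<Sum>l\<le>k. (-1) ^ (k - l) * of_nat (k choose l) * Bber (\<mu> - l) f \<xi>) = (\<Sum>i\<le>k. (of_nat (k choose i) * (-1) ^ i) * Bber (\<mu> - k + i) f \<xi>)"
  proof (rule sum.reindex_bij_witness[of _ "\<lambda>i. k - i" "\<lambda>i. k - i"])
    fix l assume "l \<in> {..k}"
    then show "(of_nat (k choose (k - l)) * (-1) ^ (k - l)) * Bber (\<mu> - k + (k - l)) f \<xi> = (-1) ^ (k - l) * of_nat (k choose l) * Bber (\<mu> - l) f \<xi>"
      using \<open>k \<le> \<mu>\<close> by (simp add: binomial_symmetric[symmetric])
  qed auto
  then show ?thesis unfolding Emk_def Dfun_eq_Bber[OF f] by simp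
qed

text \<open>One factor \<open>Cconst\<close> comes from \<open>Pk\<close> and one from its adjoint;
  the \<open>\<nu> choose k\<close> in their product cancels the denominator in
  \<open>integral_norm_Fxi\<close>. The weight \<open>(1 + |z|^2) ^ \<mu>\<close> from that integral
  converts \<open>iota \<mu>\<close> into \<open>iota 0\<close>, and the resulting
  \<open>\<mu> + 1\<close> cancels the one in \<open>Rstar\<close>.\<close>

lemma Enu_eq:
  assumes f: "f \<in> bdd_borel" and k: "k \<le> \<mu>" "2 * k \<le> \<nu>"
  shows "Enu \<mu> \<nu> k f \<xi> = (\<Sum>j\<le>k. of_real (real (\<mu> choose k) * real (k choose j) *
     (real ((\<nu> - k) choose j) / real ((\<mu> + \<nu> - k + 1) choose k))) * Dfun \<mu> k f j \<xi>)"
proof -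
  define M where "M = \<mu> + \<nu> - 2 * k"
  define C where "C = complex_of_real (Cconst \<mu> \<nu> k)"
  define F where "F = Fxi \<mu> \<nu> k \<xi>"
  define X where "X = complex_of_real ((1 + (cmod \<xi>)\<^sup>2) ^ M)"
  define b where "b j = complex_of_real (real (k choose j) * real ((\<nu> - k) choose j) / real (\<nu> choose k))" for j
  define S where "S z = (\<Sum>j\<le>k. b j * (of_real (sphker \<xi> z) ^ (\<mu> - k) * (1 - of_real (sphker \<xi> z)) ^ j))" for z
  have [measurable]: "f \<in> borel_measurable borel" using f by (simp add: bdd_borel_def)
  have k': "k \<le> \<nu>" using k by simp
  have X0: "X \<noteq> 0" unfolding X_def of_real_eq_0_iff by simp
  have F: "F \<in> Tsp \<mu> \<nu>" unfolding F_def by (rule Fxi_in_Tsp[OF k(1) k'])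
  have norm_F: "(\<integral>w. F z w * cnj (F z w) \<partial>iota \<nu>) = X * of_real ((1 + (cmod z)\<^sup>2) ^ \<mu>) * S z" for z
    unfolding F_def X_def M_def S_def b_def by (rule integral_norm_Fxi[OF k])
  have "opker M (Top \<mu> \<nu> k (Rstar \<mu> f)) \<xi> \<xi> = C * tinner \<mu> \<nu> (tensorI (Rstar \<mu> f) (\<lambda>z w. C * F z w)) F"
    unfolding opker_def Top_def Pkadj_Kker[OF k(1) k', folded M_def] Pk_def Jk_eq_tinner C_def F_def ..
  also have "\<dots> = C * ((\<integral>z. f z * (\<integral>w. C * F z w * cnj (F z w) \<partial>iota \<nu>) \<partial>iota \<mu>) / of_nat (\<mu> + 1))"
    by (subst tinner_tensorI_Rstar[OF f Tsp_cmult[OF F] F]) (rule refl)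
  also have "(\<integral>z. f z * (\<integral>w. C * F z w * cnj (F z w) \<partial>iota \<nu>) \<partial>iota \<mu>) =
     (\<integral>z. (C * X) * (f z * S z * of_real ((1 + (cmod z)\<^sup>2) ^ \<mu>)) \<partial>iota \<mu>)"
    by (intro Bochner_Integration.integral_cong refl)
       (simp only: mult.assoc[of C] integral_mult_right_zero norm_F, simp only: mult_ac)
  also have "\<dots> = (C * X) * (\<integral>z. f z * S z * of_real ((1 + (cmod z)\<^sup>2) ^ \<mu>) \<partial>iota \<mu>)"
    by (rule integral_mult_right_zero)
  also have "(\<integral>z. f z * S z * of_real ((1 + (cmod z)\<^sup>2) ^ \<mu>) \<partial>iota \<mu>) = of_nat (\<mu> + 1) * (\<integral>z. f z * S z \<partial>iota 0)"
  proof -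
    have "a * complex_of_real ((1 + (cmod z)\<^sup>2) ^ \<mu>) / complex_of_real ((1 + (cmod z)\<^sup>2) ^ \<mu>) = a" for a z
      by (rule nonzero_mult_div_cancel_right, unfold of_real_eq_0_iff, simp)
    moreover have "(\<lambda>z. f z * S z * of_real ((1 + (cmod z)\<^sup>2) ^ \<mu>)) \<in> borel_measurable borel"
      unfolding S_def by measurable
    ultimately show ?thesis by (simp only: integral_iota)
  qed
  finally have "opker M (Top \<mu> \<nu> k (Rstar \<mu> f)) \<xi> \<xi> = X * (C\<^sup>2 * (\<integral>z. f z * S z \<partial>iota 0))"
    by (simp add: power2_eq_square del: of_nat_Suc of_nat_add)
  then have "Enu \<mu> \<nu> k f \<xi> = C\<^sup>2 * (\<integral>z. f z * S z \<partial>iota 0)"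
    unfolding Enu_def Rmap_def M_def[symmetric] X_def[symmetric] using X0 by simp
  also have "(\<integral>z. f z * S z \<partial>iota 0) = (\<integral>z. (\<Sum>j\<le>k. b j * (of_real (sphker \<xi> z) ^ (\<mu> - k) * (1 - of_real (sphker \<xi> z)) ^ j * f z)) \<partial>iota 0)"
    unfolding S_def sum_distrib_left by (simp only: mult_ac)
  also have "\<dots> = (\<Sum>j\<le>k. b j * Dfun \<mu> k f j \<xi>)"
    unfolding Dfun_def integral_mult_right_zero[symmetric]
  proof (intro Bochner_Integration.integral_sum integrable_mult_right)
    fix j
    have "cmod (of_real (sphker \<xi> z) ^ (\<mu> - k) * (1 - of_real (sphker \<xi> z)) ^ j) \<le> 1" for z
    proof -
      have "complex_of_real (sphker \<xi> z) ^ (\<mu> - k) * (1 - of_real (sphker \<xi> z)) ^ j = of_real (sphker \<xi> z ^ (\<mu> - k) * (1 - sphker \<xi> z) ^ j)"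
        by simp
      then show ?thesis using sphker_bounds[of \<xi> z]
        by (simp only: norm_of_real) (auto intro!: mult_le_one power_le_one simp: abs_mult)
    qed
    then have "(\<lambda>z. of_real (sphker \<xi> z) ^ (\<mu> - k) * (1 - of_real (sphker \<xi> z)) ^ j) \<in> bdd_borel"
      unfolding bdd_borel_def by auto
    from bdd_borel_integrable[OF bdd_borel_mult[OF this f]]
    show "integrable (iota 0) (\<lambda>z. of_real (sphker \<xi> z) ^ (\<mu> - k) * (1 - of_real (sphker \<xi> z)) ^ j * f z)" .
  qed
  finally have "Enu \<mu> \<nu> k f \<xi> = (\<Sum>j\<le>k. C\<^sup>2 * b j * Dfun \<mu> k f j \<xi>)"
    by (simp only: sum_distrib_left mult.assoc)
  moreover have "C\<^sup>2 * b j = of_real (real (\<mu> choose k) * real (k choose j) *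
     (real ((\<nu> - k) choose j) / real ((\<mu> + \<nu> - k + 1) choose k)))" for j
    unfolding C_def b_def of_real_power[symmetric] of_real_mult[symmetric] Cconst_squared[OF k(1) k']
    using k' by simp
  ultimately show ?thesis by simp
qed

lemma CP1_bdd_borel: "f \<in> CP1 \<Longrightarrow> f \<in> bdd_borel"
proof -
  assume "f \<in> CP1"
  then obtain L where cont: "continuous_on UNIV f" and L: "(f \<longlongrightarrow> L) at_infinity"
    unfolding CP1_def by blast
  have "eventually (\<lambda>z. dist (f z) L < 1) at_infinity" using L by (rule tendstoD) simp
  then obtain R where R: "\<And>z. R \<le> cmod z \<Longrightarrow> dist (f z) L < 1"
    unfolding eventually_at_infinity by blast
  have "compact (f ` cball 0 R)"
    by (intro compact_continuous_image continuous_on_subset[OF cont]) auto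
  then have "bounded (f ` cball 0 R)" by (rule compact_imp_bounded)
  then obtain B where "\<forall>x\<in>f ` cball 0 R. cmod x \<le> B" unfolding bounded_iff ..
  then have B: "cmod (f z) \<le> B" if "z \<in> cball 0 R" for z using that by simp
  have "cmod (f z) \<le> max B (cmod L + 1)" for z
  proof (cases "cmod z \<le> R")
    case True
    then show ?thesis using B[of z] by simp
  next
    case False
    then have "cmod (f z - L) < 1" using R[of z] by (simp add: dist_norm)
    then show ?thesis using norm_triangle_sub[of "f z" L] by simp
  qed
  moreover have "f \<in> borel_measurable borel" using cont by (rule borel_measurable_continuous_onI)
  ultimately show ?thesis unfolding bdd_borel_def by blast
qed

lemma invB_Enu_tendsto:
  assumes "k \<le> \<mu>" and f: "f \<in> bdd_borel"
  shows "uniform_limit UNIV (\<lambda>\<nu>. invB (real (\<mu> + \<nu> - 2 * k) + 1) (\<mu> + \<nu> - 2 * k) \<mu> (Enu \<mu> \<nu> k f)) (Emk \<mu> k f) sequentially"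
proof -
  define \<tau> where "\<tau> \<nu> = \<mu> + \<nu> - 2 * k" for \<nu>
  define \<gamma> where "\<gamma> \<nu> j = real (\<mu> choose k) * real (k choose j) * (real ((\<nu> - k) choose j) / real ((\<mu> + \<nu> - k + 1) choose k))" for \<nu> j
  have \<tau>: "filterlim \<tau> sequentially sequentially"
    unfolding filterlim_at_top
  proof
    fix Z
    show "eventually (\<lambda>\<nu>. Z \<le> \<tau> \<nu>) sequentially"
      using eventually_ge_at_top[of "Z + 2 * k"] by eventually_elim (simp add: \<tau>_def)
  qed
  have \<gamma>: "(\<lambda>\<nu>. \<gamma> \<nu> j) \<longlonglongrightarrow> (if j = k then real (\<mu> choose k) else 0)" if "j \<le> k" for j
  \<comment> \<open>Shifting by \<open>k\<close> replaces the truncated difference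
    \<open>\<nu> - k\<close> by \<open>n\<close> and brings the quotient into the shape of
    \<open>binomial_ratio_tendsto\<close> with shifts 0 and \<open>\<mu> + 1\<close>.\<close>
  proof (rule LIMSEQ_offset[of _ k])
    have "(\<lambda>n. real (\<mu> choose k) * real (k choose j) * (real ((n + 0) choose j) / real ((n + (\<mu> + 1)) choose k)))
       \<longlonglongrightarrow> real (\<mu> choose k) * real (k choose j) * (if j = k then 1 else 0)"
      by (intro tendsto_mult tendsto_const binomial_ratio_tendsto that)
    then show "(\<lambda>n. \<gamma> (n + k) j) \<longlonglongrightarrow> (if j = k then real (\<mu> choose k) else 0)"
      unfolding \<gamma>_def by (cases "j = k") (simp_all add: add_ac)
  qed
  have "uniform_limit UNIV (\<lambda>\<nu> z. \<Sum>j\<le>k. of_real (\<gamma> \<nu> j) * invB (real (\<tau> \<nu>) + 1) (\<tau> \<nu>) \<mu> (Dfun \<mu> k f j) z)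
     (\<lambda>z. \<Sum>j\<le>k. of_real (if j = k then real (\<mu> choose k) else 0) * Dfun \<mu> k f j z) sequentially"
  proof (intro uniform_limit_sum_fun uniform_lim_mult)
    fix j assume "j \<in> {..k}"
    then have j: "j \<le> k" by simp
    have D: "Dfun \<mu> k f j \<in> ImR \<mu>" by (rule Dfun_in_ImR[OF f assms(1) j])
    show "uniform_limit UNIV (\<lambda>\<nu> z. complex_of_real (\<gamma> \<nu> j)) (\<lambda>z. of_real (if j = k then real (\<mu> choose k) else 0)) sequentially"
      using tendsto_of_real[OF \<gamma>[OF j], where 'a = complex] by (auto simp: uniform_limit_iff tendsto_iff)
    show "uniform_limit UNIV (\<lambda>\<nu> z. invB (real (\<tau> \<nu>) + 1) (\<tau> \<nu>) \<mu> (Dfun \<mu> k f j) z) (Dfun \<mu> k f j) sequentially"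
      using filterlim_compose[OF invB_tendsto[OF D] \<tau>] .
    show "bounded (Dfun \<mu> k f j ` UNIV)" using ImR_bdd_borel[OF D] by (auto simp: bdd_borel_def bounded_iff)
  qed (auto simp: bounded_iff)
  moreover have "(\<lambda>z. \<Sum>j\<le>k. complex_of_real (if j = k then real (\<mu> choose k) else 0) * Dfun \<mu> k f j z) = Emk \<mu> k f"
    by (rule ext) (simp add: Emk_eq_Dfun[OF f assms(1)] if_distrib if_distribR sum.delta cong: if_cong)
  ultimately have lim: "uniform_limit UNIV (\<lambda>\<nu> z. \<Sum>j\<le>k. of_real (\<gamma> \<nu> j) * invB (real (\<tau> \<nu>) + 1) (\<tau> \<nu>) \<mu> (Dfun \<mu> k f j) z) (Emk \<mu> k f) sequentially"
    by (simp only:)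
  have "eventually (\<lambda>\<nu>. \<forall>z\<in>UNIV. (\<Sum>j\<le>k. of_real (\<gamma> \<nu> j) * invB (real (\<tau> \<nu>) + 1) (\<tau> \<nu>) \<mu> (Dfun \<mu> k f j) z)
      = invB (real (\<tau> \<nu>) + 1) (\<tau> \<nu>) \<mu> (Enu \<mu> \<nu> k f) z) sequentially"
    \<comment> \<open>From \<open>2 * k \<le> \<nu>\<close> on no subtraction is truncated and
      \<open>\<mu> \<le> \<tau> \<nu>\<close>, so the formula for \<open>Enu\<close> and the inverse
      are both available.\<close>
    using eventually_ge_at_top[of "2 * k"]
  proof eventually_elim
    case (elim \<nu>)
    have "Enu \<mu> \<nu> k f = (\<lambda>z. \<Sum>j\<le>k. of_real (\<gamma> \<nu> j) * Dfun \<mu> k f j z)"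
      unfolding \<gamma>_def by (rule ext) (rule Enu_eq[OF f assms(1) elim])
    moreover have "\<mu> \<le> \<tau> \<nu>" using elim by (simp add: \<tau>_def)
    ultimately show ?case
      by (simp only:) (subst invB_lincomb, auto intro: Dfun_in_ImR[OF f assms(1)])
  qed
  from uniform_limit_cong[OF this, of "Emk \<mu> k f" "Emk \<mu> k f"] lim show ?thesis
    unfolding \<tau>_def by simp
qed

theorem mainTheorem6:
  fixes k \<mu> :: nat
  assumes "k \<le> \<mu>"
  shows "(\<forall>f\<in>ImR \<mu>. uniform_limit UNIV (\<lambda>\<nu>. invB (real \<nu> + 1) \<nu> \<mu> f) f sequentially)
       \<and> (\<forall>f\<in>CP1. uniform_limit UNIV
            (\<lambda>\<nu>. invB (real (\<mu> + \<nu> - 2 * k) + 1) (\<mu> + \<nu> - 2 * k) \<mu> (Enu \<mu> \<nu> k f))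
            (Emk \<mu> k f) sequentially)"
  using invB_tendsto invB_Enu_tendsto[OF assms CP1_bdd_borel] by blast

end
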